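(* Let $q=p^m$ with $p$ prime and $m\ge 1$, let $n\ge 1$ and $1\le r\le n(q-1)$. The composition factors of the $\mathrm{GL}(n,\mathbb F_q)$-module $H_q(r,n)$ are the modules $\mathfrak M(\boldsymbol t)$, $\boldsymbol t\in T(\Omega_{q,n,r})$, each appearing exactly once. These factors are pairwise nonisomorphic, and for $\boldsymbol t=(t_0,\dots,t_{m-1})\in T(\Omega_{q,n,r})$, putting $s_0=t_0$ and $s_j=(t_j-t_{j-1})/p^j$ for $1\le j\le m-1$, their dimensions are $$\dim_{\mathbb F_q}\mathfrak M(\boldsymbol t)=|T^{-1}(\boldsymbol t)|=\prod_{j=0}^{m-1}\Bigl(\sum_{0\le k\le s_j/p}(-1)^k\binom nk\binom{n-1+s_j-kp}{n-1}\Bigr).$$ The length of the composition series of $H_q(r,n)$ is $|T(\Omega_{q,n,r})|$.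
   Context: $\mathcal F(\mathbb F_q^n,\mathbb F_q)$ is the $\mathbb F_q$-algebra of all functions $\mathbb F_q^n\to\mathbb F_q$. Each such function is uniquely represented by a reduced polynomial ($\deg_{X_i}\le q-1$ for all $i$); its degree is the degree of that polynomial. $R_q(r,n)=\{f\in\mathcal F(\mathbb F_q^n,\mathbb F_q):\deg f\le r\}$ for $0\le r\le n(q-1)$, $R_q(-1,n)=\{0\}$, and $H_q(r,n)=R_q(r,n)/R_q(r-1,n)$. $\mathrm{GL}(n,\mathbb F_q)$ acts by $A(f)=f((X_1,\dots,X_n)A)$, which induces a $\mathrm{GL}(n,\mathbb F_q)$-module structure (over $\mathbb F_q$) on $H_q(r,n)$. $\Omega_{q,n,r}=\{\boldsymbol i=(i_1,\dots,i_n)\in\{0,\dots,q-1\}^n:i_1+\cdots+i_n=r\}$ and $X^{\boldsymbol i}=X_1^{i_1}\cdots X_n^{i_n}$; the classes of $X^{\boldsymbol i}$, $\boldsymbol i\in\Omega_{q,n,r}$ (again denoted $X^{\boldsymbol i}$), form an $\mathbb F_q$-basis of $H_q(r,n)$. For $\boldsymbol i\in\Omega_{q,n,r}$ write $i_j=\sum_{k=0}^{m-1}i_{jk}p^k$ with $0\le i_{jk}\le p-1$, and define $T(\boldsymbol i)=(t_0,\dots,t_{m-1})\in\mathbb N^m$ by $t_k=\sum_{l=0}^{k}\sum_{j=1}^n i_{jl}p^l$. The image $T(\Omega_{q,n,r})$ is partially ordered componentwise: $(t_k)\le(t_k')$ iff $t_k\le t_k'$ for all $k$. An ideal is a subset $I\subset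 T(\Omega_{q,n,r})$ such that $\boldsymbol t\in I$, $\boldsymbol t'\in T(\Omega_{q,n,r})$, $\boldsymbol t'\le\boldsymbol t$ imply $\boldsymbol t'\in I$. For an ideal $I$, $M(I)$ is the $\mathbb F_q$-span of $\{X^{\boldsymbol i}:\boldsymbol i\in T^{-1}(I)\}$ in $H_q(r,n)$; it is a $\mathrm{GL}(n,\mathbb F_q)$-submodule of $H_q(r,n)$. For $\boldsymbol t\in T(\Omega_{q,n,r})$, let $I(\boldsymbol t)=\{\boldsymbol t'\in T(\Omega_{q,n,r}):\boldsymbol t'\le\boldsymbol t\}$ and $\mathfrak M(\boldsymbol t)=M(I(\boldsymbol t))/M(I(\boldsymbol t)\setminus\{\boldsymbol t\})$. *)

theory Defs
  imports
    "HOL-Analysis.Cartesian_Space"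
    "HOL-Library.Poly_Mapping"
    "HOL-Algebra.Algebraic_Closure_Type"
    "Jordan_Normal_Form.Missing_VectorSpace"
begin

section \<open>Linear representations, quotients and composition series\<close>

text \<open>A vector space together with an action of a group (elements of type \<open>'g\<close>).\<close>

record ('k, 'v, 'g) gmod = "('k, 'v) module" +
  act :: "'g \<Rightarrow> 'v \<Rightarrow> 'v"

locale linear_rep =
  vectorspace K V + G: group G
  for G :: "('g, 'h) monoid_scheme" and K :: "('k, 'l) ring_scheme"
    and V :: "('k, 'v, 'g, 'z) gmod_scheme" +
  assumes act_hom: "g \<in> carrier G \<Longrightarrow> act V g \<in> module_hom K V V"
    and act_one: "v \<in> carrier V \<Longrightarrow> act V \<one>\<^bsub>G\<^esub> v = v"
    and act_mult: "\<lbrakk>g \<in> carrier G; h \<in> carrier G; v \<in> carrier V\<rbrakk>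
      \<Longrightarrow> act V (g \<otimes>\<^bsub>G\<^esub> h) v = act V g (act V h v)"

definition subrep ::
  "('g, 'h) monoid_scheme \<Rightarrow> ('k, 'l) ring_scheme \<Rightarrow> 'v set \<Rightarrow> ('k, 'v, 'g, 'z) gmod_scheme \<Rightarrow> bool"
where
  "subrep G K W V \<longleftrightarrow>
    LinearCombinations.submodule K W V \<and> (\<forall>g\<in>carrier G. \<forall>w\<in>W. act V g w \<in> W)"

definition simple_rep ::
  "('g, 'h) monoid_scheme \<Rightarrow> ('k, 'l) ring_scheme \<Rightarrow> ('k, 'v, 'g, 'z) gmod_scheme \<Rightarrow> bool"
where
  "simple_rep G K V \<longleftrightarrow>
    linear_rep G K V \<and> carrier V \<noteq> {\<zero>\<^bsub>V\<^esub>} \<and>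
    (\<forall>W. subrep G K W V \<longrightarrow> W = {\<zero>\<^bsub>V\<^esub>} \<or> W = carrier V)"

definition rep_iso ::
  "('g, 'h) monoid_scheme \<Rightarrow> ('k, 'l) ring_scheme \<Rightarrow>
   ('k, 'v, 'g, 'y) gmod_scheme \<Rightarrow> ('k, 'w, 'g, 'z) gmod_scheme \<Rightarrow> bool"
where
  "rep_iso G K V W \<longleftrightarrow>
    (\<exists>\<phi>\<in>module_hom K V W. bij_betw \<phi> (carrier V) (carrier W) \<and>
      (\<forall>g\<in>carrier G. \<forall>v\<in>carrier V. \<phi> (act V g v) = act W g (\<phi> v)))"

text \<open>The quotient \<open>V / N\<close> on the set of additive cosets of \<open>N\<close>.  Scalars and group elements act
  through representatives.  The multiplicative fields \<open>mult\<close> and \<open>one\<close>, present only because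
  module records extend ring records, carry no information.\<close>

definition quot_rep :: "('k, 'v, 'g, 'z) gmod_scheme \<Rightarrow> 'v set \<Rightarrow> ('k, 'v set, 'g) gmod" where
  "quot_rep V N =
    \<lparr>carrier = a_rcosets\<^bsub>V\<^esub> N,
     monoid.mult = undefined, monoid.one = undefined,
     ring.zero = N,
     ring.add = set_add V,
     module.smult = (\<lambda>a C. \<Union>x\<in>C. N +>\<^bsub>V\<^esub> (a \<odot>\<^bsub>V\<^esub> x)),
     act = (\<lambda>g C. \<Union>x\<in>C. N +>\<^bsub>V\<^esub> act V g x)\<rparr>"

text \<open>The subquotient \<open>A / B\<close> of \<open>V\<close>.\<close>

definition subquot :: "('k, 'v, 'g, 'z) gmod_scheme \<Rightarrow> 'v set \<Rightarrow> 'v set \<Rightarrow> ('k, 'v set, 'g) gmod" where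
  "subquot V A B = quot_rep (V\<lparr>carrier := A\<rparr>) B"

text \<open>\<open>W 0 \<subset> W 1 \<subset> \<dots> \<subset> W l\<close> is a composition series of length \<open>l\<close>; values \<open>W i\<close> with \<open>i > l\<close> are
  irrelevant.  Strictness of the inclusions is part of the simplicity of the factors.\<close>

definition composition_series ::
  "('g, 'h) monoid_scheme \<Rightarrow> ('k, 'l) ring_scheme \<Rightarrow> ('k, 'v, 'g, 'z) gmod_scheme \<Rightarrow>
   nat \<Rightarrow> (nat \<Rightarrow> 'v set) \<Rightarrow> bool"
where
  "composition_series G K V l W \<longleftrightarrow>
    linear_rep G K V \<and> W 0 = {\<zero>\<^bsub>V\<^esub>} \<and> W l = carrier V \<and>
    (\<forall>i\<le>l. subrep G K (W i) V) \<and>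
    (\<forall>i<l. W i \<subseteq> W (Suc i) \<and> simple_rep G K (subquot V (W (Suc i)) (W i)))"


section \<open>Functions on \<open>F\<^sub>q\<^sup>n\<close> and their degree\<close>

text \<open>Here \<open>F\<^sub>q\<close> is a finite field type \<open>'a\<close> (so \<open>q = CARD('a)\<close>), the coordinates are indexed by a
  finite type \<open>'n\<close> (so \<open>n = CARD('n)\<close>), multi-indices have type \<open>'n \<Rightarrow>\<^sub>0 nat\<close> and polynomials in the
  variables \<open>X\<^sub>j\<close> have type \<open>('n \<Rightarrow>\<^sub>0 nat) \<Rightarrow>\<^sub>0 'a\<close>.\<close>

definition monom_fun :: "('n \<Rightarrow>\<^sub>0 nat) \<Rightarrow> ('a::field)^('n::finite) \<Rightarrow> 'a" where
  "monom_fun i x = (\<Prod>j\<in>UNIV. (x $ j) ^ Poly_Mapping.lookup i j)"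

definition mpoly_fun :: "(('n \<Rightarrow>\<^sub>0 nat) \<Rightarrow>\<^sub>0 'a) \<Rightarrow> ('a::field)^('n::finite) \<Rightarrow> 'a" where
  "mpoly_fun P x = (\<Sum>i\<in>Poly_Mapping.keys P. Poly_Mapping.lookup P i * monom_fun i x)"

definition abs_index :: "(('n::finite) \<Rightarrow>\<^sub>0 nat) \<Rightarrow> nat" where
  "abs_index i = (\<Sum>j\<in>UNIV. Poly_Mapping.lookup i j)"

definition reduced :: "((('n::finite) \<Rightarrow>\<^sub>0 nat) \<Rightarrow>\<^sub>0 ('a::{finite,field})) \<Rightarrow> bool" where
  "reduced P \<longleftrightarrow>
    (\<forall>i\<in>Poly_Mapping.keys P. \<forall>j. Poly_Mapping.lookup i j \<le> CARD('a) - 1)"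

text \<open>The zero polynomial gets degree \<open>-1\<close>, so that \<open>RM (-1) = {0}\<close> below.\<close>

definition total_deg :: "((('n::finite) \<Rightarrow>\<^sub>0 nat) \<Rightarrow>\<^sub>0 ('a::zero)) \<Rightarrow> int" where
  "total_deg P = Max (insert (- 1) ((\<lambda>i. int (abs_index i)) ` Poly_Mapping.keys P))"

definition fun_deg :: "(('a::{finite,field})^('n::finite) \<Rightarrow> 'a) \<Rightarrow> int" where
  "fun_deg f = total_deg (THE P. reduced P \<and> mpoly_fun P = f)"

text \<open>The set \<open>R\<^sub>q(r, n)\<close>.\<close>

definition RM :: "int \<Rightarrow> (('a::{finite,field})^('n::finite) \<Rightarrow> 'a) set" where
  "RM r = {f. fun_deg f \<le> r}"


section \<open>The \<open>GL(n, F\<^sub>q)\<close>-modules\<close>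

definition GL :: "(('a::field)^('n::finite)^'n) monoid" where
  "GL = \<lparr>carrier = {A. invertible A}, monoid.mult = (**), monoid.one = mat 1\<rparr>"

text \<open>All functions \<open>F\<^sub>q\<^sup>n \<rightarrow> F\<^sub>q\<close> with the action \<open>A(f) = f((X\<^sub>1, \<dots>, X\<^sub>n)A)\<close>.\<close>

definition fun_rep :: "('a::field, 'a^('n::finite) \<Rightarrow> 'a, 'a^'n^'n) gmod" where
  "fun_rep =
    \<lparr>carrier = UNIV, monoid.mult = (\<lambda>f g x. f x * g x), monoid.one = (\<lambda>_. 1), ring.zero = (\<lambda>_. 0),
     ring.add = (\<lambda>f g x. f x + g x), module.smult = (\<lambda>c f x. c * f x),
     act = (\<lambda>A f x. f (x v* A))\<rparr>"

text \<open>The module \<open>H\<^sub>q(r, n) = R\<^sub>q(r, n) / R\<^sub>q(r - 1, n)\<close>.\<close>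

definition Hq ::
  "int \<Rightarrow> ('a::{finite,field}, ('a^('n::finite) \<Rightarrow> 'a) set, 'a^'n^'n) gmod"
where
  "Hq r = subquot fun_rep (RM r) (RM (r - 1))"

definition monom_class :: "int \<Rightarrow> ('n \<Rightarrow>\<^sub>0 nat) \<Rightarrow> (('a::{finite,field})^('n::finite) \<Rightarrow> 'a) set" where
  "monom_class r i = RM (r - 1) +>\<^bsub>fun_rep\<^esub> monom_fun i"

definition Omega :: "nat \<Rightarrow> nat \<Rightarrow> (('n::finite) \<Rightarrow>\<^sub>0 nat) set" where
  "Omega q r = {i. (\<forall>j. Poly_Mapping.lookup i j \<le> q - 1) \<and> abs_index i = r}"

definition digit :: "nat \<Rightarrow> nat \<Rightarrow> nat \<Rightarrow> nat" where
  "digit p k a = a div p ^ k mod p"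

text \<open>Elements of \<open>\<nat>\<^sup>m\<close> are lists of length \<open>m\<close>, ordered by \<open>list_all2 (\<le>)\<close>.\<close>

definition Tmap :: "nat \<Rightarrow> nat \<Rightarrow> (('n::finite) \<Rightarrow>\<^sub>0 nat) \<Rightarrow> nat list" where
  "Tmap p m i =
    map (\<lambda>k. \<Sum>l\<le>k. \<Sum>j\<in>UNIV. digit p l (Poly_Mapping.lookup i j) * p ^ l) [0..<m]"

text \<open>The submodule \<open>M(I)\<close> of \<open>H\<^sub>q(r, n)\<close>, where \<open>q = p\<^sup>m\<close>.\<close>

definition M_ideal ::
  "nat \<Rightarrow> nat \<Rightarrow> nat \<Rightarrow> nat list set \<Rightarrow> (('a::{finite,field})^('n::finite) \<Rightarrow> 'a) set set"
where
  "M_ideal p m r I =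
    LinearCombinations.module.span (ring_of_type_algebra :: 'a ring)
      (Hq (int r) :: ('a, ('a^'n \<Rightarrow> 'a) set, 'a^'n^'n) gmod)
      (monom_class (int r) ` {i \<in> Omega (p ^ m) r. Tmap p m i \<in> I})"

text \<open>The factor \<open>M(I(t)) / M(I(t) - {t})\<close>, with \<open>I(t)\<close> the principal ideal generated by \<open>t\<close>.\<close>

definition M_factor ::
  "nat \<Rightarrow> nat \<Rightarrow> nat \<Rightarrow> nat list \<Rightarrow>
   ('a::{finite,field}, ('a^('n::finite) \<Rightarrow> 'a) set set, 'a^'n^'n) gmod"
where
  "M_factor p m r t =
    (let I = {t' \<in> Tmap p m ` (Omega (p ^ m) r :: ('n \<Rightarrow>\<^sub>0 nat) set). list_all2 (\<le>) t' t}
     in subquot (Hq (int r)) (M_ideal p m r I) (M_ideal p m r (I - {t})))"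

text \<open>On \<open>Tmap p m ` Omega (p ^ m) r\<close> the subtraction does not truncate and the division is exact.\<close>

definition s_coord :: "nat \<Rightarrow> nat list \<Rightarrow> nat \<Rightarrow> nat" where
  "s_coord p t j = (if j = 0 then t ! 0 else (t ! j - t ! (j - 1)) div p ^ j)"

end

theory Submission
  imports Defs "HOL-Computational_Algebra.Formal_Power_Series"
begin

text \<open>
  Every submodule of \<open>H\<^sub>q(r, n)\<close> is spanned by monomials, because the group algebra contains operators
  that act on \<open>H\<^sub>q(r, n)\<close> as the projections onto single monomials.  Averaging over the torus separates
  exponents up to congruence modulo \<open>q - 1\<close>; two congruent exponents of the same degree have the entries
  \<open>(q - 1, 0)\<close> and \<open>(0, q - 1)\<close> at some pair of coordinates, and are separated by moving
  \<open>x\<^sub>j\<^sup>q\<^sup>-\<^sup>1\<close> to \<open>x\<^sub>l\<close> and back.  The coefficient of \<open>c\<^sup>k\<close>, \<open>k = p\<^sup>e\<close>, in the substitution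
  \<open>x\<^sub>j \<mapsto> x\<^sub>j + c x\<^sub>l\<close> moves one unit of the base-\<open>p\<close> digit \<open>e\<close> from \<open>x\<^sub>j\<close> to \<open>x\<^sub>l\<close>, possibly with a carry,
  and such moves lead from an exponent to every exponent with a smaller value of \<open>T\<close>.  Conversely, by the
  Frobenius endomorphism, a linear substitution turns a monomial into monomials with values of \<open>T\<close> that
  are at most as large.  So submodules correspond to ideals and composition series to maximal chains
  of ideals.  An isomorphism commutes with the projections, hence cannot identify factors that are spanned
  by different monomials.
\<close>

section \<open>Representations, quotients and the group algebra\<close>

text \<open>Moving \<open>p^e\<close> out of \<open>x_j\<close> produces the factor
  \<open>i_j choose p^e\<close>, which in characteristic \<open>p\<close> equals
  \<open>i_j div p^e\<close>; it is nonzero exactly when the base-\<open>p\<close> digit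
  \<open>e\<close> of \<open>i_j\<close> is positive. A move without carry keeps all digit sums,
  hence \<open>T\<close>; a move with a single carry out of position \<open>e\<close> lowers
  \<open>t_e\<close> by \<open>p^(e+1)\<close> and leaves the other entries alone. In the other
  direction, \<open>t_k\<close> is the sum of the residues of the exponents modulo
  \<open>p^(k+1)\<close>, and residues are subadditive, so bounds on factors add up to bounds on
  products. One obstacle is that a coefficient in \<open>c\<close> can only be extracted by summing
  over the \<open>q\<close> field elements, where positive exponents count only modulo
  \<open>q - 1\<close>, so that \<open>0\<close> and \<open>q - 1\<close> are easily confused. The
  computations take place in functions: a submodule of \<open>H_q(r,n)\<close> is replaced by its
  preimage between \<open>R_q(r-1,n)\<close> and \<open>R_q(r,n)\<close>. There, unreduced monomials
  of degree at most \<open>r\<close> do no harm, because \<open>x^q = x\<close> lowers their degree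
  and puts them into \<open>R_q(r-1,n)\<close>.\<close>

lemma quot_rep_simps [simp]:
  "carrier (quot_rep V N) = a_rcosets\<^bsub>V\<^esub> N"
  "\<zero>\<^bsub>quot_rep V N\<^esub> = N"
  "C \<oplus>\<^bsub>quot_rep V N\<^esub> D = C <+>\<^bsub>V\<^esub> D"
  by (auto simp: quot_rep_def)

context linear_rep
begin

lemma
  assumes "subrep G K W V"
  shows subrep_subset: "W \<subseteq> carrier V"
    and subrep_carrierD: "w \<in> W \<Longrightarrow> w \<in> carrier V"
    and subrep_zero: "\<zero>\<^bsub>V\<^esub> \<in> W"
    and subrep_add: "x \<in> W \<Longrightarrow> y \<in> W \<Longrightarrow> x \<oplus>\<^bsub>V\<^esub> y \<in> W"
    and subrep_smult: "a \<in> carrier K \<Longrightarrow> x \<in> W \<Longrightarrow> a \<odot>\<^bsub>V\<^esub> x \<in> W"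
    and subrep_act: "g \<in> carrier G \<Longrightarrow> x \<in> W \<Longrightarrow> act V g x \<in> W"
  using assms by (auto simp: subrep_def LinearCombinations.submodule_def)

lemma subrep_minus: "subrep G K W V \<Longrightarrow> x \<in> W \<Longrightarrow> \<ominus>\<^bsub>V\<^esub> x \<in> W"
  using subrep_smult[of W "\<ominus>\<^bsub>K\<^esub> \<one>\<^bsub>K\<^esub>" x] subrep_carrierD[of W x] smult_minus_1[of x] by auto

lemma subrepI:
  assumes "W \<subseteq> carrier V" "\<zero>\<^bsub>V\<^esub> \<in> W"
    "\<And>x y. x \<in> W \<Longrightarrow> y \<in> W \<Longrightarrow> x \<oplus>\<^bsub>V\<^esub> y \<in> W"
    "\<And>a x. a \<in> carrier K \<Longrightarrow> x \<in> W \<Longrightarrow> a \<odot>\<^bsub>V\<^esub> x \<in> W"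
    "\<And>g x. g \<in> carrier G \<Longrightarrow> x \<in> W \<Longrightarrow> act V g x \<in> W"
  shows "subrep G K W V"
  using assms module_axioms by (auto simp: subrep_def LinearCombinations.submodule_def)

lemma
  assumes "g \<in> carrier G" "v \<in> carrier V"
  shows act_closed: "act V g v \<in> carrier V"
    and act_add: "w \<in> carrier V \<Longrightarrow> act V g (v \<oplus>\<^bsub>V\<^esub> w) = act V g v \<oplus>\<^bsub>V\<^esub> act V g w"
    and act_smult: "a \<in> carrier K \<Longrightarrow> act V g (a \<odot>\<^bsub>V\<^esub> v) = a \<odot>\<^bsub>V\<^esub> act V g v"
  using act_hom[of g] assms by (auto simp: module_hom_def)

lemma diff_eq_zero_iff:
  "x \<in> carrier V \<Longrightarrow> y \<in> carrier V \<Longrightarrow> x \<ominus>\<^bsub>V\<^esub> y = \<zero>\<^bsub>V\<^esub> \<longleftrightarrow> x = y"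
  by (metis a_inv_closed minus_eq minus_equality minus_minus r_neg)

lemma subrep_carrier: "subrep G K (carrier V) V"
  by (intro subrepI) (auto simp: act_closed)

lemma linear_rep_restrict:
  assumes "subrep G K A V"
  shows "linear_rep G K (vs A)"
proof -
  have s: "LinearCombinations.submodule K A V" using assms by (simp add: subrep_def)
  have A: "A \<subseteq> carrier V" using assms by (rule subrep_subset)
  have vs: "vectorspace K (vs A)"
    by (intro vectorspace.intro submodule_is_module[OF s] field_axioms)
  show ?thesis
  proof (rule linear_rep.intro[OF vs G.group_axioms linear_rep_axioms.intro])
    fix g assume "g \<in> carrier G"
    then show "act (vs A) g \<in> module_hom K (vs A) (vs A)"
      using A assms by (auto simp: module_hom_def subrep_act act_add act_smult subset_iff)
  next
    fix v assume "v \<in> carrier (vs A)"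
    then show "act (vs A) \<one>\<^bsub>G\<^esub> v = v" using A act_one[of v] by auto
  next
    fix g h v assume "g \<in> carrier G" "h \<in> carrier G" "v \<in> carrier (vs A)"
    then show "act (vs A) (g \<otimes>\<^bsub>G\<^esub> h) v =
        act (vs A) g (act (vs A) h v)" using A act_mult[of g h v] by auto
  qed
qed

lemma subrep_restrict_iff:
  assumes "subrep G K A V"
  shows "subrep G K W (vs A) \<longleftrightarrow> subrep G K W V \<and> W \<subseteq> A"
proof -
  have "Module.module K (vs A)"
    using linear_rep_restrict[OF assms] by (simp add: linear_rep_def vectorspace_def)
  then show ?thesis
    using module_axioms subrep_subset[OF assms]
    by (auto simp: subrep_def LinearCombinations.submodule_def)
qed

lemma subrep_abelian_subgroup:
  assumes "subrep G K N V" shows "abelian_subgroup N V"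
proof (rule abelian_subgroupI3)
  show "additive_subgroup N V"
  proof (intro additive_subgroup.intro group.subgroupI)
    show "group (add_monoid V)" by (rule add.is_group)
    show "N \<subseteq> carrier (add_monoid V)" using subrep_subset[OF assms] by simp
    show "N \<noteq> {}" using subrep_zero[OF assms] by blast
    show "\<And>a. a \<in> N \<Longrightarrow> inv\<^bsub>add_monoid V\<^esub> a \<in> N"
      using subrep_minus[OF assms] by (simp add: a_inv_def)
    show "\<And>a b. a \<in> N \<Longrightarrow> b \<in> N \<Longrightarrow> a \<otimes>\<^bsub>add_monoid V\<^esub> b \<in> N"
      using subrep_add[OF assms] by simp
  qed
qed unfold_locales

lemma coset_eq_iff:
  assumes "subrep G K N V" "x \<in> carrier V" "y \<in> carrier V"
  shows "N +>\<^bsub>V\<^esub> x = N +>\<^bsub>V\<^esub> y \<longleftrightarrow> x \<ominus>\<^bsub>V\<^esub> y \<in> N"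
proof -
  interpret N: abelian_subgroup N V by (rule subrep_abelian_subgroup[OF assms(1)])
  show ?thesis
    using N.a_repr_independence'[of x y] N.a_repr_independenceD[of x y] assms(2,3) N.a_rcos_module[of y x]
    by (auto simp: a_minus_def)
qed

text \<open>The union in the definition of the scalar action runs over all representatives. They
  differ by elements of \<open>N\<close>, which scalars preserve, so every term of the union is the
  same coset. The group action is treated in the same way below.\<close>

lemma quot_smult:
  assumes N: "subrep G K N V" and a: "a \<in> carrier K" and v: "v \<in> carrier V"
  shows "a \<odot>\<^bsub>quot_rep V N\<^esub> (N +>\<^bsub>V\<^esub> v) = N +>\<^bsub>V\<^esub> (a \<odot>\<^bsub>V\<^esub> v)"
proof -
  interpret N: abelian_subgroup N V by (rule subrep_abelian_subgroup[OF N])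
  have *: "N +>\<^bsub>V\<^esub> (a \<odot>\<^bsub>V\<^esub> x) = N +>\<^bsub>V\<^esub> (a \<odot>\<^bsub>V\<^esub> v)" if x: "x \<in> N +>\<^bsub>V\<^esub> v" for x
  proof -
    have xc: "x \<in> carrier V" using N.a_elemrcos_carrier[OF v x] .
    have "x \<ominus>\<^bsub>V\<^esub> v \<in> N" using x v xc N.a_rcos_module by (simp add: a_minus_def)
    then have "a \<odot>\<^bsub>V\<^esub> (x \<ominus>\<^bsub>V\<^esub> v) \<in> N" by (rule subrep_smult[OF N a])
    moreover have "a \<odot>\<^bsub>V\<^esub> (x \<ominus>\<^bsub>V\<^esub> v) = a \<odot>\<^bsub>V\<^esub> x \<ominus>\<^bsub>V\<^esub> a \<odot>\<^bsub>V\<^esub> v"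
      using a v xc by (simp add: a_minus_def smult_r_distr smult_r_minus)
    ultimately show ?thesis using coset_eq_iff[OF N] a v xc by simp
  qed
  have "v \<in> N +>\<^bsub>V\<^esub> v" by (rule N.a_rcos_self[OF v])
  then have ne: "N +>\<^bsub>V\<^esub> v \<noteq> {}" by blast
  show ?thesis
    unfolding quot_rep_def gmod.simps module.simps by (rule SUP_eq_const[OF ne *])
qed

lemma quot_act:
  assumes N: "subrep G K N V" and g: "g \<in> carrier G" and v: "v \<in> carrier V"
  shows "act (quot_rep V N) g (N +>\<^bsub>V\<^esub> v) = N +>\<^bsub>V\<^esub> act V g v"
proof -
  interpret N: abelian_subgroup N V by (rule subrep_abelian_subgroup[OF N])
  have *: "N +>\<^bsub>V\<^esub> act V g x = N +>\<^bsub>V\<^esub> act V g v" if x: "x \<in> N +>\<^bsub>V\<^esub> v" for x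
  proof -
    have xc: "x \<in> carrier V" using N.a_elemrcos_carrier[OF v x] .
    have "x \<ominus>\<^bsub>V\<^esub> v \<in> N" using x v xc N.a_rcos_module by (simp add: a_minus_def)
    then have "act V g (x \<ominus>\<^bsub>V\<^esub> v) \<in> N" by (rule subrep_act[OF N g])
    moreover have "act V g (x \<ominus>\<^bsub>V\<^esub> v) = act V g x \<ominus>\<^bsub>V\<^esub> act V g v"
      using g v xc by (simp add: a_minus_def act_add act_smult act_closed flip: smult_minus_1)
    ultimately show ?thesis using coset_eq_iff[OF N] g v xc act_closed by simp
  qed
  have "v \<in> N +>\<^bsub>V\<^esub> v" by (rule N.a_rcos_self[OF v])
  then have ne: "N +>\<^bsub>V\<^esub> v \<noteq> {}" by blast
  show ?thesis
    unfolding quot_rep_def gmod.simps module.simps by (rule SUP_eq_const[OF ne *])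
qed

lemma quot_carrier: "a_rcosets\<^bsub>V\<^esub> N = (\<lambda>v. N +>\<^bsub>V\<^esub> v) ` carrier V"
  by (auto simp: A_RCOSETS_def')

lemma linear_rep_quot:
  assumes N: "subrep G K N V"
  shows "linear_rep G K (quot_rep V N)"
proof -
  interpret N: abelian_subgroup N V by (rule subrep_abelian_subgroup[OF N])
  note [simp] = N.a_rcos_sum quot_smult[OF N] quot_act[OF N] act_closed
  have N0: "N = N +>\<^bsub>V\<^esub> \<zero>\<^bsub>V\<^esub>" using N.a_rcos_const[of "\<zero>\<^bsub>V\<^esub>"] subrep_zero[OF N] by simp
  have ab: "abelian_group (quot_rep V N)"
  proof (rule abelian_groupI)
    fix x y z
    assume "x \<in> carrier (quot_rep V N)" "y \<in> carrier (quot_rep V N)" "z \<in> carrier (quot_rep V N)"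
    then show "x \<oplus>\<^bsub>quot_rep V N\<^esub> y \<oplus>\<^bsub>quot_rep V N\<^esub> z = x \<oplus>\<^bsub>quot_rep V N\<^esub> (y \<oplus>\<^bsub>quot_rep V N\<^esub> z)"
      by (auto simp: quot_carrier a_assoc)
  next
    show "\<zero>\<^bsub>quot_rep V N\<^esub> \<in> carrier (quot_rep V N)"
      using N0 by (auto simp: quot_carrier)
  next
    fix x assume "x \<in> carrier (quot_rep V N)"
    then obtain v where v: "v \<in> carrier V" "x = N +>\<^bsub>V\<^esub> v" by (auto simp: quot_carrier)
    show "\<zero>\<^bsub>quot_rep V N\<^esub> \<oplus>\<^bsub>quot_rep V N\<^esub> x = x"
      using v N.a_rcos_sum[of "\<zero>\<^bsub>V\<^esub>" v] N0 by simp
    have "(N +>\<^bsub>V\<^esub> \<ominus>\<^bsub>V\<^esub> v) \<oplus>\<^bsub>quot_rep V N\<^esub> x = \<zero>\<^bsub>quot_rep V N\<^esub>"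
      using v N0 by (simp add: l_neg)
    then show "\<exists>y\<in>carrier (quot_rep V N). y \<oplus>\<^bsub>quot_rep V N\<^esub> x = \<zero>\<^bsub>quot_rep V N\<^esub>"
      using v by (intro bexI[of _ "N +>\<^bsub>V\<^esub> \<ominus>\<^bsub>V\<^esub> v"]) (auto simp: quot_carrier)
  next
    fix x y
    assume "x \<in> carrier (quot_rep V N)" "y \<in> carrier (quot_rep V N)"
    then show "x \<oplus>\<^bsub>quot_rep V N\<^esub> y \<in> carrier (quot_rep V N)"
      and "x \<oplus>\<^bsub>quot_rep V N\<^esub> y = y \<oplus>\<^bsub>quot_rep V N\<^esub> x"
      by (auto simp: quot_carrier a_comm)
  qed
  have "Module.module K (quot_rep V N)"
    by (rule moduleI)
       (use ab R.cring_axioms in \<open>auto simp: quot_carrier smult_l_distr smult_r_distr smult_assoc1\<close>)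
  then have vs: "vectorspace K (quot_rep V N)" by (intro vectorspace.intro field_axioms)
  show ?thesis
  proof (rule linear_rep.intro[OF vs G.group_axioms linear_rep_axioms.intro])
    fix g assume "g \<in> carrier G"
    then show "act (quot_rep V N) g \<in> module_hom K (quot_rep V N) (quot_rep V N)"
      by (auto simp: module_hom_def quot_carrier act_add act_smult)
  qed (auto simp: quot_carrier act_one act_mult)
qed

end

section \<open>Equivariant epimorphisms, correspondence of submodules, isomorphism theorems\<close>

locale rep_epi = V: linear_rep G K V + Z: linear_rep G K Z
  for G (structure) and K and V and Z and f +
  assumes hom: "f \<in> module_hom K V Z"
    and surj: "f ` carrier V = carrier Z"
    and equivariant: "g \<in> carrier G \<Longrightarrow> v \<in> carrier V \<Longrightarrow> f (act V g v) = act Z g (f v)"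
begin

lemma f_im [simp]: "v \<in> carrier V \<Longrightarrow> f v \<in> carrier Z"
  and f_add [simp]: "v \<in> carrier V \<Longrightarrow> w \<in> carrier V \<Longrightarrow> f (v \<oplus>\<^bsub>V\<^esub> w) = f v \<oplus>\<^bsub>Z\<^esub> f w"
  and f_smult [simp]: "a \<in> carrier K \<Longrightarrow> v \<in> carrier V \<Longrightarrow> f (a \<odot>\<^bsub>V\<^esub> v) = a \<odot>\<^bsub>Z\<^esub> f v"
  using hom by (auto simp: module_hom_def)

lemma f_add_zero:
  "v \<in> carrier V \<Longrightarrow> w \<in> carrier V \<Longrightarrow> f w = \<zero>\<^bsub>Z\<^esub> \<Longrightarrow> f (v \<oplus>\<^bsub>V\<^esub> w) = f v"
  by simp

lemma f0_is_0 [simp]: "f \<zero>\<^bsub>V\<^esub> = \<zero>\<^bsub>Z\<^esub>"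
  using f_smult[of "\<zero>\<^bsub>K\<^esub>" "\<zero>\<^bsub>V\<^esub>"] f_im[of "\<zero>\<^bsub>V\<^esub>"] by (simp del: f_smult f_im)

lemma f_minus [simp]: "v \<in> carrier V \<Longrightarrow> w \<in> carrier V \<Longrightarrow> f (v \<ominus>\<^bsub>V\<^esub> w) = f v \<ominus>\<^bsub>Z\<^esub> f w"
  by (simp add: a_minus_def flip: V.smult_minus_1 Z.smult_minus_1)

definition "kern = {v \<in> carrier V. f v = \<zero>\<^bsub>Z\<^esub>}"

lemma eq_iff: "v \<in> carrier V \<Longrightarrow> w \<in> carrier V \<Longrightarrow> f v = f w \<longleftrightarrow> v \<ominus>\<^bsub>V\<^esub> w \<in> kern"
  using Z.diff_eq_zero_iff[of "f v" "f w"] by (simp add: kern_def)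

lemma subrep_vimage:
  assumes "subrep G K W Z" shows "subrep G K {v \<in> carrier V. f v \<in> W} V"
  using assms by (intro V.subrepI)
   (auto simp: Z.subrep_zero Z.subrep_add Z.subrep_smult Z.subrep_act equivariant V.act_closed)

lemma subrep_image:
  assumes "subrep G K U V" shows "subrep G K (f ` U) Z"
proof (intro Z.subrepI)
  note U = V.subrep_carrierD[OF assms]
  show "f ` U \<subseteq> carrier Z" using U by auto
  show "\<zero>\<^bsub>Z\<^esub> \<in> f ` U" using V.subrep_zero[OF assms] f0_is_0 by (metis image_eqI)
  show "x \<oplus>\<^bsub>Z\<^esub> y \<in> f ` U" if "x \<in> f ` U" "y \<in> f ` U" for x y
    using that U V.subrep_add[OF assms] by (auto simp: image_iff) (metis f_add)
  show "a \<odot>\<^bsub>Z\<^esub> x \<in> f ` U" if "a \<in> carrier K" "x \<in> f ` U" for a x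
    using that U V.subrep_smult[OF assms] by (auto simp: image_iff) (metis f_smult)
  show "act Z g x \<in> f ` U" if "g \<in> carrier G" "x \<in> f ` U" for g x
    using that U V.subrep_act[OF assms] by (auto simp: image_iff) (metis equivariant)
qed

lemma vimage_image:
  assumes "subrep G K U V" "kern \<subseteq> U" shows "{v \<in> carrier V. f v \<in> f ` U} = U"
proof -
  note U = V.subrep_carrierD[OF assms(1)]
  have "v \<in> U" if "v \<in> carrier V" "u \<in> U" "f v = f u" for u v
  proof -
    have "v \<ominus>\<^bsub>V\<^esub> u \<in> U" using that eq_iff U assms(2) by blast
    then have "(v \<ominus>\<^bsub>V\<^esub> u) \<oplus>\<^bsub>V\<^esub> u \<in> U" using that V.subrep_add[OF assms(1)] by blast
    then show ?thesis using that U by (simp add: a_minus_def V.a_assoc V.l_neg)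
  qed
  then show ?thesis using U by auto
qed

text \<open>Preimage and image match the submodules of \<open>Z\<close> with the submodules of
  \<open>V\<close> that contain the kernel. Simplicity of a quotient becomes maximality of the
  kernel, a statement that mentions no cosets.\<close>

lemma simple_iff:
  "simple_rep G K Z \<longleftrightarrow>
    kern \<noteq> carrier V \<and> (\<forall>U. subrep G K U V \<and> kern \<subseteq> U \<longrightarrow> U = kern \<or> U = carrier V)"
proof -
  have 1: "carrier Z = {\<zero>\<^bsub>Z\<^esub>} \<longleftrightarrow> kern = carrier V"
  proof
    assume "kern = carrier V"
    then have "f v = \<zero>\<^bsub>Z\<^esub>" if "v \<in> carrier V" for v using that by (auto simp: kern_def)
    then show "carrier Z = {\<zero>\<^bsub>Z\<^esub>}" using surj by (metis V.M.zero_closed image_constant image_cong)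
  qed (auto simp: kern_def simp flip: surj)
  have 2: "U = kern \<or> U = carrier V"
    if s: "\<forall>W. subrep G K W Z \<longrightarrow> W = {\<zero>\<^bsub>Z\<^esub>} \<or> W = carrier Z" and U: "subrep G K U V" "kern \<subseteq> U" for U
  proof -
    have "f ` U = {\<zero>\<^bsub>Z\<^esub>} \<or> f ` U = carrier Z" using s subrep_image[OF U(1)] by blast
    then show ?thesis using vimage_image[OF U] by (auto simp: kern_def)
  qed
  have 3: "W = {\<zero>\<^bsub>Z\<^esub>} \<or> W = carrier Z"
    if s: "\<forall>U. subrep G K U V \<and> kern \<subseteq> U \<longrightarrow> U = kern \<or> U = carrier V" and W: "subrep G K W Z" for W
  proof -
    let ?U = "{v \<in> carrier V. f v \<in> W}"
    have "?U = kern \<or> ?U = carrier V"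
      using s subrep_vimage[OF W] Z.subrep_zero[OF W] by (auto simp: kern_def)
    moreover have "W = f ` ?U" using Z.subrep_subset[OF W] surj by auto
    moreover have "f ` kern = {\<zero>\<^bsub>Z\<^esub>}" using f0_is_0 V.M.zero_closed by (auto simp: kern_def image_iff) 
    ultimately show ?thesis using surj by auto
  qed
  show ?thesis
    unfolding simple_rep_def 1 using Z.linear_rep_axioms 2 3 by meson
qed

text \<open>First isomorphism theorem in symmetric form: \<open>f\<close> and \<open>h\<close>
  identify the same vectors, so lifting along \<open>f\<close> and then applying \<open>h\<close>
  does not depend on the lift and is injective.\<close>

lemma iso_same_kernel:
  assumes "rep_epi G K V Y h" and "rep_epi.kern V Y h = kern"
  shows "rep_iso G K Z Y"
proof -
  note h = rep_epi.f_im[OF assms(1)] rep_epi.f_add[OF assms(1)] rep_epi.f_smult[OF assms(1)]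
  define s where "s x = (SOME v. v \<in> carrier V \<and> f v = x)" for x
  have s: "s x \<in> carrier V" "f (s x) = x" if "x \<in> carrier Z" for x
  proof -
    have "\<exists>v. v \<in> carrier V \<and> f v = x" using that by (auto simp flip: surj)
    from someI_ex[OF this] show "s x \<in> carrier V" "f (s x) = x" unfolding s_def by simp_all
  qed
  define \<phi> where "\<phi> x = h (s x)" for x
  have eq: "f v = f w \<longleftrightarrow> h v = h w" if "v \<in> carrier V" "w \<in> carrier V" for v w
    using eq_iff rep_epi.eq_iff[OF assms(1)] assms(2) that by simp
  have \<phi>: "\<phi> (f v) = h v" if "v \<in> carrier V" for v
    using eq[of "s (f v)" v] s that by (simp add: \<phi>_def)
  have c: "\<exists>v\<in>carrier V. x = f v" if "x \<in> carrier Z" for x using that surj by blast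
  have "\<phi> \<in> module_hom K Z Y"
    unfolding module_hom_def
  proof (intro CollectI conjI allI impI Pi_I)
    fix x assume "x \<in> carrier Z" then obtain v where "v \<in> carrier V" "x = f v" using c by blast
    then show "\<phi> x \<in> carrier Y" by (simp add: \<phi> h)
  next
    fix x y assume "x \<in> carrier Z \<and> y \<in> carrier Z"
    then have "x \<in> carrier Z" "y \<in> carrier Z" by simp_all
    then obtain v w where "v \<in> carrier V" "w \<in> carrier V" "x = f v" "y = f w"
      by (elim c[THEN bexE])
    then show "\<phi> (x \<oplus>\<^bsub>Z\<^esub> y) = \<phi> x \<oplus>\<^bsub>Y\<^esub> \<phi> y" using \<phi>[of "v \<oplus>\<^bsub>V\<^esub> w"] by (simp add: \<phi> h)
  next
    fix a x assume "a \<in> carrier K \<and> x \<in> carrier Z"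
    then have "\<exists>v\<in>carrier V. x = f v" "a \<in> carrier K" using c by simp_all
    then obtain v where "v \<in> carrier V" "x = f v" "a \<in> carrier K" by blast
    then show "\<phi> (a \<odot>\<^bsub>Z\<^esub> x) = a \<odot>\<^bsub>Y\<^esub> \<phi> x" using \<phi>[of "a \<odot>\<^bsub>V\<^esub> v"] by (simp add: \<phi> h)
  qed
  moreover have "bij_betw \<phi> (carrier Z) (carrier Y)"
    unfolding bij_betw_def
  proof
    show "inj_on \<phi> (carrier Z)" using c \<phi> eq by (intro inj_onI) metis
    have "\<phi> ` carrier Z = \<phi> ` f ` carrier V" by (simp only: surj)
    also have "\<dots> = h ` carrier V" unfolding image_image using \<phi> by (intro image_cong) auto
    finally show "\<phi> ` carrier Z = carrier Y" by (simp add: rep_epi.surj[OF assms(1)])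
  qed
  moreover have "\<phi> (act Z g x) = act Y g (\<phi> x)" if "g \<in> carrier G" "x \<in> carrier Z" for g x
  proof -
    obtain v where "v \<in> carrier V" "x = f v" using c \<open>x \<in> carrier Z\<close> by blast
    then show ?thesis
      using \<phi>[of "act V g v"] \<phi>[of v] that equivariant[of g v] rep_epi.equivariant[OF assms(1), of g v]
      by (simp add: V.act_closed)
  qed
  ultimately show ?thesis unfolding rep_iso_def by blast
qed

end

context linear_rep
begin

lemma rep_epi_quot:
  assumes N: "subrep G K N V"
  shows "rep_epi G K V (quot_rep V N) (\<lambda>v. N +>\<^bsub>V\<^esub> v)"
proof -
  interpret N: abelian_subgroup N V by (rule subrep_abelian_subgroup[OF N])
  show ?thesis
  proof (rule rep_epi.intro[OF linear_rep_axioms linear_rep_quot[OF N] rep_epi_axioms.intro])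
    show "(\<lambda>v. N +>\<^bsub>V\<^esub> v) \<in> module_hom K V (quot_rep V N)"
      unfolding module_hom_def quot_rep_simps quot_carrier
      by (simp add: N.a_rcos_sum quot_smult[OF N])
    show "(\<lambda>v. N +>\<^bsub>V\<^esub> v) ` carrier V = carrier (quot_rep V N)"
      by (simp add: quot_carrier)
  qed (simp add: quot_act[OF N])
qed

lemma kern_quot:
  assumes N: "subrep G K N V"
  shows "rep_epi.kern V (quot_rep V N) (\<lambda>v. N +>\<^bsub>V\<^esub> v) = N"
proof -
  interpret N: abelian_subgroup N V by (rule subrep_abelian_subgroup[OF N])
  have 0: "N +>\<^bsub>V\<^esub> \<zero>\<^bsub>V\<^esub> = N" using N.a_rcos_const[of "\<zero>\<^bsub>V\<^esub>"] subrep_zero[OF N] by blast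
  have "N +>\<^bsub>V\<^esub> v = N \<longleftrightarrow> v \<in> N" if "v \<in> carrier V" for v
  proof -
    have "v \<ominus>\<^bsub>V\<^esub> \<zero>\<^bsub>V\<^esub> = v" using that by (simp add: minus_eq)
    then show ?thesis using coset_eq_iff[OF N that M.zero_closed] unfolding 0 by metis
  qed
  then show ?thesis using subrep_carrierD[OF N] unfolding rep_epi.kern_def[OF rep_epi_quot[OF N]] quot_rep_simps by blast
qed

lemma rep_epi_subquot:
  assumes "subrep G K A V" "subrep G K B V" "B \<subseteq> A"
  shows "rep_epi G K (vs A) (subquot V A B) (\<lambda>v. B +>\<^bsub>V\<^esub> v)"
    and "rep_epi.kern (vs A) (subquot V A B) (\<lambda>v. B +>\<^bsub>V\<^esub> v) = B"
proof -
  note A = linear_rep_restrict[OF assms(1)]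
  have B: "subrep G K B (vs A)" using subrep_restrict_iff assms by blast
  \<comment> \<open>Cosets only involve the addition, which shrinking the carrier leaves
    unchanged.\<close>
  have *: "a_r_coset (vs A) = a_r_coset V"
    by (intro ext) (simp add: a_r_coset_def')
  show "rep_epi G K (vs A) (subquot V A B) (\<lambda>v. B +>\<^bsub>V\<^esub> v)"
    using linear_rep.rep_epi_quot[OF A B] unfolding subquot_def * .
  show "rep_epi.kern (vs A) (subquot V A B) (\<lambda>v. B +>\<^bsub>V\<^esub> v) = B"
    using linear_rep.kern_quot[OF A B] unfolding subquot_def * .
qed

lemma simple_subquot_iff:
  assumes "subrep G K A V" "subrep G K B V" "B \<subseteq> A"
  shows "simple_rep G K (subquot V A B) \<longleftrightarrow>
    A \<noteq> B \<and> (\<forall>U. subrep G K U V \<and> B \<subseteq> U \<and> U \<subseteq> A \<longrightarrow> U = B \<or> U = A)"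
  unfolding rep_epi.simple_iff[OF rep_epi_subquot(1)[OF assms]] rep_epi_subquot(2)[OF assms]
  using subrep_restrict_iff[OF assms(1)] by auto

text \<open>Here \<open>A = B + C\<close>: the quotient map of \<open>A\<close> by \<open>B\<close>,
  restricted to \<open>C\<close>, is still onto, and its kernel is the intersection
  \<open>D\<close>.\<close>

lemma second_iso:
  assumes A: "subrep G K A V" and B: "subrep G K B V" and C: "subrep G K C V" and D: "subrep G K D V"
    and "B \<subseteq> A" "C \<subseteq> A" "B \<inter> C = D" and sum: "\<And>a. a \<in> A \<Longrightarrow> \<exists>b\<in>B. \<exists>c\<in>C. a = b \<oplus>\<^bsub>V\<^esub> c"
  shows "rep_iso G K (subquot V A B) (subquot V C D)"
proof -
  have DC: "D \<subseteq> C" using assms by blast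
  note f = rep_epi_subquot(1)[OF A B \<open>B \<subseteq> A\<close>]
  note Bc = subrep_carrierD[OF B] and Cc = subrep_carrierD[OF C]
  have r: "rep_epi G K (vs C) (subquot V A B) (\<lambda>v. B +>\<^bsub>V\<^esub> v)"
  proof (intro rep_epi.intro rep_epi_axioms.intro linear_rep_restrict[OF C] rep_epi.axioms(2)[OF f])
    show "(\<lambda>v. B +>\<^bsub>V\<^esub> v) \<in> module_hom K (vs C) (subquot V A B)"
      using rep_epi.hom[OF f] \<open>C \<subseteq> A\<close> by (auto simp: module_hom_def subset_iff)
    have *: "\<exists>c\<in>C. B +>\<^bsub>V\<^esub> a = B +>\<^bsub>V\<^esub> c" if "a \<in> A" for a
    proof -
      obtain b c where bc: "b \<in> B" "c \<in> C" "a = b \<oplus>\<^bsub>V\<^esub> c" using sum[OF \<open>a \<in> A\<close>] by blast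
      then have "a \<ominus>\<^bsub>V\<^esub> c = b" using Bc Cc by (simp add: a_minus_def a_assoc r_neg)
      then have "B +>\<^bsub>V\<^esub> a = B +>\<^bsub>V\<^esub> c" using coset_eq_iff[OF B] bc Bc Cc by simp
      then show ?thesis using bc by blast
    qed
    have "(\<lambda>v. B +>\<^bsub>V\<^esub> v) ` A \<subseteq> (\<lambda>v. B +>\<^bsub>V\<^esub> v) ` C"
    proof
      fix x assume "x \<in> (\<lambda>v. B +>\<^bsub>V\<^esub> v) ` A"
      then obtain a where "a \<in> A" "x = B +>\<^bsub>V\<^esub> a" by blast
      then show "x \<in> (\<lambda>v. B +>\<^bsub>V\<^esub> v) ` C" using * by (metis image_eqI)
    qed
    moreover have "(\<lambda>v. B +>\<^bsub>V\<^esub> v) ` C \<subseteq> (\<lambda>v. B +>\<^bsub>V\<^esub> v) ` A"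
      using \<open>C \<subseteq> A\<close> by (rule image_mono)
    ultimately show "(\<lambda>v. B +>\<^bsub>V\<^esub> v) ` carrier (vs C) = carrier (subquot V A B)"
      using rep_epi.surj[OF f] by simp
    fix g v assume "g \<in> carrier G" "v \<in> carrier (vs C)"
    then show "B +>\<^bsub>V\<^esub> act (vs C) g v = act (subquot V A B) g (B +>\<^bsub>V\<^esub> v)"
      using rep_epi.equivariant[OF f, of g v] \<open>C \<subseteq> A\<close> by auto
  qed
  have "rep_epi.kern (vs C) (subquot V A B) (\<lambda>v. B +>\<^bsub>V\<^esub> v) =
      rep_epi.kern (vs A) (subquot V A B) (\<lambda>v. B +>\<^bsub>V\<^esub> v) \<inter> C"
    unfolding rep_epi.kern_def[OF r] rep_epi.kern_def[OF f] using \<open>C \<subseteq> A\<close> by auto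
  then have "rep_epi.kern (vs C) (subquot V C D) (\<lambda>v. D +>\<^bsub>V\<^esub> v) =
      rep_epi.kern (vs C) (subquot V A B) (\<lambda>v. B +>\<^bsub>V\<^esub> v)"
    using rep_epi_subquot(2)[OF A B \<open>B \<subseteq> A\<close>] rep_epi_subquot(2)[OF C D DC] \<open>B \<inter> C = D\<close> by simp
  then show ?thesis by (rule rep_epi.iso_same_kernel[OF r rep_epi_subquot(1)[OF C D DC]])
qed

end

text \<open>Elements of the group algebra as syntactic expressions, so that one element acts on all
  representations at once.\<close>

datatype ('k, 'g) gexp =
  Act 'g | Plus "('k, 'g) gexp" "('k, 'g) gexp" | Scale 'k "('k, 'g) gexp" |
  Times "('k, 'g) gexp" "('k, 'g) gexp"

primrec ev :: "('k, 'v, 'g, 'z) gmod_scheme \<Rightarrow> ('k, 'g) gexp \<Rightarrow> 'v \<Rightarrow> 'v" where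
  "ev V (Act g) = act V g"
| "ev V (Plus a b) = (\<lambda>v. ev V a v \<oplus>\<^bsub>V\<^esub> ev V b v)"
| "ev V (Scale k a) = (\<lambda>v. k \<odot>\<^bsub>V\<^esub> ev V a v)"
| "ev V (Times a b) = (\<lambda>v. ev V a (ev V b v))"

primrec gexp_on :: "('g, 'h) monoid_scheme \<Rightarrow> ('k, 'l) ring_scheme \<Rightarrow> ('k, 'g) gexp \<Rightarrow> bool" where
  "gexp_on G K (Act g) \<longleftrightarrow> g \<in> carrier G"
| "gexp_on G K (Plus a b) \<longleftrightarrow> gexp_on G K a \<and> gexp_on G K b"
| "gexp_on G K (Scale k a) \<longleftrightarrow> k \<in> carrier K \<and> gexp_on G K a"
| "gexp_on G K (Times a b) \<longleftrightarrow> gexp_on G K a \<and> gexp_on G K b"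

lemma ev_restrict: "ev (V\<lparr>carrier := A\<rparr>) e = ev V e"
  by (induction e) auto

lemma (in linear_rep) ev_subrep:
  "gexp_on G K e \<Longrightarrow> subrep G K W V \<Longrightarrow> v \<in> W \<Longrightarrow> ev V e v \<in> W"
  by (induction e arbitrary: v) (auto simp: subrep_act subrep_add subrep_smult)

lemma (in linear_rep) ev_closed: "gexp_on G K e \<Longrightarrow> v \<in> carrier V \<Longrightarrow> ev V e v \<in> carrier V"
  by (rule ev_subrep[OF _ subrep_carrier])

text \<open>Has two uses: an operator computed on functions descends to every subquotient, and an
  alleged isomorphism of factors must commute with it.\<close>

lemma ev_equivariant:
  assumes "linear_rep G K V" "linear_rep G K Z" "f \<in> module_hom K V Z"
    and "\<And>g v. g \<in> carrier G \<Longrightarrow> v \<in> carrier V \<Longrightarrow> f (act V g v) = act Z g (f v)"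
    and "gexp_on G K e" "v \<in> carrier V"
  shows "f (ev V e v) = ev Z e (f v)"
proof -
  note closed = linear_rep.ev_closed[OF assms(1)]
  show ?thesis using assms(5,6)
    by (induction e arbitrary: v)
      (use assms(3,4) in \<open>auto simp: module_hom_def closed\<close>)
qed

lemma (in linear_rep) ev_hom:
  assumes "gexp_on G K e" shows "ev V e \<in> module_hom K V V"
  using assms
proof (induction e)
  case (Act g) then show ?case by (simp add: act_hom)
next
  case (Plus a b) then show ?case
    by (auto simp: module_hom_def ev_closed smult_r_distr a_ac)
next
  case (Scale k a) then show ?case
    by (auto simp: module_hom_def ev_closed smult_r_distr R.m_comm simp flip: smult_assoc1)
next
  case (Times a b) then show ?case
    by (auto simp: module_hom_def ev_closed)
qed

text \<open>Linear independence comes for free from operators that separate the generators.\<close>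

lemma (in linear_rep) dim_eq_card:
  assumes fin: "finite S" and b: "\<And>i. i \<in> S \<Longrightarrow> b i \<in> carrier V" "\<And>i. i \<in> S \<Longrightarrow> b i \<noteq> \<zero>\<^bsub>V\<^esub>"
    and sep: "\<And>i. i \<in> S \<Longrightarrow> \<exists>E. gexp_on G K E \<and>
      (\<forall>k\<in>S. ev V E (b k) = (if k = i then b i else \<zero>\<^bsub>V\<^esub>))"
    and gen: "\<And>N. LinearCombinations.submodule K N V \<Longrightarrow> b ` S \<subseteq> N \<Longrightarrow> carrier V \<subseteq> N"
  shows "dim = card S"
proof -
  have inj: "inj_on b S"
  proof (rule inj_onI)
    fix i k assume ik: "i \<in> S" "k \<in> S" "b i = b k"
    obtain E where "\<forall>k\<in>S. ev V E (b k) = (if k = i then b i else \<zero>\<^bsub>V\<^esub>)"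
      using sep[OF ik(1)] by blast
    then have "ev V E (b i) = b i" "ev V E (b k) = (if k = i then b i else \<zero>\<^bsub>V\<^esub>)"
      using ik(1,2) by auto
    then show "i = k" using b(2)[OF ik(1)] ik(3) by (metis (full_types))
  qed
  let ?B = "b ` S"
  have Bc: "?B \<subseteq> carrier V" using b(1) by (rule image_subsetI)
  have "lin_indpt ?B"
  proof
    assume "lin_dep ?B"
    then obtain a v where a: "a \<in> ?B \<rightarrow> carrier K" "lincomb a ?B = \<zero>\<^bsub>V\<^esub>" "v \<in> ?B" "a v \<noteq> \<zero>\<^bsub>K\<^esub>"
      using finite_lin_dep[OF _ _ Bc] fin by blast
    then obtain i where i: "i \<in> S" "v = b i" by blast
    obtain E where E: "gexp_on G K E" "\<And>k. k \<in> S \<Longrightarrow> ev V E (b k) = (if k = i then b i else \<zero>\<^bsub>V\<^esub>)"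
      using sep[OF i(1)] by blast
    \<comment> \<open>A dependence with nonzero coefficient at \<open>v\<close> puts
      \<open>v\<close> into the span of the other vectors. The operator that separates
      \<open>v\<close> kills this span but fixes \<open>v\<close>, which is nonzero.\<close>
    have v: "v \<in> span (?B - {v})"
      using lincomb_isolate(2)[OF _ Bc a(1,3,4,2)] fin by blast
    have hom: "mod_hom K V V (ev V E)"
      by (intro mod_hom.intro mod_hom_axioms.intro module_axioms ev_hom[OF E(1)])
    note ker = mod_hom.ker_def[OF hom]
    have "?B - {v} \<subseteq> mod_hom.ker V V (ev V E)"
    proof
      fix w assume "w \<in> ?B - {v}"
      then obtain k where k: "k \<in> S" "w = b k" "k \<noteq> i" using i(2) by blast
      then show "w \<in> mod_hom.ker V V (ev V E)" unfolding ker using E(2)[OF k(1)] b(1)[OF k(1)] by simp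
    qed
    then have "span (?B - {v}) \<subseteq> mod_hom.ker V V (ev V E)"
      by (rule span_is_subset[OF _ mod_hom.ker_is_submodule[OF hom]])
    then have "ev V E v = \<zero>\<^bsub>V\<^esub>" using v unfolding ker by blast
    then show False using E(2)[OF i(1)] b(2)[OF i(1)] i(2) by simp
  qed
  moreover have "span ?B = carrier V"
    using gen[OF span_is_submodule[OF Bc] in_own_span[OF Bc]] span_is_subset2[OF Bc] by (rule equalityI[rotated])
  ultimately have "basis ?B" using Bc unfolding basis_def by blast
  then have "dim = card ?B" using fin by (intro dim_basis) auto
  then show ?thesis using card_image[OF inj] by simp
qed

section \<open>Moving digits\<close>

lemma sum_remove_two:
  fixes f :: "'n::finite \<Rightarrow> 'b::comm_monoid_add"
  assumes "j \<noteq> l" shows "sum f UNIV = f j + f l + sum f (UNIV - {j, l})"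
proof -
  have "sum f UNIV = f j + sum f (UNIV - {j})" by (simp add: sum.remove)
  also have "sum f (UNIV - {j}) = f l + sum f (UNIV - {j} - {l})"
    using assms by (intro sum.remove) auto
  also have "UNIV - {j} - {l} = UNIV - {j, l}" by auto
  finally show ?thesis by (simp add: add.assoc)
qed

lemma exists_strict_pair:
  fixes e e' :: "'n::finite \<Rightarrow> nat"
  assumes "sum e UNIV = sum e' UNIV" "e \<noteq> e'"
  shows "\<exists>j l. e' j < e j \<and> e l < e' l"
proof -
  have "\<exists>j. b j < a j" if "sum a UNIV = sum b UNIV" "a \<noteq> b" for a b :: "'n \<Rightarrow> nat"
  proof (rule ccontr)
    assume "\<not> ?thesis"
    then have le: "a j \<le> b j" for j by (simp add: not_less)
    moreover obtain i where "a i \<noteq> b i" using \<open>a \<noteq> b\<close> by blast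
    ultimately have "sum a UNIV < sum b UNIV"
      by (intro sum_strict_mono_ex1) (auto intro!: bexI[of _ i] simp: le_less)
    then show False using that by simp
  qed
  from this[of e e'] this[of e' e] show ?thesis using assms by metis
qed

text \<open>Exponents are treated as arrays, \<open>d j e\<close> being digit \<open>e\<close> in
  coordinate \<open>j\<close>, because moves are local there. Digits from position \<open>m\<close>
  on vanish, so that an array is determined by its exponent.\<close>

definition digit_arrays :: "nat \<Rightarrow> nat \<Rightarrow> ('n \<Rightarrow> nat \<Rightarrow> nat) set" where
  "digit_arrays p m = {d. \<forall>j e. d j e < p \<and> (m \<le> e \<longrightarrow> d j e = 0)}"

definition level_sum :: "('n::finite \<Rightarrow> nat \<Rightarrow> nat) \<Rightarrow> nat \<Rightarrow> nat" where
  "level_sum d e = (\<Sum>j\<in>UNIV. d j e)"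

text \<open>The entry \<open>t_k\<close> of \<open>T\<close> is the value at \<open>k + 1\<close>.
  The shift makes the value \<open>0\<close> at \<open>k = 0\<close> and the full degree at
  \<open>k = m\<close>.\<close>

definition partial_val :: "nat \<Rightarrow> ('n::finite \<Rightarrow> nat \<Rightarrow> nat) \<Rightarrow> nat \<Rightarrow> nat" where
  "partial_val p d k = (\<Sum>e<k. p ^ e * level_sum d e)"

definition digit_transfer :: "'n \<Rightarrow> 'n \<Rightarrow> nat \<Rightarrow> ('n \<Rightarrow> nat \<Rightarrow> nat) \<Rightarrow> 'n \<Rightarrow> nat \<Rightarrow> nat" where
  "digit_transfer j l e d = d(j := (d j)(e := d j e - 1), l := (d l)(e := d l e + 1))"

text \<open>The move of \<open>p^e\<close> into a coordinate whose digit \<open>e\<close> is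
  \<open>p - 1\<close>. It is applied only when the next digit is below \<open>p - 1\<close>, so the
  carry stops after one position.\<close>

definition digit_carry :: "'n \<Rightarrow> 'n \<Rightarrow> nat \<Rightarrow> ('n \<Rightarrow> nat \<Rightarrow> nat) \<Rightarrow> 'n \<Rightarrow> nat \<Rightarrow> nat" where
  "digit_carry j l e d =
    d(j := (d j)(e := d j e - 1), l := (d l)(e := 0, Suc e := d l (Suc e) + 1))"

lemma level_sum_transfer:
  assumes "j \<noteq> l" "d j e > 0" shows "level_sum (digit_transfer j l e d) k = level_sum d k"
proof -
  have "(\<Sum>i\<in>UNIV - {j, l}. digit_transfer j l e d i k) = (\<Sum>i\<in>UNIV - {j, l}. d i k)"
    by (intro sum.cong) (auto simp: digit_transfer_def)
  then show ?thesis
    unfolding level_sum_def sum_remove_two[OF assms(1)] using assms by (auto simp: digit_transfer_def)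
qed

text \<open>Level \<open>e\<close> loses one unit in \<open>j\<close> and \<open>p - 1\<close> units
  in \<open>l\<close>; level \<open>e + 1\<close> gains one.\<close>

lemma level_sum_carry:
  assumes "j \<noteq> l" "d j e > 0" "d l e = p - 1" "p > 0"
  shows "level_sum (digit_carry j l e d) e + p = level_sum d e"
    and "level_sum (digit_carry j l e d) (Suc e) = level_sum d (Suc e) + 1"
    and "k \<noteq> e \<Longrightarrow> k \<noteq> Suc e \<Longrightarrow> level_sum (digit_carry j l e d) k = level_sum d k"
proof -
  have r: "(\<Sum>i\<in>UNIV - {j, l}. digit_carry j l e d i k) = (\<Sum>i\<in>UNIV - {j, l}. d i k)" for k
    by (intro sum.cong) (auto simp: digit_carry_def)
  show "level_sum (digit_carry j l e d) e + p = level_sum d e"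
    "level_sum (digit_carry j l e d) (Suc e) = level_sum d (Suc e) + 1"
    "k \<noteq> e \<Longrightarrow> k \<noteq> Suc e \<Longrightarrow> level_sum (digit_carry j l e d) k = level_sum d k"
    unfolding level_sum_def sum_remove_two[OF assms(1)] r using assms by (auto simp: digit_carry_def)
qed

text \<open>Isolates the combinatorics. \<open>J\<close> will be the set of digit arrays of the
  monomials contained in a submodule, and the two closure properties are the moves that operators
  realise.\<close>

locale digit_moves =
  fixes p m :: nat and J :: "('n::finite \<Rightarrow> nat \<Rightarrow> nat) set"
  assumes p: "p > 0" and J: "J \<subseteq> digit_arrays p m"
    and transfer: "\<lbrakk>d \<in> J; j \<noteq> l; e < m; d j e > 0; d l e < p - 1\<rbrakk> \<Longrightarrow> digit_transfer j l e d \<in> J"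
    and carry: "\<lbrakk>d \<in> J; j \<noteq> l; Suc e < m; d j e > 0; d l e = p - 1; d l (Suc e) < p - 1\<rbrakk>
      \<Longrightarrow> digit_carry j l e d \<in> J"
begin

text \<open>The induction is on the total surplus of \<open>d\<close> over \<open>d'\<close>;
  truncated subtraction discards the deficits. Where the arrays differ, equal level sums provide a
  surplus and a deficit at the same level, and a transfer between the two coordinates lowers the
  total.\<close>

lemma reach_same_levels:
  assumes "d \<in> J" "d' \<in> digit_arrays p m" "\<And>e. e < m \<Longrightarrow> level_sum d e = level_sum d' e"
  shows "d' \<in> J"
  using assms
proof (induction "\<Sum>j\<in>UNIV. \<Sum>e<m. d j e - d' j e" arbitrary: d rule: less_induct)
  case less
  have gt: "\<exists>j l. d' j e < d j e \<and> d l e < d' l e" if "e < m" "d i e \<noteq> d' i e" for i e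
  proof -
    have "(\<lambda>j. d j e) \<noteq> (\<lambda>j. d' j e)" using that(2) by metis
    then show ?thesis
      using exists_strict_pair[of "\<lambda>j. d j e" "\<lambda>j. d' j e"] less.prems(3)[OF that(1)]
      by (simp add: level_sum_def)
  qed
  show ?case
  proof (cases "\<exists>i e. e < m \<and> d i e \<noteq> d' i e")
    case False
    then have "d i e = d' i e" for i e
      using less.prems(1,2) J by (cases "e < m") (auto simp: digit_arrays_def subset_iff)
    then have "d = d'" by (intro ext)
    then show ?thesis using less.prems by simp
  next
    case True
    then obtain e j l where e: "e < m" and j: "d' j e < d j e" and l: "d l e < d' l e" using gt by blast
    let ?d = "digit_transfer j l e d"
    have jl: "j \<noteq> l" using j l by auto
    have "d' l e < p" using less.prems(2) by (simp add: digit_arrays_def)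
    then have "d l e < p - 1" using l by linarith
    then have "?d \<in> J" using transfer[OF less.prems(1) jl e] j by simp
    moreover have "(\<Sum>j\<in>UNIV. \<Sum>e<m. ?d j e - d' j e) < (\<Sum>j\<in>UNIV. \<Sum>e<m. d j e - d' j e)"
    proof (rule sum_strict_mono_ex1)
      have le: "?d i k - d' i k \<le> d i k - d' i k" for i k
        using l by (auto simp: digit_transfer_def)
      show "\<forall>i\<in>UNIV. (\<Sum>e<m. ?d i e - d' i e) \<le> (\<Sum>e<m. d i e - d' i e)"
        by (auto intro: sum_mono le)
      have "(\<Sum>e<m. ?d j e - d' j e) < (\<Sum>e<m. d j e - d' j e)"
        by (rule sum_strict_mono_ex1) (use le e j jl in \<open>auto intro!: bexI[of _ e] simp: digit_transfer_def\<close>)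
      then show "\<exists>i\<in>UNIV. (\<Sum>e<m. ?d i e - d' i e) < (\<Sum>e<m. d i e - d' i e)" by blast
    qed simp
    ultimately show ?thesis
      using less.hyps[of ?d] less.prems level_sum_transfer[OF jl, of d e] j by simp
  qed
qed

text \<open>Prepares a carry at level \<open>e\<close> into coordinate \<open>l\<close>. While the
  digit of \<open>l\<close> is below \<open>p - 1\<close>, it cannot account for a level sum of at
  least \<open>p\<close>, so some other coordinate has a unit to give.\<close>

lemma fill_digit:
  assumes "d \<in> J" "e < m" "p \<le> level_sum d e"
  shows "\<exists>d'\<in>J. (\<forall>k. level_sum d' k = level_sum d k) \<and> d' l e = p - 1 \<and> (\<forall>j k. k \<noteq> e \<longrightarrow> d' j k = d j k)"
  using assms
proof (induction "p - d l e" arbitrary: d rule: less_induct)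
  case less
  show ?case
  proof (cases "d l e < p - 1")
    case False
    moreover have "d l e < p" using less.prems(1) J by (auto simp: digit_arrays_def)
    ultimately have "d l e = p - 1" by linarith
    then show ?thesis using less.prems by blast
  next
    case True
    have "\<exists>j. j \<noteq> l \<and> d j e > 0"
    proof (rule ccontr)
      assume "\<not> ?thesis"
      then have "level_sum d e = (\<Sum>j\<in>UNIV. if j = l then d l e else 0)"
        unfolding level_sum_def by (intro sum.cong) auto
      then show False using less.prems True by simp
    qed
    then obtain j where j: "j \<noteq> l" "d j e > 0" by blast
    let ?d = "digit_transfer j l e d"
    have dl: "?d l e = d l e + 1" by (simp add: digit_transfer_def)
    have "?d \<in> J" using transfer[OF less.prems(1) j(1) less.prems(2) j(2) True] .
    moreover have "p - ?d l e < p - d l e" using True dl by simp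
    ultimately obtain d' where "d' \<in> J" "\<forall>k. level_sum d' k = level_sum ?d k" "d' l e = p - 1"
      "\<forall>j k. k \<noteq> e \<longrightarrow> d' j k = ?d j k"
      using less.hyps[of ?d] less.prems level_sum_transfer[of j l d e, OF j] by auto
    then show ?thesis
      using level_sum_transfer[of j l d e, OF j] by (intro bexI[of _ d']) (auto simp: digit_transfer_def)
  qed
qed

lemma partial_val_Suc: "partial_val p d (Suc k) = partial_val p d k + p ^ k * level_sum d k"
  by (simp add: partial_val_def)

lemma partial_val_dvd:
  "k \<le> M \<Longrightarrow> \<exists>c. partial_val p d M = partial_val p d k + p ^ k * c"
proof (induction M rule: dec_induct)
  case (step M)
  then obtain c where "partial_val p d M = partial_val p d k + p ^ k * c" by blast
  moreover have "p ^ M = p ^ k * p ^ (M - k)" using step.hyps by (simp flip: power_add)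
  ultimately have "partial_val p d (Suc M) =
      partial_val p d k + p ^ k * (c + p ^ (M - k) * level_sum d M)"
    by (simp add: partial_val_Suc algebra_simps)
  then show ?case by blast
qed (auto intro: exI[of _ 0])

text \<open>
  If the values differ, carry at the last level \<open>e\<close> whose partial value is still too large and whose digit
  sum is at least \<open>p\<close>.  Level \<open>e + 1\<close> has room for the carry, since otherwise it would also qualify.
\<close>

theorem reach:
  assumes "d \<in> J" "d' \<in> digit_arrays p m" "partial_val p d m = partial_val p d' m"
    and "\<And>k. k \<le> m \<Longrightarrow> partial_val p d' k \<le> partial_val p d k"
  shows "d' \<in> J"
  using assms
proof (induction "\<Sum>k\<le>m. partial_val p d k" arbitrary: d rule: less_induct)
  case less
  let ?T = "partial_val p d" and ?T' = "partial_val p d'" and ?n = "CARD('n)"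
  have bound: "level_sum a e \<le> ?n * (p - 1)" if "a \<in> digit_arrays p m" for a :: "'n \<Rightarrow> nat \<Rightarrow> nat" and e
  proof -
    have "a j e \<le> p - 1" for j
    proof -
      have "a j e < p" using that by (simp add: digit_arrays_def)
      then show ?thesis by linarith
    qed
    then show ?thesis using sum_bounded_above[of UNIV "\<lambda>j. a j e" "p - 1"] by (simp add: level_sum_def)
  qed
  \<comment> \<open>The final values agree and later levels contribute multiples of
    \<open>p^k\<close>, so the values at \<open>k\<close> are congruent modulo \<open>p^k\<close>. A
    strict inequality therefore leaves room for one carry into level \<open>k\<close>.\<close>
  have gap: "?T' k + p ^ k \<le> ?T k" if "k \<le> m" "?T' k < ?T k" for k
  proof -
    obtain c c' where "?T m = ?T k + p ^ k * c" "?T' m = ?T' k + p ^ k * c'"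
      using partial_val_dvd[OF \<open>k \<le> m\<close>] by metis
    then have "?T k - ?T' k = p ^ k * c' - p ^ k * c" using less.prems(3) by simp
    then have "p ^ k dvd ?T k - ?T' k" by (simp flip: right_diff_distrib')
    then show ?thesis using that dvd_imp_le[of "p ^ k" "?T k - ?T' k"] by simp
  qed
  show ?case
  proof (cases "\<exists>e<m. ?T' (Suc e) < ?T (Suc e)")
    case False
    have eq: "?T k = ?T' k" if "k \<le> m" for k
      using that False less.prems(4)[OF that] by (cases k) (auto simp: partial_val_def Suc_le_eq)
    have "level_sum d e = level_sum d' e" if "e < m" for e
      using eq[of e] eq[of "Suc e"] that p by (simp add: partial_val_Suc)
    then show ?thesis using reach_same_levels less.prems by blast
  next
    case True
    \<comment> \<open>The first level with an excess serves to show that the set \<open>?E\<close>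
      below is nonempty: the values agree before it, so an excess of at least
      \<open>p^(e0+1)\<close> comes from its own digit sum, which is then at least
      \<open>p\<close>.\<close>
    define e0 where "e0 = (LEAST e. e < m \<and> ?T' (Suc e) < ?T (Suc e))"
    have e0: "e0 < m" "?T' (Suc e0) < ?T (Suc e0)"
      using LeastI_ex[OF True] unfolding e0_def by auto
    have "?T e0 = ?T' e0"
    proof (cases e0)
      case (Suc k)
      then have "\<not> (k < m \<and> ?T' (Suc k) < ?T (Suc k))"
        using not_less_Least[of k "\<lambda>e. e < m \<and> ?T' (Suc e) < ?T (Suc e)"] unfolding e0_def[symmetric] by simp
      then show ?thesis using less.prems(4)[of e0] e0 Suc by simp
    qed (simp add: partial_val_def)
    moreover have "?T' (Suc e0) + p ^ Suc e0 \<le> ?T (Suc e0)" using gap[of "Suc e0"] e0 by simp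
    ultimately have "p ^ e0 * level_sum d' e0 + p ^ e0 * p \<le> p ^ e0 * level_sum d e0"
      by (simp only: partial_val_Suc power_Suc2)
    then have "p ^ e0 * p \<le> p ^ e0 * level_sum d e0" by linarith
    then have e0p: "p \<le> level_sum d e0" using p by simp
    let ?E = "{e. e < m \<and> ?T' (Suc e) < ?T (Suc e) \<and> p \<le> level_sum d e}"
    define e where "e = Max ?E"
    have fin: "finite ?E" by simp
    have "e \<in> ?E" unfolding e_def using e0 e0p by (intro Max_in) auto
    then have e: "e < m" "?T' (Suc e) < ?T (Suc e)" "p \<le> level_sum d e" by auto
    have Se: "Suc e < m" using e(1,2) less.prems(3) by (metis Suc_lessI less_irrefl)
    \<comment> \<open>A full level \<open>e + 1\<close> also has digit sum at least
      \<open>p\<close>, so by maximality of \<open>e\<close> the values after that level agree. As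
      \<open>d\<close> was ahead one level earlier, \<open>d'\<close> would need more than
      \<open>n (p - 1)\<close> units at level \<open>e + 1\<close>.\<close>
    have small: "level_sum d (Suc e) < ?n * (p - 1)"
    proof (rule ccontr)
      assume "\<not> ?thesis"
      then have ge: "?n * (p - 1) \<le> level_sum d (Suc e)" by simp
      have "p \<le> level_sum d (Suc e)" using e(3) bound[of d e] less.prems(1) J ge by (meson le_trans subsetD)
      moreover have "Suc e \<notin> ?E" using Max_ge[OF fin, of "Suc e"] unfolding e_def[symmetric] by linarith
      ultimately have "?T' (Suc (Suc e)) = ?T (Suc (Suc e))"
        using Se less.prems(4)[of "Suc (Suc e)"] by auto
      then have "p ^ Suc e * level_sum d (Suc e) < p ^ Suc e * level_sum d' (Suc e)"
        using e(2) by (simp only: partial_val_Suc[of _ "Suc e"])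
      then have "level_sum d (Suc e) < level_sum d' (Suc e)" by simp
      then show False using bound[OF less.prems(2), of "Suc e"] ge by simp
    qed
    have "\<exists>l. d l (Suc e) < p - 1"
    proof (rule ccontr)
      assume "\<not> ?thesis"
      then have "?n * (p - 1) \<le> level_sum d (Suc e)"
        using sum_bounded_below[of UNIV "p - 1" "\<lambda>j. d j (Suc e)"] by (auto simp: level_sum_def not_less)
      then show False using small by simp
    qed
    then obtain l where l: "d l (Suc e) < p - 1" ..
    obtain d1 where d1: "d1 \<in> J" "\<And>k. level_sum d1 k = level_sum d k" "d1 l e = p - 1"
      "\<And>j k. k \<noteq> e \<Longrightarrow> d1 j k = d j k"
      using fill_digit[OF less.prems(1) e(1,3), of l] by blast
    have "\<exists>j. j \<noteq> l \<and> d1 j e > 0"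
    proof (rule ccontr)
      assume "\<not> ?thesis"
      then have "level_sum d1 e = (\<Sum>j\<in>UNIV. if j = l then d1 l e else 0)"
        unfolding level_sum_def by (intro sum.cong) auto
      then show False using e(3) d1(2,3) p by simp
    qed
    then obtain j where j: "j \<noteq> l" "d1 j e > 0" by blast
    define d2 where "d2 = digit_carry j l e d1"
    have d2: "d2 \<in> J" unfolding d2_def using carry[OF d1(1) j(1) Se j(2) d1(3)] d1(4) l by simp
    note ls = level_sum_carry[of j l d1 e p, OF j d1(3) p, folded d2_def]
    \<comment> \<open>The \<open>p\<close> units lost at level \<open>e\<close> and the one gained
      at level \<open>e + 1\<close> have the same weight \<open>p^(e+1)\<close>, so only the value
      between the two levels changes.\<close>
    have T2: "(k \<le> e \<longrightarrow> partial_val p d2 k = ?T k) \<and>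
      (k = Suc e \<longrightarrow> partial_val p d2 k + p ^ Suc e = ?T k) \<and>
      (k > Suc e \<longrightarrow> partial_val p d2 k = ?T k)" for k
    proof (induction k)
      case (Suc k)
      consider "k < e" | "k = e" | "k = Suc e" | "k > Suc e" by linarith
      then show ?case
      proof cases
        case 2
        then have "partial_val p d2 (Suc k) + p ^ Suc e = ?T k + p ^ e * (level_sum d2 e + p)"
          using Suc by (simp add: partial_val_Suc algebra_simps)
        then show ?thesis using ls(1) d1(2) 2 by (simp add: partial_val_Suc)
      qed (use Suc ls d1(2) in \<open>auto simp: partial_val_Suc\<close>)
    qed (simp add: partial_val_def)
    have le2: "partial_val p d2 k \<le> ?T k" for k
      using T2[of k] by (metis le_add1 le_refl not_less_eq_eq not_less linorder_neqE_nat less_Suc_eq_le)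
    show ?thesis
    proof (rule less.hyps[OF _ d2 less.prems(2)])
      show "(\<Sum>k\<le>m. partial_val p d2 k) < (\<Sum>k\<le>m. ?T k)"
      proof (rule sum_strict_mono_ex1)
        show "\<exists>k\<in>{..m}. partial_val p d2 k < ?T k"
        proof (intro bexI[of _ "Suc e"])
          have "p ^ Suc e > 0" using p by simp
          then show "partial_val p d2 (Suc e) < ?T (Suc e)" using T2[of "Suc e"] by linarith
        qed (use Se in simp)
      qed (use le2 in auto)
      show "partial_val p d2 m = partial_val p d' m" using T2[of m] Se less.prems(3) by simp
      show "partial_val p d' k \<le> partial_val p d2 k" if "k \<le> m" for k
      proof (cases "k = Suc e")
        case True
        then show ?thesis using gap[OF that] e(2) T2[of k] by simp
      next
        case False
        then show ?thesis using T2[of k] less.prems(4)[OF that] by (metis linorder_neqE_nat less_Suc_eq_le)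
      qed
    qed
  qed
qed

end

section \<open>Digits of exponents and the map \<open>T\<close>\<close>

abbreviation lookup :: "('b \<Rightarrow>\<^sub>0 'c::zero) \<Rightarrow> 'b \<Rightarrow> 'c" where
  "lookup \<equiv> Poly_Mapping.lookup"

lemma sum_digit: "(\<Sum>e<m. digit p e a * p ^ e) = a mod p ^ m"
proof (induction m)
  case (Suc m)
  have "a mod p ^ Suc m = p ^ m * (a div p ^ m mod p) + a mod p ^ m"
    unfolding power_Suc2 by (rule mod_mult2_eq)
  then show ?case using Suc by (simp add: digit_def)
qed simp

lemma digit_less: "0 < p \<Longrightarrow> digit p e a < p"
  by (simp add: digit_def)

lemma digit_eq_0: "a < p ^ m \<Longrightarrow> m \<le> e \<Longrightarrow> p > 0 \<Longrightarrow> digit p e a = 0"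
  by (simp add: digit_def order_less_le_trans[OF _ power_increasing])

lemma digit_sum_less:
  assumes "\<And>e. c e < (p::nat)"
  shows "(\<Sum>e<m. c e * p ^ e) < p ^ m"
proof (induction m)
  case (Suc m)
  have "c m * p ^ m + p ^ m \<le> p * p ^ m"
    using mult_le_mono1[of "Suc (c m)" p "p ^ m"] assms[of m] by simp
  then show ?case using Suc by simp
qed simp

lemma digit_sum:
  assumes "\<And>e. c e < p" "k < m"
  shows "digit p k (\<Sum>e<m. c e * p ^ e) = c k"
proof -
  have "\<exists>r. (\<Sum>e<m. c e * p ^ e) = (\<Sum>e<k. c e * p ^ e) + p ^ k * (c k + p * r)"
    using \<open>k < m\<close>
  proof (induction m)
    case (Suc m)
    show ?case
    proof (cases "k = m")
      case True
      then show ?thesis by (intro exI[of _ 0]) simp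
    next
      case False
      then obtain r where "(\<Sum>e<m. c e * p ^ e) = (\<Sum>e<k. c e * p ^ e) + p ^ k * (c k + p * r)"
        using Suc by auto
      moreover have "p ^ m = p ^ k * (p * p ^ (m - Suc k))"
        using False Suc.prems by (simp flip: power_Suc power_add)
      ultimately show ?thesis
        by (intro exI[of _ "r + c m * p ^ (m - Suc k)"]) (simp add: algebra_simps)
    qed
  qed simp
  then obtain r where "(\<Sum>e<m. c e * p ^ e) = (\<Sum>e<k. c e * p ^ e) + p ^ k * (c k + p * r)" ..
  then have "(\<Sum>e<m. c e * p ^ e) div p ^ k = c k + p * r"
    using digit_sum_less[of c p k, OF assms(1)] assms(1)[of 0] by (simp add: div_add1_eq)
  then show ?thesis using assms(1)[of k] by (simp add: digit_def)
qed

definition expo :: "nat \<Rightarrow> nat \<Rightarrow> ('n \<Rightarrow> nat \<Rightarrow> nat) \<Rightarrow> 'n \<Rightarrow> nat" where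
  "expo p m d j = (\<Sum>e<m. d j e * p ^ e)"

definition digits :: "nat \<Rightarrow> ('n \<Rightarrow> nat) \<Rightarrow> 'n \<Rightarrow> nat \<Rightarrow> nat" where
  "digits p i j e = digit p e (i j)"

text \<open>The entries of \<open>T\<close> without digits: \<open>t_k\<close> is the value at
  \<open>k + 1\<close>. In this form subadditivity in the exponent is visible, and exponents of any
  size are allowed.\<close>

definition mod_sum :: "nat \<Rightarrow> ('n::finite \<Rightarrow> nat) \<Rightarrow> nat \<Rightarrow> nat" where
  "mod_sum p i k = (\<Sum>j\<in>UNIV. i j mod p ^ k)"

lemma partial_val_digits: "partial_val p (digits p i) k = mod_sum p i k"
proof -
  have "partial_val p (digits p i) k = (\<Sum>j\<in>UNIV. \<Sum>e<k. digit p e (i j) * p ^ e)"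
    unfolding partial_val_def level_sum_def digits_def sum_distrib_left
    by (subst sum.swap) (simp add: mult.commute)
  then show ?thesis by (simp add: sum_digit mod_sum_def)
qed

lemma digits_in_digit_arrays: "p > 0 \<Longrightarrow> (\<And>j. i j < p ^ m) \<Longrightarrow> digits p i \<in> digit_arrays p m"
  using digit_eq_0 by (fastforce simp: digit_arrays_def digits_def digit_less)

lemma expo_digits: "(\<And>j. i j < p ^ m) \<Longrightarrow> expo p m (digits p i) = i"
  by (intro ext) (simp add: expo_def digits_def sum_digit)

lemma digits_expo: "d \<in> digit_arrays p m \<Longrightarrow> digits p (expo p m d) = d"
proof (intro ext)
  fix j e assume d: "d \<in> digit_arrays p m"
  then have p: "\<And>e. d j e < p" by (simp add: digit_arrays_def)
  show "digits p (expo p m d) j e = d j e"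
  proof (cases "e < m")
    case True
    then show ?thesis unfolding digits_def expo_def using digit_sum p by blast
  next
    case False
    moreover have "p > 0" using p[of 0] by simp
    ultimately show ?thesis using digit_sum_less[of "d j" p m] digit_eq_0[of _ p m e] p d
      by (simp add: digits_def expo_def digit_arrays_def)
  qed
qed

lemma expo_less: "d \<in> digit_arrays p m \<Longrightarrow> expo p m d j < p ^ m"
  unfolding expo_def by (rule digit_sum_less) (simp add: digit_arrays_def)

lemma expo_split:
  "e < m \<Longrightarrow> expo p m d j = d j e * p ^ e + (\<Sum>k\<in>{..<m} - {e}. d j k * p ^ k)"
  unfolding expo_def by (rule sum.remove) auto

lemma expo_transfer:
  assumes "j \<noteq> l" "e < m" "d j e > 0"
  shows "expo p m (digit_transfer j l e d) =
    (expo p m d)(j := expo p m d j - p ^ e, l := expo p m d l + p ^ e)"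
proof (intro ext)
  fix i
  have "(\<Sum>k\<in>{..<m} - {e}. digit_transfer j l e d i k * p ^ k) = (\<Sum>k\<in>{..<m} - {e}. d i k * p ^ k)"
    by (intro sum.cong) (auto simp: digit_transfer_def)
  then show "expo p m (digit_transfer j l e d) i =
      ((expo p m d)(j := expo p m d j - p ^ e, l := expo p m d l + p ^ e)) i"
    using assms by (auto simp: expo_split[OF assms(2)] digit_transfer_def diff_mult_distrib)
qed

text \<open>On exponents a carry is the same subtraction and addition of \<open>p^e\<close> as a
  transfer, so one family of operators realises both kinds of move.\<close>

lemma expo_carry:
  assumes "j \<noteq> l" "Suc e < m" "d j e > 0" "d l e = p - 1" "p > 0"
  shows "expo p m (digit_carry j l e d) =
    (expo p m d)(j := expo p m d j - p ^ e, l := expo p m d l + p ^ e)"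
proof (intro ext)
  fix i
  have em: "e < m" and S: "Suc e \<in> {..<m} - {e}" using assms(2) by auto
  have split: "expo p m a i = a i e * p ^ e + (a i (Suc e) * p ^ Suc e +
      (\<Sum>k\<in>{..<m} - {e} - {Suc e}. a i k * p ^ k))" for a :: "'a \<Rightarrow> nat \<Rightarrow> nat"
    unfolding expo_split[OF em] using sum.remove[OF _ S, of "\<lambda>k. a i k * p ^ k"] by simp
  have "(\<Sum>k\<in>{..<m} - {e} - {Suc e}. digit_carry j l e d i k * p ^ k)
      = (\<Sum>k\<in>{..<m} - {e} - {Suc e}. d i k * p ^ k)"
    by (intro sum.cong) (auto simp: digit_carry_def)
  then have c: "expo p m (digit_carry j l e d) i =
      digit_carry j l e d i e * p ^ e + (digit_carry j l e d i (Suc e) * p ^ Suc e +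
      (\<Sum>k\<in>{..<m} - {e} - {Suc e}. d i k * p ^ k))"
    using split[of "digit_carry j l e d"] by simp
  have q: "p ^ e + (p - 1) * p ^ e = p ^ Suc e" using assms(5) by (simp add: diff_mult_distrib)
  show "expo p m (digit_carry j l e d) i =
      ((expo p m d)(j := expo p m d j - p ^ e, l := expo p m d l + p ^ e)) i"
  proof (cases "i = l")
    case True
    then show ?thesis using assms(1,4) c split[of d] q by (simp add: digit_carry_def)
  next
    case False
    then show ?thesis using assms c split[of d] by (auto simp: digit_carry_def diff_mult_distrib)
  qed
qed

text \<open>The hypothesis \<open>move\<close> has the form that operators can supply: a positive
  digit makes the relevant binomial coefficient nonzero, and the bound on \<open>i l + p^e\<close>
  keeps the result reduced. Both kinds of digit move are instances of it.\<close>

theorem reach_exponents: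
  fixes J :: "('n::finite \<Rightarrow> nat) set"
  assumes p: "p > 0"
    and move: "\<And>i j l e. \<lbrakk>i \<in> J; j \<noteq> l; digit p e (i j) > 0; i l + p ^ e < p ^ m\<rbrakk>
      \<Longrightarrow> i(j := i j - p ^ e, l := i l + p ^ e) \<in> J"
    and "i \<in> J" "\<And>j. i j < p ^ m" "\<And>j. i' j < p ^ m" "sum i UNIV = sum i' UNIV"
    and le: "\<And>k. k \<le> m \<Longrightarrow> mod_sum p i' k \<le> mod_sum p i k"
  shows "i' \<in> J"
proof -
  define D where "D = {d \<in> digit_arrays p m. expo p m d \<in> J}"
  interpret digit_moves p m D
  proof
    show "p > 0" "D \<subseteq> digit_arrays p m" using p by (auto simp: D_def)
  next
    fix d j l e
    assume A: "d \<in> D" "j \<noteq> l" "e < m" "d j e > 0" "d l e < p - 1"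
    have d: "d \<in> digit_arrays p m" "expo p m d \<in> J" using A(1) by (auto simp: D_def)
    have arr: "digit_transfer j l e d \<in> digit_arrays p m"
      using d(1) A by (auto simp: digit_arrays_def digit_transfer_def less_imp_diff_less)
    have eq: "expo p m (digit_transfer j l e d) =
      (expo p m d)(j := expo p m d j - p ^ e, l := expo p m d l + p ^ e)"
      by (rule expo_transfer) (use A in auto)
    have "digit p e (expo p m d j) > 0" using digits_expo[OF d(1)] A(4) by (metis digits_def)
    moreover have "expo p m d l + p ^ e < p ^ m" using expo_less[OF arr, of l] A(2) by (simp add: eq)
    ultimately show "digit_transfer j l e d \<in> D"
      using move[OF d(2) A(2)] arr by (simp add: D_def eq)
  next
    fix d j l e
    assume A: "d \<in> D" "j \<noteq> l" "Suc e < m" "d j e > 0" "d l e = p - 1" "d l (Suc e) < p - 1"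
    have d: "d \<in> digit_arrays p m" "expo p m d \<in> J" using A(1) by (auto simp: D_def)
    have arr: "digit_carry j l e d \<in> digit_arrays p m"
      using d(1) A p by (auto simp: digit_arrays_def digit_carry_def less_imp_diff_less)
    have eq: "expo p m (digit_carry j l e d) =
      (expo p m d)(j := expo p m d j - p ^ e, l := expo p m d l + p ^ e)"
      by (rule expo_carry) (use A p in auto)
    have "digit p e (expo p m d j) > 0" using digits_expo[OF d(1)] A(4) by (metis digits_def)
    moreover have "expo p m d l + p ^ e < p ^ m" using expo_less[OF arr, of l] A(2) by (simp add: eq)
    ultimately show "digit_carry j l e d \<in> D"
      using move[OF d(2) A(2)] arr by (simp add: D_def eq)
  qed
  have m: "mod_sum p i m = sum i UNIV" "mod_sum p i' m = sum i' UNIV"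
    using assms(4,5) by (simp_all add: mod_sum_def)
  have "digits p i' \<in> D"
  proof (rule reach)
    show "digits p i \<in> D" using assms by (simp add: D_def digits_in_digit_arrays expo_digits)
    show "digits p i' \<in> digit_arrays p m" using assms by (simp add: digits_in_digit_arrays)
  qed (use assms le m in \<open>simp_all add: partial_val_digits\<close>)
  then show ?thesis using assms(5) by (simp add: D_def expo_digits)
qed

section \<open>The entries of \<open>T\<close> as residue sums\<close>

lemma length_Tmap [simp]: "length (Tmap p m i) = m"
  by (simp add: Tmap_def)

lemma Tmap_nth:
  assumes "k < m"
  shows "Tmap p m i ! k = mod_sum p (lookup i) (Suc k)"
proof -
  have "Tmap p m i ! k = (\<Sum>l<Suc k. \<Sum>j\<in>UNIV. digit p l (lookup i j) * p ^ l)"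
    using assms by (simp add: Tmap_def lessThan_Suc_atMost)
  also have "\<dots> = (\<Sum>j\<in>UNIV. \<Sum>l<Suc k. digit p l (lookup i j) * p ^ l)"
    by (rule sum.swap)
  finally show ?thesis unfolding sum_digit mod_sum_def .
qed

lemma Tmap_le_iff:
  "list_all2 (\<le>) (Tmap p m i') (Tmap p m i) \<longleftrightarrow>
    (\<forall>k\<le>m. mod_sum p (lookup i') k \<le> mod_sum p (lookup i) k)"
proof
  assume L: "list_all2 (\<le>) (Tmap p m i') (Tmap p m i)"
  show "\<forall>k\<le>m. mod_sum p (lookup i') k \<le> mod_sum p (lookup i) k"
  proof (intro allI impI)
    fix k assume "k \<le> m"
    then show "mod_sum p (lookup i') k \<le> mod_sum p (lookup i) k"
      using L by (cases k) (auto simp: mod_sum_def list_all2_conv_all_nth Tmap_nth Suc_le_eq)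
  qed
qed (auto simp: list_all2_conv_all_nth Tmap_nth)

text \<open>Consecutive entries of \<open>T\<close> differ by \<open>p^k\<close> times the sum of
  the digits at position \<open>k\<close>, so prescribing \<open>T\<close> means prescribing each
  digit sum separately.\<close>

lemma s_coord_Tmap:
  assumes "k < m" "p > 0"
  shows "s_coord p (Tmap p m i) k = level_sum (digits p (lookup i)) k"
proof (cases k)
  case 0
  then show ?thesis using assms
    by (simp add: s_coord_def Tmap_nth mod_sum_def level_sum_def digits_def digit_def)
next
  case (Suc l)
  have "mod_sum p (lookup i) (Suc k) =
      mod_sum p (lookup i) k + p ^ k * level_sum (digits p (lookup i)) k"
    unfolding partial_val_digits[symmetric] by (simp add: partial_val_def)
  then show ?thesis using assms Suc by (simp add: s_coord_def Tmap_nth)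
qed

lemma Tmap_eq_iff:
  assumes "p > 0"
  shows "Tmap p m i = Tmap p m i' \<longleftrightarrow> (\<forall>k<m. level_sum (digits p (lookup i)) k =
    level_sum (digits p (lookup i')) k)" (is "_ \<longleftrightarrow> ?R")
proof
  assume ?R
  then have "mod_sum p (lookup i) k = mod_sum p (lookup i') k" if "k \<le> m" for k
    unfolding partial_val_digits[symmetric] partial_val_def using that by (intro sum.cong) auto
  then show "Tmap p m i = Tmap p m i'" by (intro nth_equalityI) (auto simp: Tmap_nth)
qed (metis s_coord_Tmap assms)

section \<open>Cardinality of the fibres of \<open>T\<close>\<close>

lemma lookup_bij: "bij (lookup :: ('n::finite \<Rightarrow>\<^sub>0 nat) \<Rightarrow> 'n \<Rightarrow> nat)"
proof (rule bijI)
  show "inj (lookup :: ('n \<Rightarrow>\<^sub>0 nat) \<Rightarrow> 'n \<Rightarrow> nat)" by (rule injI) (rule poly_mapping_eqI, simp)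
  show "surj (lookup :: ('n \<Rightarrow>\<^sub>0 nat) \<Rightarrow> 'n \<Rightarrow> nat)"
    by (rule surjI[of _ Abs_poly_mapping]) (simp add: Abs_poly_mapping_inverse)
qed

text \<open>An exponent splits into its columns of digits, one function on the coordinates for each
  position, and lying in the fibre constrains each column only through its sum. The degree condition
  follows from the digit sums.\<close>

lemma card_Tmap_fibre:
  fixes i0 :: "'n::finite \<Rightarrow>\<^sub>0 nat"
  assumes p: "p > 1" and i0: "i0 \<in> Omega (p ^ m) r"
  shows "card {i :: 'n \<Rightarrow>\<^sub>0 nat. i \<in> Omega (p ^ m) r \<and> Tmap p m i = Tmap p m i0} =
    (\<Prod>k<m. card {c :: 'n \<Rightarrow> nat. (\<forall>j. c j < p) \<and> sum c UNIV = s_coord p (Tmap p m i0) k})"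
proof -
  let ?B = "\<lambda>k. {c :: 'n \<Rightarrow> nat. (\<forall>j. c j < p) \<and> sum c UNIV = s_coord p (Tmap p m i0) k}"
  let ?L = "{i :: 'n \<Rightarrow>\<^sub>0 nat. i \<in> Omega (p ^ m) r \<and> Tmap p m i = Tmap p m i0}"
  define h where "h i = (\<lambda>k\<in>{..<m}. \<lambda>j. digits p (lookup i) j k)" for i :: "'n \<Rightarrow>\<^sub>0 nat"
  define g where "g c = Abs_poly_mapping (expo p m (\<lambda>j k. if k < m then c k j else 0))" for c :: "nat \<Rightarrow> 'n \<Rightarrow> nat"
  have small: "i j < p ^ m \<longleftrightarrow> i j \<le> p ^ m - 1" for i :: "'n \<Rightarrow> nat" and j
    using p by (metis Suc_pred' less_Suc_eq_le zero_less_power not_less0 gr0I)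
  have om: "i \<in> Omega (p ^ m) r \<longleftrightarrow>
      (\<forall>j. lookup i j < p ^ m) \<and> sum (lookup i) UNIV = r" for i :: "'n \<Rightarrow>\<^sub>0 nat"
    by (simp add: Omega_def abs_index_def small)
  have sum_eq: "sum (lookup i) UNIV = partial_val p (digits p (lookup i)) m"
    if "\<forall>j. lookup i j < p ^ m" for i :: "'n \<Rightarrow>\<^sub>0 nat"
    using that by (simp add: partial_val_digits mod_sum_def)
  have L: "i \<in> ?L \<longleftrightarrow> (\<forall>j. lookup i j < p ^ m) \<and>
      (\<forall>k<m. level_sum (digits p (lookup i)) k = s_coord p (Tmap p m i0) k)" for i :: "'n \<Rightarrow>\<^sub>0 nat"
  proof -
    have "sum (lookup i) UNIV = r" if "\<forall>j. lookup i j < p ^ m"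
      "\<forall>k<m. level_sum (digits p (lookup i)) k = level_sum (digits p (lookup i0)) k"
      using that i0 sum_eq[of i] sum_eq[of i0] unfolding om partial_val_def by simp
    then show ?thesis using p Tmap_eq_iff[of p m i i0] by (auto simp: om s_coord_Tmap)
  qed
  have "bij_betw h ?L (PiE {..<m} ?B)"
  proof (rule bij_betw_byWitness[where f' = g])
    show "\<forall>i\<in>?L. g (h i) = i"
    proof
      fix i assume "i \<in> ?L"
      then have i: "\<And>j. lookup i j < p ^ m" unfolding L by blast
      have "expo p m (\<lambda>j k. if k < m then h i k j else 0) = expo p m (digits p (lookup i))"
        by (intro ext) (simp add: expo_def h_def)
      also have "\<dots> = lookup i" using i by (rule expo_digits)
      finally show "g (h i) = i" by (simp add: g_def)
    qed
    have gd: "digits p (lookup (g c)) = (\<lambda>j k. if k < m then c k j else 0)"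
      "lookup (g c) j < p ^ m" if c: "c \<in> PiE {..<m} ?B" for c j
    proof -
      have "(\<lambda>j k. if k < m then c k j else 0) \<in> digit_arrays p m"
        using c p by (auto simp: digit_arrays_def PiE_def Pi_def)
      then show "digits p (lookup (g c)) = (\<lambda>j k. if k < m then c k j else 0)"
        "lookup (g c) j < p ^ m"
        by (simp_all add: g_def digits_expo expo_less Abs_poly_mapping_inverse)
    qed
    show "\<forall>c\<in>PiE {..<m} ?B. h (g c) = c"
    proof
      fix c assume c: "c \<in> PiE {..<m} ?B"
      show "h (g c) = c"
        unfolding h_def gd(1)[OF c] using c by (intro ext) (auto simp: PiE_def extensional_def)
    qed
    show "h ` ?L \<subseteq> PiE {..<m} ?B"
    proof (intro image_subsetI PiE_I)
      fix i k assume "i \<in> ?L" and k: "k \<in> {..<m}"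
      then have "level_sum (digits p (lookup i)) k = s_coord p (Tmap p m i0) k"
        unfolding L by simp
      then show "h i k \<in> ?B k" using p k by (simp add: h_def digits_def digit_less level_sum_def)
    qed (simp add: h_def)
    show "g ` PiE {..<m} ?B \<subseteq> ?L"
    proof (intro image_subsetI)
      fix c assume c: "c \<in> PiE {..<m} ?B"
      then show "g c \<in> ?L" unfolding L level_sum_def gd(1)[OF c] using gd(2)[OF c] by (auto simp: PiE_def Pi_def)
    qed
  qed
  then have "card ?L = card (PiE {..<m} ?B)" by (rule bij_betw_same_card)
  then show ?thesis by (simp add: card_PiE)
qed

lemma card_bounded_compositions_fps:
  "of_nat (card {c :: 'n::finite \<Rightarrow> nat. (\<forall>j. c j < p) \<and> sum c UNIV = s}) =
    fps_nth ((\<Sum>k<p. fps_X ^ k) ^ CARD('n) :: rat fps) s"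
proof -
  have "(\<Sum>k<p. fps_X ^ k) ^ CARD('n) = (\<Prod>j\<in>(UNIV :: 'n set). \<Sum>k<p. fps_X ^ k :: rat fps)"
    by simp
  also have "\<dots> = (\<Sum>c\<in>PiE (UNIV :: 'n set) (\<lambda>_. {..<p}). \<Prod>j\<in>UNIV. fps_X ^ c j)"
    by (rule prod_sum_PiE) auto
  also have "\<dots> = (\<Sum>c\<in>PiE (UNIV :: 'n set) (\<lambda>_. {..<p}). fps_X ^ sum c UNIV)"
    by (simp add: power_sum)
  finally have "fps_nth ((\<Sum>k<p. fps_X ^ k) ^ CARD('n)) s =
      (\<Sum>c\<in>PiE (UNIV :: 'n set) (\<lambda>_. {..<p}). if s = sum c UNIV then 1 else (0::rat))"
    by (simp add: fps_sum_nth)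
  also have "\<dots> = of_nat (card {c \<in> PiE (UNIV :: 'n set) (\<lambda>_. {..<p}). s = sum c UNIV})"
    by (subst sum.inter_filter[symmetric]) (auto intro: finite_PiE)
  also have "{c \<in> PiE (UNIV :: 'n set) (\<lambda>_. {..<p}). s = sum c UNIV} =
      {c. (\<forall>j. c j < p) \<and> sum c UNIV = s}"
    by (auto simp: PiE_def Pi_def)
  finally show ?thesis by simp
qed

text \<open>In \<open>(1 + X + ... + X^(p-1))^n = (1 - X^p)^n (1 - X)^(-n)\<close> the binomial
  theorem for the first factor and the negative binomial series for the second give the alternating
  sum.\<close>

lemma card_bounded_compositions:
  assumes p: "p > 0"
  shows "int (card {c :: 'n::finite \<Rightarrow> nat. (\<forall>j. c j < p) \<and> sum c UNIV = s}) =
    (\<Sum>k = 0..s div p. (- 1) ^ k * int (CARD('n) choose k) *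
      int ((CARD('n) - 1 + s - k * p) choose (CARD('n) - 1)))"
proof -
  let ?n = "CARD('n)" and ?X = "fps_X :: rat fps"
  have n: "?n > 0" by simp
  let ?F = "Abs_fps (\<lambda>k. of_nat ((?n + k - 1) choose k)) :: rat fps"
  have F: "inverse ((1 - ?X) ^ ?n) = ?F"
    using one_minus_const_fps_X_neg_power'[OF n, of "1 :: rat"] by simp
  have "(\<Sum>k<p. ?X ^ k) * (1 - ?X) = 1 - ?X ^ p"
    by (simp add: one_diff_power_eq mult.commute)
  then have 1: "(\<Sum>k<p. ?X ^ k) ^ ?n * (1 - ?X) ^ ?n = (1 - ?X ^ p) ^ ?n"
    by (simp flip: power_mult_distrib)
  have 2: "(1 - ?X) ^ ?n * inverse ((1 - ?X) ^ ?n) = 1"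
    by (intro inverse_mult_eq_1') (simp add: fps_power_zeroth)
  have "(\<Sum>k<p. ?X ^ k) ^ ?n = (\<Sum>k<p. ?X ^ k) ^ ?n * ((1 - ?X) ^ ?n * inverse ((1 - ?X) ^ ?n))"
    unfolding 2 by (rule mult_1_right[symmetric])
  also have "\<dots> = (1 - ?X ^ p) ^ ?n * ?F"
    unfolding mult.assoc[symmetric] 1 F ..
  finally have "(\<Sum>k<p. ?X ^ k) ^ ?n = (1 - ?X ^ p) ^ ?n * ?F" .
  also have "(1 - ?X ^ p) ^ ?n = (\<Sum>k\<le>?n. of_nat (?n choose k) * (- 1) ^ k * ?X ^ (k * p))"
  proof -
    have "(1 - ?X ^ p) ^ ?n = (- (?X ^ p) + 1) ^ ?n" by simp
    also have "\<dots> = (\<Sum>k\<le>?n. of_nat (?n choose k) * (- (?X ^ p)) ^ k * 1 ^ (?n - k))"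
      by (rule binomial_ring)
    also have "\<dots> = (\<Sum>k\<le>?n. of_nat (?n choose k) * (- 1) ^ k * ?X ^ (k * p))"
      by (intro sum.cong refl) (simp add: power_minus[of "?X ^ p"] power_mult[symmetric] mult.commute[of p])
    finally show ?thesis .
  qed
  finally have "fps_nth ((\<Sum>k<p. ?X ^ k) ^ ?n) s =
      (\<Sum>k\<le>?n. fps_nth (of_nat (?n choose k) * (- 1) ^ k * ?X ^ (k * p) * ?F) s)"
    by (simp add: sum_distrib_right fps_sum_nth)
  also have "\<dots> = (\<Sum>k\<le>?n. if k * p \<le> s then
      (- 1) ^ k * of_nat (?n choose k) * of_nat ((?n - 1 + s - k * p) choose (?n - 1)) else 0)"
  proof (intro sum.cong refl)
    fix k
    have c: "of_nat (?n choose k) * (- 1) ^ k = fps_const (of_nat (?n choose k) * (- 1) ^ k :: rat)"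
    proof -
      have "(- 1 :: rat fps) = fps_const (- 1)" by (simp flip: fps_const_neg)
      then show ?thesis by (simp only: fps_of_nat[symmetric] fps_const_power fps_const_mult)
    qed
    have "fps_nth (of_nat (?n choose k) * (- 1) ^ k * ?X ^ (k * p) * ?F) s =
        of_nat (?n choose k) * (- 1) ^ k * fps_nth (?X ^ (k * p) * ?F) s"
      unfolding c mult.assoc by simp
    moreover have "fps_nth (?X ^ (k * p) * ?F) s =
        (if k * p \<le> s then of_nat ((?n + (s - k * p) - 1) choose (s - k * p)) else 0)"
      by (simp add: fps_X_power_mult_nth)
    moreover have "(?n + (s - k * p) - 1) choose (s - k * p) = (?n - 1 + s - k * p) choose (?n - 1)" if "k * p \<le> s"
    proof -
      have "?n + (s - k * p) - 1 = ?n - 1 + s - k * p" using that n by linarith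
      moreover have "(?n - 1 + s - k * p) - (s - k * p) = ?n - 1" using that n by linarith
      moreover have "s - k * p \<le> ?n - 1 + s - k * p" using that n by linarith
      ultimately show ?thesis
        using binomial_symmetric[of "s - k * p" "?n - 1 + s - k * p"] by (simp only:)
    qed
    ultimately show "fps_nth (of_nat (?n choose k) * (- 1) ^ k * ?X ^ (k * p) * ?F) s =
      (if k * p \<le> s then (- 1) ^ k * of_nat (?n choose k) * of_nat ((?n - 1 + s - k * p) choose (?n - 1)) else 0)"
      by (cases "k * p \<le> s") (simp_all add: mult.commute[of "(- 1) ^ k"] del: One_nat_def)
  qed
  \<comment> \<open>The two cut-offs agree: terms with \<open>k > n\<close> vanish through
    \<open>n choose k\<close>, terms with \<open>k > s div p\<close> through the condition
    \<open>k * p \<le> s\<close>.\<close>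
  also have "\<dots> = (\<Sum>k\<in>{0..s div p}. (- 1) ^ k * of_nat (?n choose k) *
      of_nat ((?n - 1 + s - k * p) choose (?n - 1)))"
    by (rule sum.mono_neutral_cong)
      (use p in \<open>auto simp: less_eq_div_iff_mult_less_eq binomial_eq_0\<close>)
  finally have "rat_of_int (int (card {c :: 'n::finite \<Rightarrow> nat. (\<forall>j. c j < p) \<and> sum c UNIV = s})) =
    rat_of_int (\<Sum>k = 0..s div p. (- 1) ^ k * int (CARD('n) choose k) *
      int ((CARD('n) - 1 + s - k * p) choose (CARD('n) - 1)))"
    by (simp add: card_bounded_compositions_fps)
  then show ?thesis unfolding of_int_eq_iff .
qed

section \<open>Functions on \<open>F\<^sub>q\<^sup>n\<close> and reduced polynomials\<close>

lemma card_field_ge_2: "CARD('a::{finite,field}) \<ge> 2"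
  using card_mono[of "UNIV :: 'a set" "{0, 1}"] by simp

text \<open>Translation by \<open>1\<close> permutes the field, so adding \<open>1\<close> to every
  summand leaves the sum of all elements unchanged.\<close>

lemma of_nat_card_field: "of_nat CARD('a) = (0 :: 'a::{finite,field})"
proof -
  have "(\<Sum>x\<in>(UNIV :: 'a set). x) = (\<Sum>x\<in>UNIV. x + 1)"
    by (rule sum.reindex_bij_witness[of _ "\<lambda>x. x + 1" "\<lambda>x. x - 1"]) auto
  then show ?thesis by (simp add: sum.distrib)
qed

lemma finite_field_power_card:
  fixes c :: "'a::{finite,field}"
  assumes "c \<noteq> 0" shows "c ^ (CARD('a) - 1) = 1"
proof -
  have "(\<Prod>x\<in>UNIV - {0}. c * x) = (\<Prod>x\<in>UNIV - {0}. x)"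
    by (rule prod.reindex_bij_witness[of _ "\<lambda>x. x / c" "\<lambda>x. c * x"]) (use assms in auto)
  then have "c ^ card (UNIV - {0 :: 'a}) * (\<Prod>x\<in>UNIV - {0}. x) = 1 * (\<Prod>x\<in>UNIV - {0}. x)"
    by (simp add: prod.distrib)
  then show ?thesis by (simp add: card_Diff_singleton)
qed

lemma finite_field_power_q:
  fixes c :: "'a::{finite,field}" shows "c ^ CARD('a) = c"
  using finite_field_power_card[of c] card_field_ge_2[where 'a = 'a]
  by (cases "c = 0") (simp_all add: power_eq_if)

text \<open>For the remainder \<open>?s\<close> of \<open>s\<close> modulo \<open>q - 1\<close>, the
  equation \<open>x^?s = 1\<close> has at most \<open>?s < q - 1\<close> roots. This root count
  takes the place of a generator of the multiplicative group.\<close>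

lemma exists_power_neq_1:
  assumes "\<not> (CARD('a::{finite,field}) - 1) dvd s"
  shows "\<exists>c :: 'a. c \<noteq> 0 \<and> c ^ s \<noteq> 1"
proof -
  let ?N = "CARD('a) - 1" let ?s = "s mod ?N"
  have s: "0 < ?s" "?s < ?N"
    using assms card_field_ge_2[where 'a = 'a] by (auto simp: dvd_eq_mod_eq_0 intro: mod_less_divisor)
  have pow: "c ^ s = c ^ ?s" if "c \<noteq> 0" for c :: 'a
  proof -
    have "c ^ s = c ^ (?N * (s div ?N) + ?s)" by simp
    then show ?thesis using finite_field_power_card[OF that] by (simp only: power_add power_mult) simp
  qed
  let ?P = "monom 1 ?s - 1 :: 'a poly"
  have "coeff ?P ?s = 1" using s by simp
  then have "?P \<noteq> 0" by (metis coeff_0 zero_neq_one)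
  then have "card {x. poly ?P x = 0} \<le> degree ?P" by (rule card_poly_roots_bound)
  also have "degree ?P \<le> ?s" by (rule degree_diff_le) (auto intro: degree_monom_le)
  finally have "card {x. poly ?P x = 0} < card (UNIV - {0 :: 'a})" using s by (simp add: card_Diff_singleton)
  then have "\<not> UNIV - {0} \<subseteq> {x. poly ?P x = 0}" by (metis card_mono finite not_less)
  then show ?thesis using pow by (auto simp: poly_monom)
qed

lemma sum_power_nonzero:
  "(\<Sum>c\<in>UNIV - {0 :: 'a::{finite,field}}. c ^ s) = (if (CARD('a) - 1) dvd s then - 1 else 0)"
proof (cases "(CARD('a) - 1) dvd s")
  case True
  then have "(\<Sum>c\<in>UNIV - {0 :: 'a}. c ^ s) = (\<Sum>c\<in>UNIV - {0 :: 'a}. 1)"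
    by (intro sum.cong) (auto simp: power_mult finite_field_power_card simp del: One_nat_def elim!: dvdE)
  also have "\<dots> = of_nat CARD('a) - 1"
    using card_field_ge_2[where 'a = 'a] by (simp add: card_Diff_singleton of_nat_diff)
  finally show ?thesis using True by (simp add: of_nat_card_field)
next
  case False
  then obtain g :: 'a where g: "g \<noteq> 0" "g ^ s \<noteq> 1" using exists_power_neq_1 by blast
  have "(\<Sum>c\<in>UNIV - {0 :: 'a}. c ^ s) = (\<Sum>c\<in>UNIV - {0}. (g * c) ^ s)"
    by (rule sum.reindex_bij_witness[of _ "\<lambda>x. g * x" "\<lambda>x. x / g"]) (use g in auto)
  also have "\<dots> = g ^ s * (\<Sum>c\<in>UNIV - {0 :: 'a}. c ^ s)"
    by (simp add: power_mult_distrib sum_distrib_left)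
  finally show ?thesis using False g by simp
qed

text \<open>Because \<open>0^0 = 1\<close>, the full sum for \<open>s = 0\<close> is
  \<open>q = 0\<close> in the field, while the sum over the nonzero elements is \<open>-1\<close>.
  This difference is what allows the exponents \<open>0\<close> and \<open>q - 1\<close> to be told
  apart.\<close>

lemma sum_power:
  "(\<Sum>c\<in>UNIV. (c :: 'a::{finite,field}) ^ s) = (if s > 0 \<and> (CARD('a) - 1) dvd s then - 1 else 0)"
proof (cases "s = 0")
  case True
  then show ?thesis by (simp add: of_nat_card_field)
next
  case False
  have "(\<Sum>c\<in>UNIV. (c :: 'a) ^ s) = 0 ^ s + (\<Sum>c\<in>UNIV - {0 :: 'a}. c ^ s)"
    by (rule sum.remove) auto
  then show ?thesis using False by (simp add: sum_power_nonzero zero_power)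
qed

lemma dvd_between:
  assumes "0 < s" "s < 2 * N" shows "N dvd s \<longleftrightarrow> s = (N :: nat)"
proof
  assume "N dvd s"
  then obtain k where "s = N * k" by blast
  then show "s = N" using assms by (cases k; cases "k - 1") auto
qed simp

text \<open>The dual basis of \<open>1, x, \<dots>, x\<^sup>q\<^sup>-\<^sup>1\<close> for the pairing \<open>\<langle>f, g\<rangle> = \<Sum>\<^sub>c f(c) g(c)\<close>.  The summand \<open>1\<close>
  at \<open>i = 0\<close> separates \<open>1\<close> from \<open>x\<^sup>q\<^sup>-\<^sup>1\<close>, which agree on the nonzero elements.\<close>

definition dual_power :: "nat \<Rightarrow> 'a::{finite,field} \<Rightarrow> 'a" where
  "dual_power i c = (if i = 0 then 1 else 0) - c ^ (CARD('a) - 1 - i)"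

lemma sum_dual_power:
  assumes i: "i \<le> CARD('a) - 1" and k: "k \<le> CARD('a) - 1"
  shows "(\<Sum>c\<in>UNIV. c ^ k * dual_power i (c :: 'a::{finite,field})) = (if i = k then 1 else 0)"
proof -
  define N where "N = CARD('a) - 1"
  have N: "N > 0" using card_field_ge_2[where 'a = 'a] by (simp add: N_def)
  note sp = sum_power[where 'a = 'a, folded N_def]
  have ik: "i \<le> N" "k \<le> N" using assms by (simp_all add: N_def)
  have "(\<Sum>c\<in>UNIV. c ^ k * dual_power i (c :: 'a)) =
      (if i = 0 then (\<Sum>c\<in>UNIV. (c :: 'a) ^ k) else 0) - (\<Sum>c\<in>UNIV. (c :: 'a) ^ (k + (N - i)))"
    by (simp add: dual_power_def[where 'a = 'a, folded N_def] algebra_simps sum_subtractf power_add sum_negf)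
  also have "\<dots> = (if i = k then 1 else 0)"
  proof (cases "i = 0")
    case True
    then show ?thesis using N by (simp add: sp)
  next
    case False
    have "k + (N - i) < 2 * N" using False ik N by linarith
    then have *: "0 < k + (N - i) \<Longrightarrow> N dvd k + (N - i) \<longleftrightarrow> k + (N - i) = N"
      by (rule dvd_between[rotated])
    have "k + (N - i) = N \<longleftrightarrow> i = k" "0 < k + (N - i) \<or> i \<noteq> k" using ik False by linarith+
    then have "0 < k + (N - i) \<and> N dvd k + (N - i) \<longleftrightarrow> i = k"
      using * by (cases "0 < k + (N - i)") metis+
    then show ?thesis using False unfolding sp by (simp only: if_False minus_zero diff_0 split: if_splits) simp
  qed
  finally show ?thesis .
qed

text \<open>The indicator of \<open>y\<close> as a polynomial in \<open>x\<close>: the sum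
  \<open>?S\<close> is \<open>(x^q - y^q) / (x - y) = 1\<close> for distinct arguments, and
  \<open>q\<close> times a power of \<open>y\<close>, hence \<open>0\<close>, for equal
  ones.\<close>

lemma sum_dual_power_mult:
  "(\<Sum>i<CARD('a). dual_power i y * x ^ i) = (if x = (y :: 'a::{finite,field}) then 1 else 0)"
proof -
  let ?q = "CARD('a)" let ?S = "\<Sum>i<?q. y ^ (?q - Suc i) * x ^ i"
  have q: "?q > 0" by simp
  have "(\<Sum>i<?q. dual_power i y * x ^ i) = (\<Sum>i<?q. if i = 0 then 1 else 0) - ?S"
    unfolding sum_subtractf[symmetric] by (intro sum.cong) (auto simp: dual_power_def algebra_simps)
  also have "(\<Sum>i<?q. if i = 0 then 1 else 0) = (1 :: 'a)" using q by simp
  also have "?S = (if x = y then 0 else 1)"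
  proof (cases "x = y")
    case True
    have "?S = (\<Sum>i<?q. y ^ (?q - 1))"
      using True by (intro sum.cong refl) (simp flip: power_add)
    then show ?thesis using True by (simp add: of_nat_card_field)
  next
    case False
    have "(x - y) * ?S = (x - y) * 1"
      using power_diff_sumr2[of x ?q y] by (simp add: finite_field_power_q)
    then show ?thesis using False by simp
  qed
  finally show ?thesis by simp
qed

text \<open>\<open>monom_fun\<close> for plain functions instead of finitely supported maps. Over a
  finite index type these are the same, and exponents can be updated freely.\<close>

definition mon :: "('n::finite \<Rightarrow> nat) \<Rightarrow> 'a::field^'n \<Rightarrow> 'a" where
  "mon e x = (\<Prod>j\<in>UNIV. (x $ j) ^ e j)"

lemma monom_fun_eq_mon: "monom_fun i = mon (lookup i)"
  by (intro ext) (simp add: monom_fun_def mon_def)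

lemma mon_add: "mon (\<lambda>j. e j + e' j) x = mon e x * mon e' x"
  by (simp add: mon_def power_add prod.distrib)

definition red_exps :: "nat \<Rightarrow> ('n \<Rightarrow> nat) set" where
  "red_exps q = {e. \<forall>j. e j < q}"

lemma red_exps_PiE: "red_exps q = PiE UNIV (\<lambda>_. {..<q})"
  by (auto simp: red_exps_def)

lemma finite_red_exps [simp]: "finite (red_exps q :: ('n::finite \<Rightarrow> nat) set)"
  unfolding red_exps_PiE by (intro finite_PiE) auto

text \<open>The coefficient of \<open>mon e\<close> in the reduced polynomial of \<open>f\<close>,
  for reduced \<open>e\<close>, written as a pairing with the dual basis in each coordinate. It is
  linear in \<open>f\<close> by construction, and no polynomial has to be chosen.\<close>

definition coef :: "('n::finite \<Rightarrow> nat) \<Rightarrow> ('a::{finite,field}^'n \<Rightarrow> 'a) \<Rightarrow> 'a" where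
  "coef e f = (\<Sum>x\<in>UNIV. f x * (\<Prod>j\<in>UNIV. dual_power (e j) (x $ j)))"

lemma coef_add: "coef e (\<lambda>x. f x + g x) = coef e f + coef e g"
  by (simp add: coef_def algebra_simps sum.distrib)

lemma coef_scale: "coef e (\<lambda>x. c * f x) = c * coef e f"
  by (simp add: coef_def algebra_simps sum_distrib_left)

lemma coef_zero [simp]: "coef e (\<lambda>x. 0) = 0"
  by (simp add: coef_def)

lemma coef_sum: "coef e (\<lambda>x. \<Sum>i\<in>A. F i x) = (\<Sum>i\<in>A. coef e (F i))"
  by (induction A rule: infinite_finite_induct) (simp_all add: coef_add)

lemma sum_UNIV_vec:
  fixes F :: "'n::finite \<Rightarrow> 'a::finite \<Rightarrow> 'b::comm_semiring_1"
  shows "(\<Sum>x\<in>(UNIV :: ('a^'n) set). \<Prod>j\<in>UNIV. F j (x $ j)) = (\<Prod>j\<in>UNIV. \<Sum>c\<in>UNIV. F j c)"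
proof -
  have "(\<Prod>j\<in>UNIV. \<Sum>c\<in>UNIV. F j c) = (\<Sum>g\<in>PiE UNIV (\<lambda>_. UNIV). \<Prod>j\<in>UNIV. F j (g j))"
    by (rule prod_sum_PiE) auto
  also have "\<dots> = (\<Sum>x\<in>(UNIV :: ('a^'n) set). \<Prod>j\<in>UNIV. F j (x $ j))"
    by (rule sum.reindex_bij_witness[of _ vec_nth vec_lambda]) auto
  finally show ?thesis ..
qed

lemma coef_mon:
  assumes "e \<in> red_exps CARD('a)" "e' \<in> red_exps CARD('a)"
  shows "coef e (mon e' :: 'a::{finite,field}^'n::finite \<Rightarrow> 'a) = (if e = e' then 1 else 0)"
proof -
  have "coef e (mon e' :: 'a^'n \<Rightarrow> 'a) =
      (\<Sum>x\<in>(UNIV :: ('a^'n) set). \<Prod>j\<in>UNIV. (x $ j) ^ e' j * dual_power (e j) (x $ j))"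
    by (simp add: coef_def mon_def prod.distrib)
  also have "\<dots> = (\<Prod>j\<in>UNIV. \<Sum>c\<in>UNIV. c ^ e' j * dual_power (e j) (c :: 'a))"
    by (rule sum_UNIV_vec)
  also have "\<dots> = (\<Prod>j\<in>UNIV. if e j = e' j then 1 else 0)"
    using assms by (intro prod.cong refl sum_dual_power)
      (auto simp: red_exps_def less_Suc_eq_le[symmetric] card_gt_0_iff)
  also have "\<dots> = (if e = e' then 1 else 0)"
    by (auto simp: fun_eq_iff prod_zero_iff)
  finally show ?thesis .
qed

text \<open>Summed over all reduced \<open>e\<close>, the products of dual powers and monomials give
  the indicator of a point; exchanging the two sums yields Lagrange interpolation.\<close>

lemma mon_expansion:
  "f x = (\<Sum>e\<in>red_exps CARD('a). coef e f * mon e (x :: 'a::{finite,field}^'n::finite))"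
proof -
  have "(\<Sum>e\<in>red_exps CARD('a). coef e f * mon e x) =
      (\<Sum>e\<in>PiE UNIV (\<lambda>_. {..<CARD('a)}). \<Sum>y\<in>UNIV. f y * (\<Prod>j\<in>UNIV. dual_power (e j) (y $ j) * (x $ j) ^ e j))"
    by (simp add: coef_def mon_def sum_distrib_right prod.distrib mult.assoc red_exps_PiE)
  also have "\<dots> = (\<Sum>y\<in>UNIV. f y *
      (\<Sum>e\<in>PiE UNIV (\<lambda>_. {..<CARD('a)}). \<Prod>j\<in>UNIV. dual_power (e j) (y $ j) * (x $ j) ^ e j))"
    by (subst sum.swap) (simp add: sum_distrib_left)
  also have "\<dots> = (\<Sum>y\<in>UNIV. f y * (\<Prod>j\<in>UNIV. \<Sum>i<CARD('a). dual_power i (y $ j) * (x $ j) ^ i))"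
    by (subst prod_sum_PiE) auto
  also have "\<dots> = (\<Sum>y\<in>UNIV. f y * (if x = y then 1 else 0))"
    by (intro sum.cong refl arg_cong2[of _ _ _ _ "(*)"])
      (auto simp: sum_dual_power_mult vec_eq_iff prod_zero_iff)
  also have "\<dots> = (\<Sum>y\<in>UNIV. if x = y then f y else 0)" by (intro sum.cong) auto
  also have "\<dots> = f x" by simp
  finally show ?thesis ..
qed

lemma reduced_mpoly_coef:
  fixes P :: "('n::finite \<Rightarrow>\<^sub>0 nat) \<Rightarrow>\<^sub>0 'a::{finite,field}"
  assumes "reduced P"
  shows "lookup P i = (if lookup i \<in> red_exps CARD('a)
    then coef (lookup i) (mpoly_fun P) else 0)"
proof (cases "lookup i \<in> red_exps CARD('a)")
  case True
  have red: "lookup k \<in> red_exps CARD('a)" if "k \<in> Poly_Mapping.keys P" for k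
    using assms that by (auto simp: reduced_def red_exps_def less_Suc_eq_le[symmetric] card_gt_0_iff)
  have "coef (lookup i) (mpoly_fun P) =
      (\<Sum>k\<in>Poly_Mapping.keys P. lookup P k *
        coef (lookup i) (mon (lookup k)))"
    unfolding mpoly_fun_def[abs_def] monom_fun_eq_mon coef_sum coef_scale ..
  also have "\<dots> = (\<Sum>k\<in>Poly_Mapping.keys P. if i = k then lookup P k else 0)"
  proof (intro sum.cong refl)
    fix k assume k: "k \<in> Poly_Mapping.keys P"
    have "lookup i = lookup k \<longleftrightarrow> i = k"
      by (simp only: poly_mapping_eq_iff)
    then show "lookup P k * coef (lookup i) (mon (lookup k)) =
        (if i = k then lookup P k else 0)"
      unfolding coef_mon[OF True red[OF k]] by simp
  qed
  also have "\<dots> = lookup P i" by (simp add: in_keys_iff)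
  finally show ?thesis using True by simp
next
  case False
  then have "i \<notin> Poly_Mapping.keys P"
    using assms by (auto simp: reduced_def red_exps_def less_Suc_eq_le[symmetric] card_gt_0_iff)
  then show ?thesis using False by (simp add: in_keys_iff)
qed

text \<open>Justifies the definite description in \<open>fun_deg\<close>:
  \<open>mon_expansion\<close> gives existence, and uniqueness holds since \<open>coef\<close>
  recovers every coefficient of a reduced polynomial.\<close>

lemma ex1_reduced:
  fixes f :: "'a::{finite,field}^'n::finite \<Rightarrow> 'a"
  shows "\<exists>!P. reduced P \<and> mpoly_fun P = f"
proof -
  define P where "P = Abs_poly_mapping
    (\<lambda>i. if lookup i \<in> red_exps CARD('a) then coef (lookup i) f else 0)"
  have bij: "bij_betw lookup {i :: 'n \<Rightarrow>\<^sub>0 nat. lookup i \<in> red_exps CARD('a)} (red_exps CARD('a))"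
    using lookup_bij by (auto simp: bij_betw_def inj_on_def bij_def surj_def image_iff)
  then have fin: "finite {i :: 'n \<Rightarrow>\<^sub>0 nat. lookup i \<in> red_exps CARD('a)}"
    using bij_betw_finite finite_red_exps by blast
  then have P: "lookup P i =
      (if lookup i \<in> red_exps CARD('a) then coef (lookup i) f else 0)" for i
    unfolding P_def by (subst Abs_poly_mapping_inverse) (auto elim: finite_subset[rotated])
  have keys: "Poly_Mapping.keys P \<subseteq> {i. lookup i \<in> red_exps CARD('a)}"
    by (auto simp: in_keys_iff P split: if_splits)
  have "mpoly_fun P x = f x" for x
  proof -
    have "mpoly_fun P x = (\<Sum>i | lookup i \<in> red_exps CARD('a).
        lookup P i * monom_fun i x)"
      unfolding mpoly_fun_def by (intro sum.mono_neutral_left fin keys) (auto simp: in_keys_iff)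
    also have "\<dots> = (\<Sum>i | lookup i \<in> red_exps CARD('a).
        coef (lookup i) f * mon (lookup i) x)"
      by (intro sum.cong) (auto simp: P monom_fun_eq_mon)
    also have "\<dots> = (\<Sum>e\<in>red_exps CARD('a). coef e f * mon e x)"
      by (rule sum.reindex_bij_betw[OF bij])
    finally show ?thesis using mon_expansion[of f x] by simp
  qed
  moreover have "reduced P"
    using keys card_field_ge_2[where 'a = 'a]
    by (auto simp: reduced_def red_exps_def less_Suc_eq_le[symmetric] card_gt_0_iff dest!: subsetD)
  moreover have "P = P'" if "reduced P'" "mpoly_fun P' = f" for P'
    using that reduced_mpoly_coef[of P'] P by (intro poly_mapping_eqI) simp
  ultimately show ?thesis by (intro ex1I[of _ P]) auto
qed

lemma all_lookup:
  "(\<forall>i :: 'n::finite \<Rightarrow>\<^sub>0 nat. Q (lookup i)) \<longleftrightarrow> (\<forall>e. Q e)"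
  using bij_is_surj[OF lookup_bij] by (metis surjD)

text \<open>The bound \<open>-1\<close> on \<open>d\<close> matches the degree of the zero
  polynomial: below it \<open>RM d\<close> is empty, while the zero function satisfies the
  right-hand side.\<close>

lemma RM_iff:
  fixes f :: "'a::{finite,field}^'n::finite \<Rightarrow> 'a"
  assumes "d \<ge> - 1"
  shows "f \<in> RM d \<longleftrightarrow> (\<forall>e\<in>red_exps CARD('a). d < int (sum e UNIV) \<longrightarrow> coef e f = 0)"
proof -
  define P where "P = (THE P. reduced P \<and> mpoly_fun P = f)"
  have P: "reduced P" "mpoly_fun P = f"
    using theI'[OF ex1_reduced[of f]] unfolding P_def by auto
  have "f \<in> RM d \<longleftrightarrow> (\<forall>i\<in>Poly_Mapping.keys P. int (abs_index i) \<le> d)"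
    unfolding RM_def mem_Collect_eq fun_deg_def P_def[symmetric] total_deg_def using assms
    by (auto simp: Max_le_iff)
  also have "\<dots> \<longleftrightarrow> (\<forall>i. lookup i \<in> red_exps CARD('a) \<longrightarrow>
      d < int (sum (lookup i) UNIV) \<longrightarrow> coef (lookup i) f = 0)"
    unfolding in_keys_iff Ball_def reduced_mpoly_coef[OF P(1)] P(2) abs_index_def
    by (auto simp: not_le)
  also have "\<dots> \<longleftrightarrow> (\<forall>e\<in>red_exps CARD('a). d < int (sum e UNIV) \<longrightarrow> coef e f = 0)"
    using all_lookup[of "\<lambda>e. e \<in> red_exps CARD('a) \<longrightarrow> d < int (sum e UNIV) \<longrightarrow> coef e f = 0"] by blast
  finally show ?thesis .
qed

section \<open>Substitutions and the map \<open>T\<close>\<close>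

lemma CHAR_eq_prime:
  assumes p: "prime p" and card: "CARD('a::{finite,field}) = p ^ m"
  shows "CHAR('a) = p"
proof -
  have "of_nat p ^ m = (0 :: 'a)" using of_nat_card_field[where 'a = 'a] card by simp
  then have "of_nat p = (0 :: 'a)" by simp
  then have "CHAR('a) dvd p" by (simp add: of_nat_eq_0_iff_char_dvd)
  moreover have "CHAR('a) \<noteq> 1"
  proof
    assume "CHAR('a) = 1"
    then have "of_nat 1 = (0 :: 'a)" by (metis of_nat_CHAR)
    then show False by simp
  qed
  ultimately show ?thesis using p by (metis One_nat_def prime_nat_iff)
qed

lemma CHAR_poly: "CHAR('b::comm_semiring_1 poly) = CHAR('b)"
proof -
  have "(of_nat n = (0 :: 'b poly)) = (of_nat n = (0 :: 'b))" for n
    by (simp add: of_nat_poly)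
  then have "CHAR('b poly) dvd n \<longleftrightarrow> CHAR('b) dvd n" for n
    by (simp add: of_nat_eq_0_iff_char_dvd)
  then show ?thesis by (metis dvd_antisym dvd_refl)
qed

text \<open>A case of Lucas' theorem. With \<open>a = N h + b\<close> and \<open>b < N\<close>,
  Frobenius gives \<open>(1 + X)^a = (1 + X^N)^h (1 + X)^b\<close>, whose coefficient at
  \<open>X^N\<close> is \<open>h\<close>. Modulo the characteristic, \<open>h\<close> is digit
  \<open>t\<close> of \<open>a\<close>.\<close>

lemma of_nat_choose_prime_power:
  fixes N :: nat
  assumes p: "prime CHAR('b::comm_ring_1)" and N: "N = CHAR('b) ^ t"
  shows "of_nat (a choose N) = (of_nat (a div N) :: 'b)"
proof -
  define h b where "h = a div N" and "b = a mod N"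
  have N0: "N > 0" using p by (simp add: N prime_gt_0_nat)
  have b: "b < N" using N0 by (simp add: b_def)
  have a: "a = N * h + b" by (simp add: h_def b_def)
  let ?X = "monom 1 1 :: 'b poly"
  have lin: "[:1, 1:] = ?X + 1" by (simp add: monom_altdef one_pCons)
  have dream: "(?X + 1) ^ N = ?X ^ N + 1"
    using freshmans_dream'[of N t ?X 1] p N by (simp add: CHAR_poly)
  have "of_nat (a choose N) = coeff ([:1, 1:] ^ a :: 'b poly) N"
  proof (cases "N \<le> a")
    case False
    then show ?thesis using degree_linear_power[of 1 a] degree_power_le[of "[:1, 1 :: 'b:]" a]
      by (subst coeff_eq_0) (auto simp: binomial_eq_0 intro: le_less_trans)
  qed (simp add: coeff_linear_poly_power)
  also have "[:1, 1:] ^ a = (?X ^ N + 1) ^ h * (?X + 1) ^ b"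
    unfolding a power_add power_mult lin dream ..
  also have "\<dots> = (\<Sum>i\<le>h. of_nat (h choose i) * ?X ^ (N * i)) * (\<Sum>s\<le>b. of_nat (b choose s) * ?X ^ s)"
    by (simp add: binomial_ring power_mult)
  also have "coeff \<dots> N = (\<Sum>i\<le>h. \<Sum>s\<le>b. of_nat (h choose i) * of_nat (b choose s) *
      (if N * i + s = N then 1 else 0))"
    unfolding sum_product coeff_sum
    by (intro sum.cong refl) (auto simp: monom_power of_nat_monom mult_monom)
  also have "\<dots> = (\<Sum>i\<le>h. if i = 1 then of_nat h else 0)"
  proof (intro sum.cong refl)
    fix i
    have *: "N * i + s = N \<longleftrightarrow> i = 1 \<and> s = 0" if "s \<le> b" for s
      using that b N0 by (cases i; cases "i - 1") auto
    have "(\<Sum>s\<le>b. of_nat (h choose i) * of_nat (b choose s) * (if N * i + s = N then 1 else (0::'b))) =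
        (\<Sum>s\<le>b. if s = 0 then (if i = 1 then of_nat h else 0) else 0)"
      using * by (intro sum.cong refl) auto
    then show "(\<Sum>s\<le>b. of_nat (h choose i) * of_nat (b choose s) * (if N * i + s = N then 1 else (0::'b))) =
        (if i = 1 then of_nat h else 0)" by simp
  qed
  also have "\<dots> = of_nat h" by (cases "h = 0") (auto simp: sum.delta)
  finally show ?thesis by (simp add: h_def)
qed

section \<open>A filtration by residue sums that linear substitutions respect\<close>

lemma mod_sum_add_le: "mod_sum p (\<lambda>j. e j + e' j) k \<le> mod_sum p e k + mod_sum p e' k"
  unfolding mod_sum_def sum.distrib[symmetric]
  by (intro sum_mono) (metis mod_add_eq mod_less_eq_dividend)

text \<open>The span of the monomials whose residue sums are bounded by \<open>\<tau>\<close> at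
  every \<open>k\<close>. Exponents may be unreduced, because products and powers leave the reduced
  range; reduction comes only at the end.\<close>

inductive_set filt :: "nat \<Rightarrow> (nat \<Rightarrow> nat) \<Rightarrow> ('a::field^'n::finite \<Rightarrow> 'a) set" for p \<tau> where
  filt_zero: "(\<lambda>x. 0) \<in> filt p \<tau>"
| filt_step: "f \<in> filt p \<tau> \<Longrightarrow> (\<And>k. mod_sum p e k \<le> \<tau> k) \<Longrightarrow> (\<lambda>x. c * mon e x + f x) \<in> filt p \<tau>"

lemma filt_mon: "(\<And>k. mod_sum p e k \<le> \<tau> k) \<Longrightarrow> (\<lambda>x. c * mon e x) \<in> filt p \<tau>"
  using filt_step[OF filt_zero, of p e \<tau> c] by simp

lemma filt_add: "f \<in> filt p \<tau> \<Longrightarrow> g \<in> filt p \<tau> \<Longrightarrow> (\<lambda>x. f x + g x) \<in> filt p \<tau>"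
  by (induction rule: filt.induct) (auto simp: add.assoc intro: filt_step)

lemma filt_sum: "(\<And>i. i \<in> A \<Longrightarrow> F i \<in> filt p \<tau>) \<Longrightarrow> (\<lambda>x. \<Sum>i\<in>A. F i x) \<in> filt p \<tau>"
  by (induction A rule: infinite_finite_induct) (auto intro: filt_zero filt_add)

lemma filt_mult:
  assumes "f \<in> filt p \<tau>" "g \<in> filt p \<sigma>"
  shows "(\<lambda>x. f x * g x) \<in> filt p (\<lambda>k. \<tau> k + \<sigma> k)"
  using assms(1)
proof (induction rule: filt.induct)
  case filt_zero
  then show ?case by (simp add: filt.filt_zero)
next
  case (filt_step f e c)
  note e = filt_step.hyps(2) and IH = filt_step.IH
  have "(\<lambda>x. c * mon e x * g x) \<in> filt p (\<lambda>k. \<tau> k + \<sigma> k)"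
    using assms(2)
  proof (induction rule: filt.induct)
    case filt_zero
    then show ?case by (simp add: filt.filt_zero)
  next
    case (filt_step g e' c')
    have "mod_sum p (\<lambda>j. e j + e' j) k \<le> \<tau> k + \<sigma> k" for k
      using mod_sum_add_le[of p e e' k] filt_step.hyps(2)[of k] e[of k] by linarith
    then have "(\<lambda>x. (c * c') * mon (\<lambda>j. e j + e' j) x + c * mon e x * g x) \<in> filt p (\<lambda>k. \<tau> k + \<sigma> k)"
      using filt_step.IH by (rule filt.filt_step[rotated])
    then show ?case by (simp add: mon_add algebra_simps)
  qed
  then show ?case using filt_add[OF _ IH] by (simp add: distrib_right)
qed

lemma mon_zero: "mon (\<lambda>j. 0) x = 1"
  by (simp add: mon_def)

lemma filt_one: "(\<lambda>x. 1) \<in> filt p (\<lambda>k. 0)"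
  using filt_mon[of p "\<lambda>j. 0" "\<lambda>k. 0" 1] by (simp add: mod_sum_def mon_zero)

lemma filt_power: "f \<in> filt p \<tau> \<Longrightarrow> (\<lambda>x. f x ^ d) \<in> filt p (\<lambda>k. d * \<tau> k)"
  using filt_mult[of f p \<tau>] by (induction d) (simp_all add: filt_one)

lemma filt_prod:
  "finite A \<Longrightarrow> (\<And>i. i \<in> A \<Longrightarrow> F i \<in> filt p (\<tau> i)) \<Longrightarrow>
    (\<lambda>x. \<Prod>i\<in>A. F i x) \<in> filt p (\<lambda>k. \<Sum>i\<in>A. \<tau> i k)"
  by (induction A rule: finite_induct) (simp_all add: filt_one filt_mult)

text \<open>Raising to the power \<open>p^l\<close> is additive, so only pure powers of single
  variables occur, each with the residue sum of the number \<open>p^l\<close>.\<close>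

lemma filt_linear_form:
  fixes A :: "'a::{finite,field}^'n^'n::finite"
  assumes "prime p" "CARD('a) = p ^ m"
  shows "(\<lambda>x. ((x v* A) $ j) ^ p ^ l) \<in> filt p (\<lambda>k. p ^ l mod p ^ k)"
proof -
  have char: "CHAR('a) = p" using assms by (rule CHAR_eq_prime)
  have "((x v* A) $ j) ^ p ^ l = (\<Sum>i\<in>UNIV. (A $ i $ j) ^ p ^ l * mon (\<lambda>t. if t = i then p ^ l else 0) x)" for x
  proof -
    have m: "mon (\<lambda>t. if t = i then p ^ l else 0) x = (x $ i) ^ p ^ l" for i
      by (simp add: mon_def if_distrib[of "\<lambda>e. _ ^ e"] prod.delta cong: if_cong)
    have "((x v* A) $ j) ^ p ^ l = (\<Sum>i\<in>UNIV. (x $ i * A $ i $ j) ^ p ^ l)"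
      unfolding vector_matrix_mult_def by (simp add: freshmans_dream_sum'[of "p ^ l" l] char assms)
    then show ?thesis by (simp add: m power_mult_distrib mult.commute)
  qed
  moreover have "(\<lambda>x. \<Sum>i\<in>UNIV. (A $ i $ j) ^ p ^ l * mon (\<lambda>t. if t = i then p ^ l else 0) x)
      \<in> filt p (\<lambda>k. p ^ l mod p ^ k)"
    by (intro filt_sum filt_mon)
      (simp add: mod_sum_def if_distrib[of "\<lambda>e. e mod _"] sum.delta cong: if_cong)
  ultimately show ?thesis by simp
qed

text \<open>A summand survives only for \<open>l < k\<close>. The bounds of the individual digit
  factors therefore add up to the residue itself, with nothing lost.\<close>

lemma sum_digit_mod:
  assumes p: "p > 1" and a: "a < p ^ m"
  shows "(\<Sum>l<m. digit p l a * (p ^ l mod p ^ k)) = a mod p ^ k"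
proof -
  have "p ^ l mod p ^ k = (if l < k then p ^ l else 0)" for l
  proof (cases "l < k")
    case True
    then show ?thesis using p by (simp add: power_strict_increasing)
  next
    case False
    then show ?thesis using le_imp_power_dvd[of k l p] by (simp add: dvd_eq_mod_eq_0)
  qed
  then have "(\<Sum>l<m. digit p l a * (p ^ l mod p ^ k)) = (\<Sum>l<m. if l < k then digit p l a * p ^ l else 0)"
    by (intro sum.cong) auto
  also have "\<dots> = (\<Sum>l\<in>{l. l < m \<and> l < k}. digit p l a * p ^ l)"
    by (subst sum.inter_filter[symmetric]) (auto intro: sum.cong)
  also have "{l. l < m \<and> l < k} = {..<min m k}" by auto
  also have "(\<Sum>l<min m k. digit p l a * p ^ l) = a mod p ^ k"
  proof (cases "m \<le> k")
    case True
    then have "a < p ^ k" using a p by (meson less_le_trans power_increasing less_imp_le)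
    then show ?thesis using True a by (simp add: sum_digit min_def)
  qed (simp add: sum_digit min_def)
  finally show ?thesis .
qed

text \<open>Each power of a linear form is split, by the digits of its exponent, into Frobenius
  powers; the bounds of all factors add up to \<open>mod_sum p e\<close>.\<close>

lemma filt_act_mon:
  fixes A :: "'a::{finite,field}^'n^'n::finite"
  assumes p: "prime p" "CARD('a) = p ^ m" and e: "e \<in> red_exps CARD('a)"
  shows "(\<lambda>x. mon e (x v* A)) \<in> filt p (mod_sum p e)"
proof -
  have e: "e j < p ^ m" for j using e p by (simp add: red_exps_def)
  have eq: "mon e (x v* A) = (\<Prod>j\<in>UNIV. \<Prod>l<m. (((x v* A) $ j) ^ p ^ l) ^ digit p l (e j))" for x
  proof -
    have "((x v* A) $ j) ^ e j = (\<Prod>l<m. (((x v* A) $ j) ^ p ^ l) ^ digit p l (e j))" for j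
    proof -
      have "e j = (\<Sum>l<m. digit p l (e j) * p ^ l)" using e[of j] by (simp add: sum_digit)
      then have "((x v* A) $ j) ^ e j = ((x v* A) $ j) ^ (\<Sum>l<m. p ^ l * digit p l (e j))"
        by (simp add: mult.commute)
      then show ?thesis by (simp add: power_sum power_mult)
    qed
    then show ?thesis by (simp add: mon_def)
  qed
  have "(\<lambda>x. mon e (x v* A)) \<in>
      filt p (\<lambda>k. \<Sum>j\<in>UNIV. \<Sum>l<m. digit p l (e j) * (p ^ l mod p ^ k))"
    unfolding eq by (intro filt_prod filt_power filt_linear_form[OF p]) auto
  then show ?thesis
    using e p by (simp add: sum_digit_mod prime_gt_Suc_0_nat mod_sum_def[abs_def])
qed

lemma mod_sum_le_imp_sum_le:
  assumes "p > 1" "\<And>k. mod_sum p e k \<le> mod_sum p e0 k"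
  shows "sum e UNIV \<le> sum e0 UNIV"
proof -
  \<comment> \<open>Any \<open>k\<close> with \<open>p^k\<close> above all entries turns residues
    into entries; the sum itself qualifies, since \<open>s < p^s\<close>.\<close>
  let ?k = "sum e UNIV"
  have "e j < p ^ ?k" for j
  proof -
    have "e j \<le> ?k" by (rule member_le_sum) auto
    also have "?k < p ^ ?k" using assms(1) by (intro power_gt_expt) simp
    finally show ?thesis .
  qed
  then have "sum e UNIV = mod_sum p e ?k" by (simp add: mod_sum_def)
  also have "\<dots> \<le> mod_sum p e0 ?k" by (rule assms(2))
  also have "\<dots> \<le> sum e0 UNIV" by (simp add: mod_sum_def sum_mono)
  finally show ?thesis .
qed

text \<open>Replacing \<open>x^q\<close> by \<open>x\<close> lowers an exponent by
  \<open>q - 1\<close>. The strict drop of the degree is what sends unreduced monomials of degree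
  \<open>r\<close> to zero in \<open>H_q(r,n)\<close>.\<close>

lemma mon_reduce:
  fixes e :: "'n::finite \<Rightarrow> nat"
  shows "\<exists>e'\<in>red_exps CARD('a). (mon e' :: 'a::{finite,field}^'n \<Rightarrow> 'a) = mon e \<and>
    sum e' UNIV \<le> sum e UNIV \<and> (e \<notin> red_exps CARD('a) \<longrightarrow> sum e' UNIV < sum e UNIV)"
proof (induction "sum e UNIV" arbitrary: e rule: less_induct)
  case less
  show ?case
  proof (cases "e \<in> red_exps CARD('a)")
    case False
    then obtain j where j: "CARD('a) \<le> e j" by (auto simp: red_exps_def not_less)
    define e1 where "e1 = e(j := e j - (CARD('a) - 1))"
    have q: "CARD('a) \<ge> 2" by (rule card_field_ge_2)
    have "mon e1 x = mon e x" for x :: "'a^'n"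
    proof -
      have "(x $ i) ^ e1 i = (x $ i) ^ e i" for i
      proof (cases "i = j")
        case True
        have "e j = CARD('a) + (e j - CARD('a))" using j by simp
        then have "(x $ j) ^ e j = (x $ j) ^ CARD('a) * (x $ j) ^ (e j - CARD('a))" by (metis power_add)
        also have "\<dots> = (x $ j) ^ Suc (e j - CARD('a))" by (simp add: finite_field_power_q)
        also have "Suc (e j - CARD('a)) = e1 j" using j q by (simp add: e1_def)
        finally show ?thesis using True by simp
      qed (simp add: e1_def)
      then show ?thesis by (simp add: mon_def)
    qed
    moreover have lt: "sum e1 UNIV < sum e UNIV"
      by (rule sum_strict_mono_ex1) (use j q in \<open>auto simp: e1_def intro!: bexI[of _ j]\<close>)
    ultimately show ?thesis using less.hyps[OF lt] False by (metis ext less_le_trans order_le_less_trans less_imp_le)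
  qed auto
qed

text \<open>The preimage, in functions, of the span of the monomials of \<open>J\<close> in
  \<open>H_q(r,n)\<close>. The extremes \<open>UNIV\<close> and \<open>{}\<close> give
  \<open>R_q(r,n)\<close> and \<open>R_q(r-1,n)\<close>.\<close>

definition top_space :: "nat \<Rightarrow> ('n \<Rightarrow> nat) set \<Rightarrow> ('a::{finite,field}^'n::finite \<Rightarrow> 'a) set" where
  "top_space r J = {f. \<forall>e\<in>red_exps CARD('a). coef e f \<noteq> 0 \<longrightarrow>
    sum e UNIV < r \<or> sum e UNIV = r \<and> e \<in> J}"

lemma RM_eq_top_space:
  "RM (int r) = top_space r UNIV" "RM (int r - 1) = top_space r {}"
proof -
  have "int r - 1 < int s \<longleftrightarrow> \<not> s < r" "int r < int s \<longleftrightarrow> \<not> (s < r \<or> s = r)" for s by linarith+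
  then show "RM (int r) = top_space r UNIV" "RM (int r - 1) = top_space r {}"
    by (auto simp: set_eq_iff RM_iff top_space_def simp del: of_nat_sum)
qed

lemma top_space_zero: "(\<lambda>x. 0) \<in> top_space r J"
  by (simp add: top_space_def)

lemma top_space_add: "f \<in> top_space r J \<Longrightarrow> g \<in> top_space r J \<Longrightarrow> (\<lambda>x. f x + g x) \<in> top_space r J"
  unfolding top_space_def coef_add mem_Collect_eq by (metis add.right_neutral)

lemma top_space_scale: "f \<in> top_space r J \<Longrightarrow> (\<lambda>x. c * f x) \<in> top_space r J"
  by (simp add: top_space_def coef_scale)

lemma top_space_sum: "(\<And>i. i \<in> A \<Longrightarrow> F i \<in> top_space r J) \<Longrightarrow> (\<lambda>x. \<Sum>i\<in>A. F i x) \<in> top_space r J"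
  by (induction A rule: infinite_finite_induct) (auto intro: top_space_zero top_space_add)

lemma top_space_mono: "J \<subseteq> J' \<Longrightarrow> top_space r J \<subseteq> top_space r J'"
  by (auto simp: top_space_def)

lemma mon_in_top_space:
  assumes "sum e UNIV \<le> r" and "e \<in> red_exps CARD('a) \<Longrightarrow> sum e UNIV = r \<Longrightarrow> e \<in> J"
  shows "(mon e :: 'a::{finite,field}^'n::finite \<Rightarrow> 'a) \<in> top_space r J"
proof -
  obtain e' where e': "e' \<in> red_exps CARD('a)" "(mon e' :: 'a^'n \<Rightarrow> 'a) = mon e" "sum e' UNIV \<le> sum e UNIV"
    "e \<notin> red_exps CARD('a) \<Longrightarrow> sum e' UNIV < sum e UNIV"
    using mon_reduce[of e, where 'a = 'a] by blast
  show ?thesis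
  proof (cases "e \<in> red_exps CARD('a)")
    case True
    then show ?thesis using assms unfolding top_space_def by (auto simp: coef_mon le_less)
  next
    case False
    then have "(mon e' :: 'a^'n \<Rightarrow> 'a) \<in> top_space r J"
      using e'(1,4) False assms(1) unfolding top_space_def by (auto simp: coef_mon)
    then show ?thesis by (simp add: e')
  qed
qed

definition down_closed :: "nat \<Rightarrow> nat \<Rightarrow> nat \<Rightarrow> ('n::finite \<Rightarrow> nat) set \<Rightarrow> bool" where
  "down_closed p m r J \<longleftrightarrow> (\<forall>e\<in>J. \<forall>e'\<in>red_exps (p ^ m). sum e' UNIV = r \<longrightarrow>
    (\<forall>k\<le>m. mod_sum p e' k \<le> mod_sum p e k) \<longrightarrow> e' \<in> J)"

lemma filt_subset_top_space:
  assumes "\<And>e. (\<And>k. mod_sum p e k \<le> \<tau> k) \<Longrightarrow>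
    (mon e :: 'a::{finite,field}^'n::finite \<Rightarrow> 'a) \<in> top_space r J"
  shows "filt p \<tau> \<subseteq> (top_space r J :: ('a^'n \<Rightarrow> 'a) set)"
proof
  fix f :: "'a^'n \<Rightarrow> 'a" assume "f \<in> filt p \<tau>"
  then show "f \<in> top_space r J"
  proof (induction rule: filt.induct)
    case (filt_step f e c)
    then show ?case by (intro top_space_add top_space_scale assms) auto
  qed (rule top_space_zero)
qed

text \<open>The monomials produced by the substitution are bounded by the original one in every
  \<open>mod_sum\<close>, hence also in degree. Those that are reduced and still of degree
  \<open>r\<close> are covered by \<open>down_closed\<close>; all others have, or reduce to, smaller
  degree.\<close>

lemma top_space_act:
  fixes A :: "'a::{finite,field}^'n^'n::finite"
  assumes p: "prime p" "CARD('a) = p ^ m" and J: "down_closed p m r J" and f: "f \<in> top_space r J"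
  shows "(\<lambda>x. f (x v* A)) \<in> top_space r J"
proof -
  have p1: "p > 1" using p(1) by (rule prime_gt_1_nat)
  have "(\<lambda>x. coef e f * mon e (x v* A)) \<in> top_space r J" if e: "e \<in> red_exps CARD('a)" for e
  proof (cases "coef e f = 0")
    case True
    then show ?thesis by (simp add: top_space_zero)
  next
    case False
    then have e': "sum e UNIV < r \<or> sum e UNIV = r \<and> e \<in> J"
      using f e by (auto simp: top_space_def)
    have "filt p (mod_sum p e) \<subseteq> (top_space r J :: ('a^'n \<Rightarrow> 'a) set)"
    proof (intro filt_subset_top_space mon_in_top_space)
      fix e1 :: "'n \<Rightarrow> nat" assume le: "\<And>k. mod_sum p e1 k \<le> mod_sum p e k"
      have s: "sum e1 UNIV \<le> sum e UNIV" using mod_sum_le_imp_sum_le[OF p1 le] .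
      then show "sum e1 UNIV \<le> r" using e' by auto
      assume "e1 \<in> red_exps CARD('a)" "sum e1 UNIV = r"
      then show "e1 \<in> J" using e' s le J p(2) unfolding down_closed_def by auto
    qed
    then show ?thesis using filt_act_mon[OF p e, of A] by (intro top_space_scale) blast
  qed
  then have "(\<lambda>x. \<Sum>e\<in>red_exps CARD('a). coef e f * mon e (x v* A)) \<in> top_space r J"
    by (rule top_space_sum)
  then show ?thesis by (simp flip: mon_expansion)
qed

section \<open>Operators in the group algebra of \<open>GL(n, F\<^sub>q)\<close>\<close>

lemma GL_simps [simp]: "carrier GL = {A. invertible A}" "A \<otimes>\<^bsub>GL\<^esub> B = A ** B" "\<one>\<^bsub>GL\<^esub> = mat 1"
  by (simp_all add: GL_def)

lemma invertible_mat_1: "invertible (mat 1 :: 'a::field^'n::finite^'n)"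
  by (auto simp: invertible_def intro: exI[of _ "mat 1"])

lemma group_GL: "group (GL :: ('a::field^'n::finite^'n) monoid)"
proof (rule groupI)
  fix A :: "'a^'n^'n" assume "A \<in> carrier GL"
  then obtain B where "A ** B = mat 1" "B ** A = mat 1" by (auto simp: invertible_def)
  then show "\<exists>B\<in>carrier GL. B \<otimes>\<^bsub>GL\<^esub> A = \<one>\<^bsub>GL\<^esub>" by (auto simp: invertible_def)
qed (auto simp: invertible_mult matrix_mul_assoc invertible_mat_1)

lemma fun_rep_simps [simp]:
  "carrier fun_rep = UNIV" "\<zero>\<^bsub>fun_rep\<^esub> = (\<lambda>_. 0)"
  "f \<oplus>\<^bsub>fun_rep\<^esub> g = (\<lambda>x. f x + g x)" "c \<odot>\<^bsub>fun_rep\<^esub> f = (\<lambda>x. c * f x)"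
  "act fun_rep A f = (\<lambda>x. f (x v* A))"
  by (simp_all add: fun_rep_def)

lemma ring_of_type_simps [simp]:
  "carrier (ring_of_type_algebra :: 'a::field ring) = UNIV"
  "\<zero>\<^bsub>(ring_of_type_algebra :: 'a::field ring)\<^esub> = 0"
  "\<one>\<^bsub>(ring_of_type_algebra :: 'a::field ring)\<^esub> = 1"
  "(a :: 'a::field) \<oplus>\<^bsub>ring_of_type_algebra\<^esub> b = a + b"
  "(a :: 'a::field) \<otimes>\<^bsub>ring_of_type_algebra\<^esub> b = a * b"
  by (simp_all add: ring_of_type_algebra_def)

lemma linear_rep_fun_rep:
  "linear_rep (GL :: ('a::field^'n::finite^'n) monoid) ring_of_type_algebra fun_rep"
proof -
  have ab: "abelian_group (fun_rep :: ('a, 'a^'n \<Rightarrow> 'a, 'a^'n^'n) gmod)"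
  proof (rule abelian_groupI)
    fix f :: "'a^'n \<Rightarrow> 'a"
    show "\<exists>g\<in>carrier fun_rep. g \<oplus>\<^bsub>fun_rep\<^esub> f = \<zero>\<^bsub>fun_rep\<^esub>"
      by (intro bexI[of _ "\<lambda>x. - f x"]) auto
  qed (auto simp: algebra_simps)
  have md: "Module.module (ring_of_type_algebra :: 'a ring) (fun_rep :: ('a, 'a^'n \<Rightarrow> 'a, 'a^'n^'n) gmod)"
    by (rule moduleI) (use ab in \<open>auto simp: algebra_simps\<close>)
  interpret vectorspace "ring_of_type_algebra :: 'a ring" "fun_rep :: ('a, 'a^'n \<Rightarrow> 'a, 'a^'n^'n) gmod"
    by (intro vectorspace.intro md) auto
  interpret group "GL :: ('a::field^'n::finite^'n) monoid" by (rule group_GL)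
  show ?thesis
    by unfold_locales (auto simp: module_hom_def vector_matrix_mul_assoc)
qed

text \<open>Separates a group algebra expression from its effect on functions; the expression is
  recovered only when the operator is carried over to quotients.\<close>

definition realizable :: "(('a::field^'n::finite \<Rightarrow> 'a) \<Rightarrow> 'a^'n \<Rightarrow> 'a) \<Rightarrow> bool" where
  "realizable L \<longleftrightarrow> (\<exists>E. gexp_on (GL :: ('a^'n^'n) monoid) (ring_of_type_algebra :: 'a ring) E \<and>
    (\<forall>f. ev fun_rep E f = L f))"

lemma realizable_act: "invertible A \<Longrightarrow> realizable (\<lambda>f x. f (x v* A))"
  unfolding realizable_def by (intro exI[of _ "Act A"]) auto

lemma realizable_add: "realizable L \<Longrightarrow> realizable M \<Longrightarrow> realizable (\<lambda>f x. L f x + M f x)"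
proof -
  assume "realizable L" "realizable M"
  then obtain E F where "gexp_on GL ring_of_type_algebra E" "\<And>f. ev fun_rep E f = L f"
    "gexp_on GL ring_of_type_algebra F" "\<And>f. ev fun_rep F f = M f"
    unfolding realizable_def by blast
  then show ?thesis unfolding realizable_def by (intro exI[of _ "Plus E F"]) simp
qed

lemma realizable_scale: "realizable L \<Longrightarrow> realizable (\<lambda>f x. c * L f x)"
  unfolding realizable_def by (elim exE, rule exI[of _ "Scale c _"]) auto

lemma realizable_comp: "realizable L \<Longrightarrow> realizable M \<Longrightarrow> realizable (\<lambda>f. L (M f))"
proof -
  assume "realizable L" "realizable M"
  then obtain E F where "gexp_on GL ring_of_type_algebra E" "\<And>f. ev fun_rep E f = L f"
    "gexp_on GL ring_of_type_algebra F" "\<And>f. ev fun_rep F f = M f"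
    unfolding realizable_def by blast
  then show ?thesis unfolding realizable_def by (intro exI[of _ "Times E F"]) simp
qed

lemma realizable_id: "realizable (\<lambda>f. f)"
  using realizable_act[of "mat 1"] by (simp add: invertible_mat_1)

lemma realizable_sum:
  "(\<And>c. c \<in> C \<Longrightarrow> realizable (L c)) \<Longrightarrow> realizable (\<lambda>f x. \<Sum>c\<in>C. L c f x)"
proof (induction C rule: infinite_finite_induct)
  case (insert c C)
  then show ?case using realizable_add[of "L c"] by simp
qed (use realizable_scale[OF realizable_id, of 0] in simp_all)

definition invariant :: "('a::field^'n::finite \<Rightarrow> 'a) set \<Rightarrow> bool" where
  "invariant W \<longleftrightarrow> (\<forall>f\<in>W. \<forall>g\<in>W. (\<lambda>x. f x + g x) \<in> W) \<and> (\<forall>f\<in>W. \<forall>c. (\<lambda>x. c * f x) \<in> W) \<and>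
    (\<forall>f\<in>W. \<forall>A. invertible A \<longrightarrow> (\<lambda>x. f (x v* A)) \<in> W)"

lemma realizable_invariant:
  assumes "realizable L" "invariant W" "f \<in> W" shows "L f \<in> W"
proof -
  obtain E where E: "gexp_on (GL :: ('a^'b^'b) monoid) (ring_of_type_algebra :: 'a ring) E" "\<And>f. ev fun_rep E f = L f"
    using assms(1) unfolding realizable_def by blast
  have "ev fun_rep E f \<in> W" using E(1) assms(3)
    by (induction E arbitrary: f) (use assms(2) in \<open>auto simp: invariant_def\<close>)
  then show ?thesis by (simp add: E)
qed

lemma realizable_linear:
  assumes "realizable L"
  shows "L (\<lambda>x. f x + g x) = (\<lambda>x. L f x + L g x)" "L (\<lambda>x. c * f x) = (\<lambda>x. c * L f x)"
proof -
  obtain E where E: "\<And>f. ev fun_rep E f = L f"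
    using assms(1) unfolding realizable_def by blast
  have "ev fun_rep E (\<lambda>x. f x + g x) = (\<lambda>x. ev fun_rep E f x + ev fun_rep E g x)"
    "ev fun_rep E (\<lambda>x. c * f x) = (\<lambda>x. c * ev fun_rep E f x)"
    by (induction E arbitrary: f g c) (simp_all add: algebra_simps)
  then show "L (\<lambda>x. f x + g x) = (\<lambda>x. L f x + L g x)" "L (\<lambda>x. c * f x) = (\<lambda>x. c * L f x)"
    by (simp_all add: E)
qed

lemma realizable_diff:
  "realizable L \<Longrightarrow> L (\<lambda>x. f x - g x) = (\<lambda>x. L f x - L g x)"
  using realizable_linear(1)[of L f "\<lambda>x. (- 1) * g x"] realizable_linear(2)[of L "- 1" g] by simp

lemma realizable_linear_sum:
  assumes "realizable L" shows "L (\<lambda>x. \<Sum>i\<in>A. F i x) = (\<lambda>x. \<Sum>i\<in>A. L (F i) x)"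
proof (induction A rule: infinite_finite_induct)
  case (insert i A)
  then show ?case using realizable_linear(1)[OF assms] by simp
qed (use realizable_linear(2)[OF assms, of 0] in simp_all)

lemma invertibleI:
  fixes A B :: "'a::field^'n^'n::finite"
  assumes "\<And>x. (x v* A) v* B = x" shows "invertible A"
proof -
  have "transpose (A ** B) *v x = mat 1 *v x" for x
    using assms[of x] by (simp add: vector_matrix_mul_assoc)
  then have "transpose (A ** B) = mat 1" by (simp add: matrix_eq)
  then have "A ** B = mat 1" by (metis transpose_mat transpose_transpose)
  then show ?thesis unfolding invertible_right_inverse by blast
qed

lemma ex_transvection:
  fixes c :: "'a::field" and j l :: "'n::finite"
  assumes "j \<noteq> l"
  shows "\<exists>A. invertible A \<and> (\<forall>x. x v* A = (\<chi> i. if i = j then x $ j + c * x $ l else x $ i))"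
proof -
  define A where "A c = (\<chi> i k. (if i = k then 1 else 0) + (if i = l then if k = j then c else 0 else 0))"
    for c :: 'a
  have A: "x v* A c = (\<chi> i. if i = j then x $ j + c * x $ l else x $ i)" for x c
    by (simp add: vec_eq_iff A_def vector_matrix_mult_def distrib_left sum.distrib
      if_distrib[of "\<lambda>y. _ * y"] sum.delta cong: if_cong)
  have "(x v* A c) v* A (- c) = x" for x using assms by (simp add: A vec_eq_iff)
  then show ?thesis using invertibleI A by blast
qed

lemma ex_dilation:
  fixes c :: "'a::field" and j :: "'n::finite"
  assumes "c \<noteq> 0"
  shows "\<exists>A. invertible A \<and> (\<forall>x. x v* A = (\<chi> i. if i = j then c * x $ j else x $ i))"
proof -
  define A where "A c = (\<chi> i k. if i = k then (if k = j then c else 1) else 0)" for c :: 'a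
  have A: "x v* A c = (\<chi> i. if i = j then c * x $ j else x $ i)" for x c
    by (simp add: vec_eq_iff A_def vector_matrix_mult_def if_distrib[of "\<lambda>y. _ * y"] sum.delta cong: if_cong)
  have "(x v* A c) v* A (1 / c) = x" for x using assms by (simp add: A vec_eq_iff)
  then show ?thesis using invertibleI A by blast
qed

text \<open>The coefficient of \<open>c\<^sup>k\<close> in \<open>f(\<dots>, x\<^sub>j + c x\<^sub>l, \<dots>)\<close>.\<close>

definition transfer_op :: "'n \<Rightarrow> 'n \<Rightarrow> nat \<Rightarrow> ('a::{finite,field}^'n::finite \<Rightarrow> 'a) \<Rightarrow> 'a^'n \<Rightarrow> 'a" where
  "transfer_op j l k f x =
    - (\<Sum>c\<in>UNIV. c ^ (CARD('a) - 1 - k) * f (\<chi> i. if i = j then x $ j + c * x $ l else x $ i))"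

lemma realizable_transfer_op:
  assumes "j \<noteq> l"
  shows "realizable (transfer_op j l k :: ('a::{finite,field}^'n::finite \<Rightarrow> 'a) \<Rightarrow> _)"
proof -
  have 1: "realizable (\<lambda>f x. f (\<chi> i. if i = j then x $ j + c * x $ l else x $ i))" for c :: 'a
  proof -
    obtain A where "invertible A" "\<forall>x. x v* A = (\<chi> i. if i = j then x $ j + c * x $ l else x $ i)"
      using ex_transvection[OF assms, of c] by blast
    then show ?thesis using realizable_act[of A] by simp
  qed
  have "realizable (\<lambda>f x. (- 1) * (\<Sum>c\<in>UNIV. c ^ (CARD('a) - 1 - k) *
      f (\<chi> i. if i = j then x $ j + (c :: 'a) * x $ l else x $ i)))"
    by (intro realizable_scale realizable_sum 1)
  then show ?thesis unfolding transfer_op_def[abs_def] by simp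
qed

text \<open>A torus average: for \<open>a \<le> q - 1\<close> the power \<open>q - 1 - a\<close>
  stands for \<open>-a\<close>, and the sign is the inverse of \<open>q - 1\<close> in the field. It
  keeps the monomials whose exponent at \<open>j\<close> is congruent to \<open>a\<close> modulo
  \<open>q - 1\<close>.\<close>

definition weight_op :: "'n \<Rightarrow> nat \<Rightarrow> ('a::{finite,field}^'n::finite \<Rightarrow> 'a) \<Rightarrow> 'a^'n \<Rightarrow> 'a" where
  "weight_op j a f x =
    - (\<Sum>c\<in>UNIV - {0}. c ^ (CARD('a) - 1 - a) * f (\<chi> i. if i = j then c * x $ j else x $ i))"

lemma realizable_weight_op: "realizable (weight_op j a :: ('a::{finite,field}^'n::finite \<Rightarrow> 'a) \<Rightarrow> _)"
proof -
  have 1: "realizable (\<lambda>f x. f (\<chi> i. if i = j then c * x $ j else x $ i))" if c: "c \<noteq> 0" for c :: 'a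
  proof -
    obtain A where "invertible A" "\<forall>x. x v* A = (\<chi> i. if i = j then c * x $ j else x $ i)"
      using ex_dilation[OF c, of j] by blast
    then show ?thesis using realizable_act[of A] by simp
  qed
  have "realizable (\<lambda>f x. (- 1) * (\<Sum>c\<in>UNIV - {0}. c ^ (CARD('a) - 1 - a) *
      f (\<chi> i. if i = j then (c :: 'a) * x $ j else x $ i)))"
    by (intro realizable_scale realizable_sum 1) auto
  then show ?thesis unfolding weight_op_def[abs_def] by simp
qed

lemma prod_remove_two:
  fixes f :: "'n::finite \<Rightarrow> 'b::comm_monoid_mult"
  assumes "j \<noteq> l" shows "prod f UNIV = f j * f l * prod f (UNIV - {j, l})"
proof -
  have "prod f UNIV = f j * prod f (UNIV - {j})" by (simp add: prod.remove)
  also have "prod f (UNIV - {j}) = f l * prod f (UNIV - {j} - {l})"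
    using assms by (intro prod.remove) auto
  also have "UNIV - {j} - {l} = UNIV - {j, l}" by auto
  finally show ?thesis by (simp add: mult.assoc)
qed

definition move :: "'n \<Rightarrow> 'n \<Rightarrow> nat \<Rightarrow> ('n \<Rightarrow> nat) \<Rightarrow> 'n \<Rightarrow> nat" where
  "move j l k e = e(j := e j - k, l := e l + k)"

text \<open>Of the binomial expansion only the term \<open>t = k\<close> survives the sum over
  \<open>c\<close>. The exponent \<open>q - 1 - k + t\<close> of \<open>c\<close> stays below
  \<open>2 (q - 1)\<close> because \<open>1 \<le> k\<close>, and it is \<open>0\<close> only for
  \<open>k = q - 1\<close> and \<open>t = 0\<close>, where the full power sum vanishes.\<close>

lemma transfer_op_mon:
  assumes jl: "j \<noteq> l" and e: "e j < CARD('a)" and k: "1 \<le> k" "k < CARD('a)"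
  shows "transfer_op j l k (mon e :: 'a::{finite,field}^'n::finite \<Rightarrow> 'a) =
    (\<lambda>x. of_nat (e j choose k) * mon (move j l k e) x)"
proof
  fix x :: "'a^'n"
  let ?R = "\<Prod>i\<in>UNIV - {j, l}. (x $ i) ^ e i"
  have mv: "mon (move j l t e) x = (x $ j) ^ (e j - t) * (x $ l) ^ (e l + t) * ?R" for t
  proof -
    have "(\<Prod>i\<in>UNIV - {j, l}. (x $ i) ^ move j l t e i) = ?R"
      by (intro prod.cong) (auto simp: move_def)
    then show ?thesis unfolding mon_def prod_remove_two[OF jl] using jl by (simp add: move_def)
  qed
  have tv: "mon e (\<chi> i. if i = j then x $ j + c * x $ l else x $ i) =
      (\<Sum>t\<le>e j. of_nat (e j choose t) * c ^ t * mon (move j l t e) x)" for c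
  proof -
    have "(\<Prod>i\<in>UNIV - {j, l}. ((\<chi> i. if i = j then x $ j + c * x $ l else x $ i) $ i) ^ e i) = ?R"
      by (intro prod.cong) auto
    then have "mon e (\<chi> i. if i = j then x $ j + c * x $ l else x $ i) =
        (c * x $ l + x $ j) ^ e j * ((x $ l) ^ e l * ?R)"
      unfolding mon_def prod_remove_two[OF jl] using jl by (simp add: mult.assoc add.commute)
    also have "\<dots> = (\<Sum>t\<le>e j. of_nat (e j choose t) * (c * x $ l) ^ t * (x $ j) ^ (e j - t)) * ((x $ l) ^ e l * ?R)"
      by (simp only: binomial_ring)
    also have "\<dots> = (\<Sum>t\<le>e j. of_nat (e j choose t) * c ^ t * mon (move j l t e) x)"
      unfolding sum_distrib_right
      by (intro sum.cong refl) (simp add: mv power_mult_distrib power_add mult_ac)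
    finally show ?thesis .
  qed
  define N where "N = CARD('a) - 1"
  have N: "k \<le> N" "e j \<le> N" "N > 0" using e k by (simp_all add: N_def)
  have "transfer_op j l k (mon e) x =
      (\<Sum>t\<le>e j. of_nat (e j choose t) * mon (move j l t e) x * - (\<Sum>c\<in>UNIV. (c :: 'a) ^ (N - k + t)))"
    unfolding transfer_op_def tv sum_distrib_left N_def[symmetric]
    by (subst sum.swap) (simp add: sum_negf[symmetric] sum_distrib_left power_add mult_ac)
  also have "\<dots> = (\<Sum>t\<le>e j. if t = k then of_nat (e j choose k) * mon (move j l k e) x else 0)"
  proof (intro sum.cong refl)
    fix t assume t: "t \<in> {..e j}"
    have *: "N - k + t < 2 * N" "N - k + t = N \<longleftrightarrow> t = k" using t N k by auto
    have "0 < N - k + t \<and> N dvd N - k + t \<longleftrightarrow> t = k"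
    proof (cases "0 < N - k + t")
      case True
      then show ?thesis using dvd_between[OF True *(1)] *(2) by simp
    next
      case False
      then show ?thesis using k by auto
    qed
    then show "of_nat (e j choose t) * mon (move j l t e) x * - (\<Sum>c\<in>UNIV. (c :: 'a) ^ (N - k + t)) =
        (if t = k then of_nat (e j choose k) * mon (move j l k e) x else 0)"
      unfolding sum_power[where 'a = 'a, folded N_def] by auto
  qed
  also have "\<dots> = of_nat (e j choose k) * mon (move j l k e) x"
    by (auto simp: sum.delta binomial_eq_0 not_le)
  finally show "transfer_op j l k (mon e) x = of_nat (e j choose k) * mon (move j l k e) x" .
qed

lemma weight_op_mon:
  "weight_op j a (mon e :: 'a::{finite,field}^'n::finite \<Rightarrow> 'a) =
    (\<lambda>x. (if (CARD('a) - 1) dvd (CARD('a) - 1 - a + e j) then 1 else 0) * mon e x)"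
proof
  fix x :: "'a^'n"
  have "mon e (\<chi> i. if i = j then c * x $ j else x $ i) = c ^ e j * mon e x" for c
  proof -
    have "(\<Prod>i\<in>UNIV - {j}. ((\<chi> i. if i = j then c * x $ j else x $ i) $ i) ^ e i) =
        (\<Prod>i\<in>UNIV - {j}. (x $ i) ^ e i)" by (intro prod.cong) auto
    then show ?thesis
      unfolding mon_def prod.remove[OF finite UNIV_I, of _ j] by (simp add: power_mult_distrib mult.assoc)
  qed
  then have "weight_op j a (mon e) x = - (\<Sum>c\<in>UNIV - {0 :: 'a}. c ^ (CARD('a) - 1 - a + e j)) * mon e x"
    unfolding weight_op_def sum_distrib_right mult_minus_left by (simp add: power_add mult.assoc)
  then show "weight_op j a (mon e) x =
      (if (CARD('a) - 1) dvd (CARD('a) - 1 - a + e j) then 1 else 0) * mon e x"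
    unfolding sum_power_nonzero by simp
qed

section \<open>Invariant subspaces are spanned by monomials\<close>

definition idx :: "nat \<Rightarrow> nat \<Rightarrow> ('n::finite \<Rightarrow> nat) set" where
  "idx q r = {e \<in> red_exps q. sum e UNIV = r}"

lemma finite_idx [simp]: "finite (idx q r)"
  unfolding idx_def by simp

lemma sum_move: "j \<noteq> l \<Longrightarrow> k \<le> e j \<Longrightarrow> sum (move j l k e) UNIV = sum e (UNIV :: 'n::finite set)"
proof -
  assume jl: "j \<noteq> l" and k: "k \<le> e j"
  have "sum (move j l k e) (UNIV - {j, l}) = sum e (UNIV - {j, l})"
    by (intro sum.cong) (auto simp: move_def)
  then show ?thesis unfolding sum_remove_two[OF jl] using jl k by (simp add: move_def)
qed

lemma invariant_top_space:
  assumes "prime p" "CARD('a) = p ^ m" "down_closed p m r J"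
  shows "invariant (top_space r J :: ('a::{finite,field}^'n::finite \<Rightarrow> 'a) set)"
  unfolding invariant_def using assms by (auto intro: top_space_add top_space_scale top_space_act)

lemma invariant_top_space_empty:
  assumes "prime p" "CARD('a) = p ^ m"
  shows "invariant (top_space r {} :: ('a::{finite,field}^'n::finite \<Rightarrow> 'a) set)"
  using assms by (rule invariant_top_space) (simp add: down_closed_def)

text \<open>\<open>L\<close> acts on \<open>H_q(r,n)\<close> as a diagonal matrix with entries
  \<open>\<nu>\<close> in the monomial basis; errors of lower degree are allowed because they vanish
  there.\<close>

definition diagonal :: "nat \<Rightarrow> (('a::{finite,field}^'n::finite \<Rightarrow> 'a) \<Rightarrow> 'a^'n \<Rightarrow> 'a) \<Rightarrow> (('n \<Rightarrow> nat) \<Rightarrow> 'a) \<Rightarrow> bool" where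
  "diagonal r L \<nu> \<longleftrightarrow> realizable L \<and>
    (\<forall>k\<in>idx CARD('a) r. (\<lambda>x. L (mon k) x - \<nu> k * mon k x) \<in> top_space r {})"

lemma diagonal_id: "diagonal r (\<lambda>f. f) (\<lambda>k. 1)"
  by (simp add: diagonal_def realizable_id top_space_zero)

lemma diagonal_comp:
  fixes L M :: "('a::{finite,field}^'n::finite \<Rightarrow> 'a) \<Rightarrow> 'a^'n \<Rightarrow> 'a"
  assumes p: "prime p" "CARD('a) = p ^ m" and L: "diagonal r L \<alpha>" and M: "diagonal r M \<beta>"
  shows "diagonal r (\<lambda>f. L (M f)) (\<lambda>k. \<alpha> k * \<beta> k)"
  unfolding diagonal_def
proof (intro conjI ballI)
  have rL: "realizable L" and rM: "realizable M" using L M by (auto simp: diagonal_def)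
  show "realizable (\<lambda>f. L (M f))" by (rule realizable_comp[OF rL rM])
  fix k :: "'n \<Rightarrow> nat" assume k: "k \<in> idx CARD('a) r"
  note inv = invariant_top_space_empty[OF p]
  have "L (\<lambda>x. M (mon k) x - \<beta> k * mon k x) \<in> top_space r {}"
    using M k by (intro realizable_invariant[OF rL inv]) (auto simp: diagonal_def)
  then have "(\<lambda>x. L (M (mon k)) x - \<beta> k * L (mon k) x) \<in> top_space r {}"
    by (simp add: realizable_diff[OF rL] realizable_linear(2)[OF rL])
  moreover have "(\<lambda>x. \<beta> k * (L (mon k) x - \<alpha> k * mon k x)) \<in> top_space r {}"
    using L k by (intro top_space_scale) (auto simp: diagonal_def)
  ultimately have "(\<lambda>x. (L (M (mon k)) x - \<beta> k * L (mon k) x) + \<beta> k * (L (mon k) x - \<alpha> k * mon k x))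
      \<in> top_space r {}" by (rule top_space_add)
  then show "(\<lambda>x. L (M (mon k)) x - \<alpha> k * \<beta> k * mon k x) \<in> top_space r {}"
    by (simp add: algebra_simps)
qed

text \<open>Two exponents that are congruent modulo \<open>q - 1\<close> in every coordinate have the same torus weight;
  they differ by exchanging entries \<open>0\<close> and \<open>q - 1\<close>, which is detected by moving a full
  \<open>x\<^sub>j\<^sup>q\<^sup>-\<^sup>1\<close> to \<open>x\<^sub>l\<close> and back.\<close>

lemma diagonal_separates:
  fixes e e' :: "'n::finite \<Rightarrow> nat"
  assumes p: "prime p" "CARD('a) = p ^ m"
    and e: "e \<in> idx CARD('a) r" "e' \<in> idx CARD('a) r" "e \<noteq> e'"
  shows "\<exists>L (\<nu> :: ('n \<Rightarrow> nat) \<Rightarrow> 'a::{finite,field}). diagonal r L \<nu> \<and> \<nu> e = 1 \<and> \<nu> e' = 0"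
proof -
  define N where "N = CARD('a) - 1"
  have q: "CARD('a) = Suc N" "N > 0" using card_field_ge_2[where 'a = 'a] by (simp_all add: N_def)
  have le: "k j \<le> N" if "k \<in> idx CARD('a) r" for k and j :: 'n
  proof -
    have "k j < CARD('a)" using that by (simp add: idx_def red_exps_def)
    then show ?thesis using q by linarith
  qed
  show ?thesis
  proof (cases "\<exists>j. \<not> N dvd N - e j + e' j")
    case True
    then obtain j where j: "\<not> N dvd N - e j + e' j" by blast
    let ?l = "\<lambda>k. if N dvd N - e j + k j then 1 else (0::'a)"
    have "diagonal r (weight_op j (e j)) ?l"
      unfolding diagonal_def weight_op_mon N_def[symmetric]
      by (simp add: realizable_weight_op top_space_zero)
    moreover have "?l e = 1" using le[OF e(1)] by simp
    ultimately show ?thesis using j by (intro exI[of _ "weight_op j (e j)"] exI[of _ ?l]) simp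
  next
    case False
    then have dvd: "N dvd N - e j + e' j" for j by blast
    obtain j l where j: "e' j < e j" and l: "e l < e' l"
      using exists_strict_pair[of e e'] e by (auto simp: idx_def)
    have jl: "j \<noteq> l" using j l by auto
    \<comment> \<open>At \<open>j\<close> a multiple of \<open>N\<close> lies below
      \<open>N\<close>, hence is \<open>0\<close>; at \<open>l\<close> it lies above
      \<open>N\<close> and is at most \<open>2 N\<close>, hence is \<open>2 N\<close>. So
      \<open>e\<close> is \<open>N\<close> at \<open>j\<close> and \<open>0\<close> at
      \<open>l\<close>, and \<open>e'\<close> the other way round.\<close>
    have "N - e j + e' j = 0"
      using dvd[of j] j le[OF e(1), of j] nat_dvd_not_less[of "N - e j + e' j" N] by linarith
    then have ej: "e j = N" "e' j = 0" using le[OF e(1), of j] by auto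
    have "N - e l + e' l = 2 * N"
      using dvd[of l] l le[OF e(1), of l] le[OF e(2), of l] dvd_between[of "N - e l + e' l" N] by linarith
    then have el: "e l = 0" using le[OF e(1), of l] le[OF e(2), of l] by linarith
    define L :: "('a^'n \<Rightarrow> 'a) \<Rightarrow> 'a^'n \<Rightarrow> 'a" 
      where "L = (\<lambda>f. transfer_op l j N (transfer_op j l N f))"
    let ?l = "\<lambda>k. if k j = N \<and> k l = 0 then 1 else (0::'a)"
    have rL: "realizable L" unfolding L_def
      by (intro realizable_comp[of "transfer_op l j N" "transfer_op j l N"] realizable_transfer_op)
        (use jl in auto)
    have r1: "realizable (transfer_op l j N :: ('a^'n \<Rightarrow> 'a) \<Rightarrow> _)" using jl by (intro realizable_transfer_op) auto
    have "(\<lambda>x. L (mon k) x - ?l k * mon k x) \<in> top_space r {}" if k: "k \<in> idx CARD('a) r" for k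
    proof -
      have kr: "k \<in> red_exps CARD('a)" "sum k UNIV = r" using k by (auto simp: idx_def)
      have t1: "transfer_op j l N (mon k :: 'a^'n \<Rightarrow> 'a) = (\<lambda>x. of_nat (k j choose N) * mon (move j l N k) x)"
        using q le[OF k, of j] by (intro transfer_op_mon jl) auto
      consider "k j < N" | "k j = N" "k l > 0" | "k j = N" "k l = 0" using le[OF k, of j] by fastforce
      then show ?thesis
      proof cases
        case 1
        then have "L (mon k) = (\<lambda>x. 0)"
          using realizable_linear(2)[OF r1, of 0 "\<lambda>x. 0"] by (simp add: L_def t1 binomial_eq_0)
        then show ?thesis using 1 by (simp add: top_space_zero)
      next
        case 2
        \<comment> \<open>The exponent at \<open>l\<close> is already positive, so receiving
          \<open>N\<close> more units makes it unreduced and the monomial drops in degree.\<close>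
        have "(mon (move j l N k) :: 'a^'n \<Rightarrow> 'a) \<in> top_space r {}"
        proof (rule mon_in_top_space)
          show "sum (move j l N k) UNIV \<le> r" using 2 kr jl by (simp add: sum_move)
          have "move j l N k l > N" using 2 by (simp add: move_def)
          then have "move j l N k \<notin> red_exps CARD('a)" using q by (auto simp: red_exps_def not_less Suc_le_eq)
          then show "move j l N k \<in> {}" if "move j l N k \<in> red_exps CARD('a)" using that by blast
        qed
        then have "transfer_op l j N (mon (move j l N k) :: 'a^'n \<Rightarrow> 'a) \<in> top_space r {}"
          by (rule realizable_invariant[OF r1 invariant_top_space_empty[OF p]])
        then show ?thesis using 2 by (simp add: L_def t1)
      next
        case 3
        have "transfer_op l j N (mon (move j l N k) :: 'a^'n \<Rightarrow> 'a) =
            (\<lambda>x. of_nat (move j l N k l choose N) * mon (move l j N (move j l N k)) x)"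
          using q jl 3 by (intro transfer_op_mon) (auto simp: move_def)
        moreover have "move l j N (move j l N k) = k" using 3 jl by (auto simp: move_def)
        moreover have "move j l N k l = N" using 3 by (simp add: move_def)
        ultimately have "L (mon k) = (mon k :: 'a^'n \<Rightarrow> 'a)" using 3 by (simp add: L_def t1)
        then show ?thesis using 3 by (simp add: top_space_zero)
      qed
    qed
    then have "diagonal r L ?l" using rL by (simp add: diagonal_def)
    then show ?thesis using ej el q by (intro exI[of _ L] exI[of _ ?l]) simp
  qed
qed

text \<open>Composes one separating operator for each other exponent; the eigenvalues multiply to
  \<open>1\<close> at \<open>e\<close> and to \<open>0\<close> elsewhere.\<close>

lemma diagonal_projector:
  fixes e :: "'n::finite \<Rightarrow> nat"
  assumes p: "prime p" "CARD('a) = p ^ m" and e: "e \<in> idx CARD('a) r"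
  shows "\<exists>L (\<nu> :: ('n \<Rightarrow> nat) \<Rightarrow> 'a::{finite,field}). diagonal r L \<nu> \<and> \<nu> e = 1 \<and>
    (\<forall>k\<in>idx CARD('a) r - {e}. \<nu> k = 0)"
proof -
  have "\<exists>L (\<nu> :: ('n \<Rightarrow> nat) \<Rightarrow> 'a). diagonal r L \<nu> \<and> \<nu> e = 1 \<and> (\<forall>k\<in>B. \<nu> k = 0)"
    if "finite B" "B \<subseteq> idx CARD('a) r - {e}" for B
    using that
  proof (induction B rule: finite_induct)
    case empty
    show ?case by (intro exI[of _ "\<lambda>f. f"] exI[of _ "\<lambda>k. 1"]) (simp add: diagonal_id)
  next
    case (insert b B)
    then obtain L and \<nu> :: "('n \<Rightarrow> nat) \<Rightarrow> 'a" where L: "diagonal r L \<nu>" "\<nu> e = 1" "\<forall>k\<in>B. \<nu> k = 0" by blast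
    obtain M and \<mu> :: "('n \<Rightarrow> nat) \<Rightarrow> 'a" where M: "diagonal r M \<mu>" "\<mu> e = 1" "\<mu> b = 0"
      using diagonal_separates[OF p e, of b] insert.prems by blast
    show ?case
      using diagonal_comp[OF p L(1) M(1)] L M
      by (intro exI[of _ "\<lambda>f. L (M f)"] exI[of _ "\<lambda>k. \<nu> k * \<mu> k"]) auto
  qed
  then show ?thesis by simp
qed

lemma projector:
  fixes e :: "'n::finite \<Rightarrow> nat"
  assumes p: "prime p" "CARD('a) = p ^ m" and e: "e \<in> idx CARD('a) r"
  shows "\<exists>L. realizable L \<and> (\<forall>f\<in>top_space r UNIV.
    (\<lambda>x. L f x - coef e f * mon e (x :: 'a::{finite,field}^'n)) \<in> top_space r {})"
proof -
  obtain L and \<nu> :: "('n \<Rightarrow> nat) \<Rightarrow> 'a" where L: "diagonal r L \<nu>" "\<nu> e = 1"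
    "\<And>k. k \<in> idx CARD('a) r \<Longrightarrow> k \<noteq> e \<Longrightarrow> \<nu> k = 0"
    using diagonal_projector[OF p e] by blast
  have rL: "realizable L" using L(1) by (simp add: diagonal_def)
  note inv = invariant_top_space_empty[OF p]
  have "(\<lambda>x. L f x - coef e f * mon e x) \<in> top_space r {}"
    if f: "f \<in> top_space r UNIV" for f :: "'a^'n \<Rightarrow> 'a"
  proof -
    have "L f = L (\<lambda>x. \<Sum>k\<in>red_exps CARD('a). coef k f * mon k x)"
      by (simp flip: mon_expansion)
    then have Lf: "L f x = (\<Sum>k\<in>red_exps CARD('a). coef k f * L (mon k) x)" for x
      by (simp add: realizable_linear_sum[OF rL] realizable_linear(2)[OF rL])
    have er: "e \<in> red_exps CARD('a)" using e by (simp add: idx_def)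
    have "coef e f * mon e x = (\<Sum>k\<in>red_exps CARD('a). if k = e then coef e f * mon e x else 0)" for x
      using er by simp
    then have "(\<lambda>x. L f x - coef e f * mon e x) = (\<lambda>x. \<Sum>k\<in>red_exps CARD('a).
        coef k f * L (mon k) x - (if k = e then coef e f * mon e x else 0))"
      unfolding Lf by (simp add: sum_subtractf)
    also have "\<dots> \<in> top_space r {}"
    proof (rule top_space_sum)
      fix k :: "'n \<Rightarrow> nat" assume k: "k \<in> red_exps CARD('a)"
      consider "sum k UNIV < r" | "k \<in> idx CARD('a) r" | "coef k f = 0" "k \<notin> idx CARD('a) r"
        using f k unfolding top_space_def idx_def by fastforce
      then show "(\<lambda>x. coef k f * L (mon k) x - (if k = e then coef e f * mon e x else 0)) \<in> top_space r {}"
      proof cases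
        case 1
        then have "(mon k :: 'a^'n \<Rightarrow> 'a) \<in> top_space r {}" by (intro mon_in_top_space) auto
        then have "(\<lambda>x. coef k f * L (mon k) x) \<in> top_space r {}"
          using realizable_invariant[OF rL inv] by (intro top_space_scale) blast
        moreover have "k \<noteq> e" using 1 e by (auto simp: idx_def)
        ultimately show ?thesis by simp
      next
        case 2
        then have "(\<lambda>x. coef k f * (L (mon k) x - \<nu> k * mon k x)) \<in> top_space r {}"
          using L(1) by (intro top_space_scale) (auto simp: diagonal_def)
        moreover have "\<nu> k = (if k = e then 1 else 0)" using L(2,3) 2 by simp
        ultimately show ?thesis by (cases "k = e") (simp_all add: algebra_simps)
      next
        case 3
        then have "k \<noteq> e" using e by blast
        then show ?thesis using 3 by (simp add: top_space_zero)
      qed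
    qed
    finally show ?thesis .
  qed
  then show ?thesis using rL by blast
qed

text \<open>The assumptions on \<open>W\<close> describe the preimage of a submodule of
  \<open>H_q(r,n)\<close>. Since \<open>W\<close> contains \<open>top_space r {}\<close>, the error
  term of a projector can be subtracted inside \<open>W\<close>, which leaves a multiple of a
  monomial.\<close>

theorem invariant_eq_top_space:
  fixes W :: "('a::{finite,field}^'n::finite \<Rightarrow> 'a) set"
  assumes p: "prime p" "CARD('a) = p ^ m"
    and W: "invariant W" "top_space r {} \<subseteq> W" "W \<subseteq> top_space r UNIV"
  defines "J \<equiv> {e \<in> idx CARD('a) r. mon e \<in> W}"
  shows "W = top_space r J" and "down_closed p m r J"
proof -
  note add = W(1)[unfolded invariant_def, THEN conjunct1, rule_format]
  note scale = W(1)[unfolded invariant_def, THEN conjunct2, THEN conjunct1, rule_format]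
  have zero: "(\<lambda>x. 0) \<in> W" using W(2) top_space_zero by blast
  have sumW: "(\<lambda>x. \<Sum>i\<in>A. F i x) \<in> W" if "\<And>i. i \<in> A \<Longrightarrow> F i \<in> W" for A and F :: "'c \<Rightarrow> 'a^'n \<Rightarrow> 'a"
    using that by (induction A rule: infinite_finite_induct) (simp_all add: zero add)
  show "W = top_space r J"
  proof
    show "W \<subseteq> top_space r J"
    proof
      fix f assume f: "f \<in> W"
      have "e \<in> J" if e: "e \<in> red_exps CARD('a)" "coef e f \<noteq> 0" "sum e UNIV = r" for e
      proof -
        have ei: "e \<in> idx CARD('a) r" using e by (simp add: idx_def)
        obtain L where L: "realizable L" "(\<lambda>x. L f x - coef e f * mon e x) \<in> top_space r {}"
          using projector[OF p ei] W(3) f by blast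
        have "L f \<in> W" by (rule realizable_invariant[OF L(1) W(1) f])
        moreover have "(\<lambda>x. (- 1) * (L f x - coef e f * mon e x)) \<in> W"
          using L(2) W(2) by (intro scale) auto
        ultimately have "(\<lambda>x. L f x + (- 1) * (L f x - coef e f * mon e x)) \<in> W" by (rule add)
        then have "(\<lambda>x. coef e f * mon e x) \<in> W" by simp
        then have "(\<lambda>x. inverse (coef e f) * (coef e f * mon e x)) \<in> W" by (rule scale)
        then show ?thesis using e ei by (simp add: J_def mult.assoc[symmetric])
      qed
      then show "f \<in> top_space r J" using f W(3) by (auto simp: top_space_def)
    qed
    show "top_space r J \<subseteq> W"
    proof
      fix f :: "'a^'n \<Rightarrow> 'a" assume f: "f \<in> top_space r J"
      have "(\<lambda>x. coef e f * mon e x) \<in> W" if e: "e \<in> red_exps CARD('a)" for e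
      proof (cases "coef e f = 0")
        case True
        then show ?thesis by (simp add: zero)
      next
        case False
        then consider "sum e UNIV < r" | "e \<in> J" using f e by (auto simp: top_space_def)
        then show ?thesis
        proof cases
          case 1
          then have "(mon e :: 'a^'n \<Rightarrow> 'a) \<in> top_space r {}" by (intro mon_in_top_space) auto
          then show ?thesis using W(2) by (intro scale) blast
        qed (auto simp: J_def intro: scale)
      qed
      then have "(\<lambda>x. \<Sum>e\<in>red_exps CARD('a). coef e f * mon e x) \<in> W" by (rule sumW)
      then show "f \<in> W" by (simp flip: mon_expansion)
    qed
  qed
  have char: "CHAR('a) = p" by (rule CHAR_eq_prime[OF p])
  have p0: "p > 0" using p(1) by (rule prime_gt_0_nat)
  show "down_closed p m r J"
    unfolding down_closed_def
  proof (intro ballI impI)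
    fix e e' :: "'n \<Rightarrow> nat"
    assume e: "e \<in> J" and e': "e' \<in> red_exps (p ^ m)" "sum e' UNIV = r"
      and le: "\<forall>k\<le>m. mod_sum p e' k \<le> mod_sum p e k"
    show "e' \<in> J"
    proof (rule reach_exponents[OF p0 _ e])
      fix i j l t
      assume i: "i \<in> J" and jl: "j \<noteq> l" and d: "digit p t (i j) > 0" and s: "i l + p ^ t < p ^ m"
      have ii: "i \<in> idx CARD('a) r" "mon i \<in> W" using i by (auto simp: J_def)
      have "i j div p ^ t \<noteq> 0" using d unfolding digit_def by (metis mod_0 less_irrefl)
      then have pt: "p ^ t \<le> i j" by (auto simp: div_eq_0_iff not_less)
      have "transfer_op j l (p ^ t) (mon i :: 'a^'n \<Rightarrow> 'a) \<in> W"
        by (rule realizable_invariant[OF realizable_transfer_op[OF jl] W(1) ii(2)])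
      also have "transfer_op j l (p ^ t) (mon i :: 'a^'n \<Rightarrow> 'a) =
          (\<lambda>x. of_nat (i j choose p ^ t) * mon (move j l (p ^ t) i) x)"
        using ii(1) s p p0 by (intro transfer_op_mon jl) (auto simp: idx_def red_exps_def Suc_le_eq)
      finally have W1: "(\<lambda>x. of_nat (i j choose p ^ t) * mon (move j l (p ^ t) i) x) \<in> W" .
      \<comment> \<open>In characteristic \<open>p\<close> the right-hand side is digit
        \<open>t\<close> of \<open>i j\<close>, which is positive and below
        \<open>p\<close>.\<close>
      have "of_nat (i j choose p ^ t) = (of_nat (i j div p ^ t) :: 'a)"
        using p(1) char by (intro of_nat_choose_prime_power[of _ t]) auto
      also have "\<dots> \<noteq> 0" using d by (simp add: of_nat_eq_0_iff_char_dvd char digit_def dvd_eq_mod_eq_0)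
      finally have nz: "of_nat (i j choose p ^ t) \<noteq> (0 :: 'a)" .
      have "(\<lambda>x. inverse (of_nat (i j choose p ^ t)) * (of_nat (i j choose p ^ t) * mon (move j l (p ^ t) i) x)) \<in> W"
        by (rule scale[OF W1])
      then have "(mon (move j l (p ^ t) i) :: 'a^'n \<Rightarrow> 'a) \<in> W" using nz by (simp add: mult.assoc[symmetric])
      moreover have "move j l (p ^ t) i \<in> red_exps CARD('a)"
        using ii(1) s p(2) by (auto simp: idx_def red_exps_def move_def less_imp_diff_less)
      then have "move j l (p ^ t) i \<in> idx CARD('a) r"
        using ii(1) jl pt by (simp add: idx_def sum_move)
      ultimately show "i(j := i j - p ^ t, l := i l + p ^ t) \<in> J"
        by (simp add: J_def move_def)
    qed (use e e' le p(2) in \<open>auto simp: J_def idx_def red_exps_def\<close>)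
  qed
qed

section \<open>Submodules and ideals\<close>

lemma top_space_induct:
  fixes f :: "'a::{finite,field}^'n::finite \<Rightarrow> 'a"
  assumes "f \<in> top_space r J" "(\<lambda>x. 0) \<in> U"
    and add: "\<And>f g. f \<in> U \<Longrightarrow> g \<in> U \<Longrightarrow> (\<lambda>x. f x + g x) \<in> U"
    and mon: "\<And>c e. e \<in> red_exps CARD('a) \<Longrightarrow> sum e UNIV < r \<or> sum e UNIV = r \<and> e \<in> J \<Longrightarrow>
      (\<lambda>x. c * mon e x) \<in> U"
  shows "f \<in> U"
proof -
  have "(\<lambda>x. \<Sum>e\<in>A. coef e f * mon e x) \<in> U" if "A \<subseteq> red_exps CARD('a)" for A
    using finite_subset[OF that finite_red_exps] that
  proof (induction A rule: finite_induct)
    case (insert e A)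
    have "(\<lambda>x. coef e f * mon e x) \<in> U"
    proof (cases "coef e f = 0")
      case False
      then show ?thesis using insert.prems assms(1) by (intro mon) (auto simp: top_space_def)
    qed (simp add: assms(2))
    then show ?case using insert add by simp
  qed (simp add: assms(2))
  from this[of "red_exps CARD('a)"] show ?thesis by (simp flip: mon_expansion)
qed

lemma mon_in_top_space_iff:
  assumes "e \<in> idx CARD('a) r"
  shows "(mon e :: 'a::{finite,field}^'n::finite \<Rightarrow> 'a) \<in> top_space r J \<longleftrightarrow> e \<in> J"
proof
  assume "(mon e :: 'a^'n \<Rightarrow> 'a) \<in> top_space r J"
  then show "e \<in> J" using assms unfolding top_space_def by (auto simp: coef_mon idx_def)
next
  assume "e \<in> J"
  then show "(mon e :: 'a^'n \<Rightarrow> 'a) \<in> top_space r J"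
    using assms by (intro mon_in_top_space) (auto simp: idx_def)
qed

lemma top_space_Int: "top_space r J \<inter> top_space r J' = top_space r (J \<inter> J')"
  unfolding top_space_def by blast

lemma top_space_Un:
  fixes f :: "'a::{finite,field}^'n::finite \<Rightarrow> 'a"
  assumes "f \<in> top_space r (J \<union> J')"
  shows "\<exists>g\<in>top_space r J. \<exists>h\<in>top_space r J'. f = (\<lambda>x. g x + h x)"
proof -
  let ?U = "{f. \<exists>g\<in>top_space r J. \<exists>h\<in>top_space r J'. f = (\<lambda>x :: 'a^'n. g x + h x :: 'a)}"
  have I: "f \<in> ?U" if "g \<in> top_space r J" "h \<in> top_space r J'" "\<And>x. f x = g x + h x" for f g h
    using that by blast
  have "f \<in> ?U"
  proof (rule top_space_induct[OF assms])
    show "(\<lambda>x. 0) \<in> ?U" by (rule I[OF top_space_zero top_space_zero]) simp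
  next
    fix f f' assume "f \<in> ?U" "f' \<in> ?U"
    then obtain g h g' h' where *: "g \<in> top_space r J" "h \<in> top_space r J'"
      "g' \<in> top_space r J" "h' \<in> top_space r J'" "f = (\<lambda>x. g x + h x)" "f' = (\<lambda>x. g' x + h' x)" by blast
    show "(\<lambda>x. f x + f' x) \<in> ?U"
      by (rule I[OF top_space_add[OF *(1,3)] top_space_add[OF *(2,4)]]) (simp add: *)
  next
    fix c :: 'a and e :: "'n \<Rightarrow> nat"
    assume e: "e \<in> red_exps CARD('a)" "sum e UNIV < r \<or> sum e UNIV = r \<and> e \<in> J \<union> J'"
    then consider "(mon e :: 'a^'n \<Rightarrow> 'a) \<in> top_space r J" | "(mon e :: 'a^'n \<Rightarrow> 'a) \<in> top_space r J'"
      using mon_in_top_space[of e r J] mon_in_top_space[of e r J'] by fastforce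
    then show "(\<lambda>x. c * mon e x) \<in> ?U"
    proof cases
      case 1
      show ?thesis by (rule I[OF top_space_scale[OF 1, of c] top_space_zero]) simp
    next
      case 2
      show ?thesis by (rule I[OF top_space_zero top_space_scale[OF 2, of c]]) simp
    qed
  qed
  then show ?thesis by blast
qed

lemma subrep_iff_invariant:
  fixes W :: "('a::field^'n::finite \<Rightarrow> 'a) set"
  shows "subrep GL ring_of_type_algebra W fun_rep \<longleftrightarrow> invariant W \<and> (\<lambda>x. 0) \<in> W"
proof -
  interpret linear_rep "GL :: ('a^'n^'n) monoid" "ring_of_type_algebra :: 'a ring" fun_rep
    by (rule linear_rep_fun_rep)
  show ?thesis
    using module_axioms by (auto simp: subrep_def LinearCombinations.submodule_def invariant_def)
qed

text \<open>Makes the sum of the entries a strictly monotone rank for the componentwise order;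
  minimal and maximal elements are later chosen by it.\<close>

lemma list_all2_le_sum_list:
  fixes s t :: "nat list"
  assumes "list_all2 (\<le>) s t"
  shows "sum_list s \<le> sum_list t" and "s \<noteq> t \<Longrightarrow> sum_list s < sum_list t"
  using assms by (induction rule: list_all2_induct) (auto simp: add_less_le_mono add_le_less_mono add_mono)

lemma list_all2_le_trans:
  fixes s t u :: "nat list"
  shows "list_all2 (\<le>) s t \<Longrightarrow> list_all2 (\<le>) t u \<Longrightarrow> list_all2 (\<le>) s u"
  by (rule list_all2_trans[of "(\<le>)" "(\<le>)" "(\<le>)"]) auto

text \<open>The type argument only makes the number of variables explicit.\<close>

definition T_image :: "nat \<Rightarrow> nat \<Rightarrow> nat \<Rightarrow> 'n::finite itself \<Rightarrow> nat list set" where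
  "T_image p m r _ = Tmap p m ` (Omega (p ^ m) r :: ('n \<Rightarrow>\<^sub>0 nat) set)"

locale Hq_setting =
  fixes p m r :: nat and ta :: "'a::{finite,field} itself" and tn :: "'n::finite itself"
  assumes prime: "prime p" and card: "CARD('a) = p ^ m"
begin

abbreviation "K \<equiv> (ring_of_type_algebra :: 'a ring)"
abbreviation "G \<equiv> (GL :: ('a^'n^'n) monoid)"
abbreviation "V \<equiv> (fun_rep :: ('a, 'a^'n \<Rightarrow> 'a, 'a^'n^'n) gmod)"
abbreviation "H \<equiv> (Hq (int r) :: ('a, ('a^'n \<Rightarrow> 'a) set, 'a^'n^'n) gmod)"
abbreviation "Om \<equiv> (Omega (p ^ m) r :: ('n \<Rightarrow>\<^sub>0 nat) set)"
abbreviation "TOm \<equiv> T_image p m r tn"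
abbreviation "M I \<equiv> (M_ideal p m r I :: ('a^'n \<Rightarrow> 'a) set set)"
abbreviation "tops \<equiv> (top_space r :: ('n \<Rightarrow> nat) set \<Rightarrow> ('a^'n \<Rightarrow> 'a) set)"

definition proj :: "('a^'n \<Rightarrow> 'a) \<Rightarrow> ('a^'n \<Rightarrow> 'a) set" where
  "proj f = tops {} +>\<^bsub>V\<^esub> f"

definition exps :: "nat list set \<Rightarrow> ('n \<Rightarrow> nat) set" where
  "exps I = lookup ` {i \<in> Om. Tmap p m i \<in> I}"

definition ideal :: "nat list set \<Rightarrow> bool" where
  "ideal I \<longleftrightarrow> I \<subseteq> TOm \<and> (\<forall>t\<in>I. \<forall>t'\<in>TOm. list_all2 (\<le>) t' t \<longrightarrow> t' \<in> I)"

lemma in_TOm: "t \<in> TOm \<longleftrightarrow> (\<exists>i\<in>Om. t = Tmap p m i)"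
  by (auto simp: T_image_def)

lemma Tmap_in_TOm: "i \<in> Om \<Longrightarrow> Tmap p m i \<in> TOm"
  by (auto simp: in_TOm)

lemma lookup_in_idx: "lookup i \<in> idx CARD('a) r \<longleftrightarrow> i \<in> Om"
proof -
  have "a < p ^ m \<longleftrightarrow> a \<le> p ^ m - 1" for a
    using prime_gt_0_nat[OF prime] by (simp add: less_Suc_eq_le[symmetric])
  then show ?thesis by (simp add: idx_def Omega_def red_exps_def abs_index_def card)
qed

lemma lookup_in_exps: "lookup i \<in> exps I \<longleftrightarrow> i \<in> Om \<and> Tmap p m i \<in> I"
  unfolding exps_def using lookup_bij by (auto simp: bij_def inj_on_def)

lemma exps_subset_idx: "exps I \<subseteq> idx CARD('a) r"
  by (auto simp: exps_def lookup_in_idx)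

lemma ex_lookup: "\<exists>i. (e :: 'n \<Rightarrow> nat) = lookup i"
  using bij_is_surj[OF lookup_bij] by (auto simp: surj_def)

lemma exps_Int: "exps (I \<inter> I') = exps I \<inter> exps I'"
proof (rule Set.set_eqI)
  fix e :: "'n \<Rightarrow> nat"
  obtain i where "e = lookup i" using ex_lookup by blast
  then show "e \<in> exps (I \<inter> I') \<longleftrightarrow> e \<in> exps I \<inter> exps I'" by (auto simp: lookup_in_exps)
qed

lemma exps_Un: "exps (I \<union> I') = exps I \<union> exps I'"
  by (auto simp: exps_def)

lemma down_closed_exps:
  assumes "ideal I" shows "down_closed p m r (exps I)"
  unfolding down_closed_def
proof (intro ballI impI)
  fix e e' :: "'n \<Rightarrow> nat"
  assume A: "e \<in> exps I" "e' \<in> red_exps (p ^ m)" "sum e' UNIV = r"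
    "\<forall>k\<le>m. mod_sum p e' k \<le> mod_sum p e k"
  obtain i i' where i: "e = lookup i" "e' = lookup i'"
    using ex_lookup by metis
  have "i' \<in> Om" using A i card by (simp add: idx_def flip: lookup_in_idx)
  moreover have "list_all2 (\<le>) (Tmap p m i') (Tmap p m i)" using A(4) by (simp add: Tmap_le_iff i)
  ultimately show "e' \<in> exps I"
    using assms A(1) Tmap_in_TOm unfolding i lookup_in_exps ideal_def by blast
qed

text \<open>Exponents with the same value of \<open>T\<close> lie below each other, so a down-closed
  set of exponents of degree \<open>r\<close> is a union of whole fibres and comes from its image
  under \<open>T\<close>.\<close>

lemma ideal_of_down_closed:
  assumes "down_closed p m r J" "J \<subseteq> idx CARD('a) r"
  shows "\<exists>I. ideal I \<and> J = exps I"
proof -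
  define I where "I = {Tmap p m i |i. lookup i \<in> J}"
  have J: "lookup i' \<in> J"
    if "lookup i \<in> J" "i' \<in> Om" "list_all2 (\<le>) (Tmap p m i') (Tmap p m i)" for i i'
    using assms(1) that card unfolding down_closed_def Tmap_le_iff lookup_in_idx[symmetric]
    by (auto simp: idx_def)
  have "ideal I"
    unfolding ideal_def
  proof (intro conjI ballI impI)
    show "I \<subseteq> TOm" using assms(2) lookup_in_idx Tmap_in_TOm unfolding I_def by blast
    fix t t' assume "t \<in> I" "t' \<in> TOm" "list_all2 (\<le>) t' t"
    then show "t' \<in> I" using J by (auto simp: I_def in_TOm)
  qed
  moreover have "lookup i \<in> J \<longleftrightarrow> lookup i \<in> exps I" for i
  proof
    assume "lookup i \<in> J"
    then show "lookup i \<in> exps I"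
      using assms(2) by (auto simp: lookup_in_exps I_def simp flip: lookup_in_idx)
  next
    assume "lookup i \<in> exps I"
    then obtain i' where "i \<in> Om" "lookup i' \<in> J" "Tmap p m i = Tmap p m i'"
      by (auto simp: lookup_in_exps I_def)
    then show "lookup i \<in> J" using J[of i' i] by (simp add: list.rel_refl)
  qed
  then have "e \<in> J \<longleftrightarrow> e \<in> exps I" for e using ex_lookup[of e] by (elim exE) simp
  then have "J = exps I" by (rule Set.set_eqI)
  ultimately show ?thesis by blast
qed

sublocale V: linear_rep G K V
  by (rule linear_rep_fun_rep)

lemma subrep_top:
  assumes "down_closed p m r J" shows "subrep G K (tops J) V"
  unfolding subrep_iff_invariant using invariant_top_space[OF prime card assms] top_space_zero by blast

lemma subrep_top_UNIV: "subrep G K (tops UNIV) V" and subrep_top_empty: "subrep G K (tops {}) V"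
  by (rule subrep_top, simp add: down_closed_def)+

lemma rep_epi_proj: "rep_epi G K (V.vs (tops UNIV)) H proj"
  and kern_proj: "rep_epi.kern (V.vs (tops UNIV)) H proj = tops {}"
  using V.rep_epi_subquot[OF subrep_top_UNIV subrep_top_empty top_space_mono[OF empty_subsetI]]
  unfolding Hq_def RM_eq_top_space proj_def[abs_def] by auto

sublocale h: rep_epi G K "V.vs (tops UNIV)" H proj
  by (rule rep_epi_proj)

lemma top_subset_UNIV: "tops J \<subseteq> tops UNIV"
  by (rule top_space_mono) simp

lemma subrep_top_UNIV_iff:
  "subrep G K W (V.vs (tops UNIV)) \<longleftrightarrow> subrep G K W V \<and> W \<subseteq> tops UNIV"
  by (rule V.subrep_restrict_iff[OF subrep_top_UNIV])

lemma proj_add: "f \<in> tops UNIV \<Longrightarrow> g \<in> tops UNIV \<Longrightarrow> proj (\<lambda>x. f x + g x) = proj f \<oplus>\<^bsub>H\<^esub> proj g"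
  using h.f_add[of f g] by simp

lemma proj_scale: "f \<in> tops UNIV \<Longrightarrow> proj (\<lambda>x. c * f x) = c \<odot>\<^bsub>H\<^esub> proj f"
  using h.f_smult[of c f] by simp

lemma proj_zero: "proj (\<lambda>x. 0) = \<zero>\<^bsub>H\<^esub>"
  using h.f0_is_0 by simp

lemma proj_eq_zero_iff: "f \<in> tops UNIV \<Longrightarrow> proj f = \<zero>\<^bsub>H\<^esub> \<longleftrightarrow> f \<in> tops {}"
  using kern_proj by (auto simp: h.kern_def)

lemma mon_in_top_UNIV: "e \<in> red_exps CARD('a) \<Longrightarrow> sum e UNIV \<le> r \<Longrightarrow> mon e \<in> tops UNIV"
  by (intro mon_in_top_space) auto

lemma subrep_image_top:
  assumes "ideal I" shows "subrep G K (proj ` tops (exps I)) H"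
  by (rule h.subrep_image) (use subrep_top_UNIV_iff subrep_top[OF down_closed_exps[OF assms]] top_subset_UNIV in blast)

text \<open>\<open>M I\<close> is defined as a span of classes; it becomes the image of a space of
  functions, since monomials of lower degree have class zero.\<close>

lemma M_eq:
  assumes "ideal I" shows "M I = proj ` tops (exps I)"
proof -
  let ?S = "monom_class (int r) ` {i \<in> Omega (p ^ m) r. Tmap p m i \<in> I} :: ('a^'n \<Rightarrow> 'a) set set"
  have sub: "LinearCombinations.submodule K (proj ` tops (exps I)) H"
    using subrep_image_top[OF assms] by (simp add: subrep_def)
  have cls: "monom_class (int r) i = proj (mon (lookup i))" for i
    by (simp add: monom_class_def proj_def RM_eq_top_space monom_fun_eq_mon)
  have S: "?S = (\<lambda>e. proj (mon e)) ` exps I"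
    unfolding exps_def by (simp add: cls image_image card)
  have mon: "mon e \<in> tops (exps I)" if "e \<in> exps I" for e
    using that mon_in_top_space_iff exps_subset_idx by blast
  have S_sub: "?S \<subseteq> proj ` tops (exps I)" using mon unfolding S by (auto intro: imageI)
  then have "h.Z.span ?S \<subseteq> proj ` tops (exps I)"
    by (rule h.Z.span_is_subset[OF _ sub])
  moreover have "proj ` tops (exps I) \<subseteq> h.Z.span ?S"
  proof
    fix y assume "y \<in> proj ` tops (exps I)"
    then obtain f where f: "f \<in> tops (exps I)" "y = proj f" by blast
    have Sc: "?S \<subseteq> carrier H"
      using S_sub h.Z.subrep_subset[OF subrep_image_top[OF assms]] by (rule order_trans)
    note span = h.Z.span_is_submodule[OF Sc, unfolded LinearCombinations.submodule_def]
    let ?U = "{f \<in> tops UNIV. proj f \<in> h.Z.span ?S}"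
    have "f \<in> ?U"
    proof (rule top_space_induct[OF f(1)])
      show "(\<lambda>x. 0) \<in> ?U" using span by (simp add: top_space_zero proj_zero)
      show "(\<lambda>x. f x + g x) \<in> ?U" if "f \<in> ?U" "g \<in> ?U" for f g
        using that span by (simp add: top_space_add proj_add)
      fix c :: 'a and e :: "'n \<Rightarrow> nat"
      assume e: "e \<in> red_exps CARD('a)" "sum e UNIV < r \<or> sum e UNIV = r \<and> e \<in> exps I"
      then have me: "mon e \<in> tops UNIV" by (intro mon_in_top_UNIV) auto
      have "proj (mon e) \<in> h.Z.span ?S"
      proof (cases "e \<in> exps I")
        case True
        then show ?thesis using h.Z.in_own_span[OF Sc] unfolding S by blast
      next
        case False
        then have "mon e \<in> tops {}" using e by (intro mon_in_top_space) auto
        then show ?thesis using proj_eq_zero_iff[OF me] span by simp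
      qed
      then show "(\<lambda>x. c * mon e x) \<in> ?U" using span me by (simp add: top_space_scale proj_scale)
    qed
    then show "y \<in> h.Z.span ?S" using f(2) by simp
  qed
  ultimately show ?thesis by (simp add: M_ideal_def)
qed

lemma vimage_M:
  assumes "ideal I" shows "{f \<in> tops UNIV. proj f \<in> M I} = tops (exps I)"
proof -
  have "subrep G K (tops (exps I)) (V.vs (tops UNIV))"
    using subrep_top_UNIV_iff subrep_top[OF down_closed_exps[OF assms]] top_subset_UNIV by blast
  moreover have "h.kern \<subseteq> tops (exps I)" unfolding kern_proj by (rule top_space_mono) simp
  ultimately show ?thesis using h.vimage_image[of "tops (exps I)"] by (simp add: M_eq[OF assms])
qed

lemma subrep_M: "ideal I \<Longrightarrow> subrep G K (M I) H"
  by (simp add: M_eq subrep_image_top)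

text \<open>The classification applies to the preimage of \<open>W\<close> in
  \<open>R_q(r,n)\<close>, which contains the kernel \<open>R_q(r-1,n)\<close>; pushing forward
  recovers \<open>W\<close> because \<open>proj\<close> is onto.\<close>

lemma subrep_cases:
  assumes "subrep G K W H" shows "\<exists>I. ideal I \<and> W = M I"
proof -
  define W' where "W' = {f \<in> tops UNIV. proj f \<in> W}"
  have "subrep G K W' (V.vs (tops UNIV))"
    using h.subrep_vimage[OF assms] by (simp add: W'_def)
  then have W': "invariant W'" "W' \<subseteq> tops UNIV" using subrep_top_UNIV_iff subrep_iff_invariant by blast+
  moreover have "tops {} \<subseteq> W'"
  proof
    fix f assume f: "f \<in> tops {}"
    then have "f \<in> tops UNIV" using top_subset_UNIV by blast
    then show "f \<in> W'"
      using proj_eq_zero_iff[of f] f h.Z.subrep_zero[OF assms] by (simp add: W'_def)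
  qed
  moreover define J where "J = {e \<in> idx CARD('a) r. mon e \<in> W'}"
  ultimately have J: "W' = tops J" "down_closed p m r J"
    unfolding J_def using invariant_eq_top_space[OF prime card, of W'] by simp_all
  moreover have "J \<subseteq> idx CARD('a) r" by (simp add: J_def)
  ultimately obtain I where "ideal I" "J = exps I" using ideal_of_down_closed by metis
  then have I: "ideal I" "W' = tops (exps I)" using J by simp_all
  have "x \<in> proj ` W'" if x: "x \<in> W" for x
  proof -
    have "x \<in> proj ` tops UNIV" using h.Z.subrep_carrierD[OF assms x] h.surj by simp
    then obtain f where "f \<in> tops UNIV" "x = proj f" by blast
    then show ?thesis using x by (simp add: W'_def)
  qed
  moreover have "proj ` W' \<subseteq> W" unfolding W'_def by (rule image_subsetI) simp
  ultimately have "W = proj ` W'" by blast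
  then show ?thesis using I M_eq by blast
qed

lemma M_subset_iff:
  assumes "ideal I" "ideal I'" shows "M I \<subseteq> M I' \<longleftrightarrow> I \<subseteq> I'"
proof
  assume "M I \<subseteq> M I'"
  then have sub: "tops (exps I) \<subseteq> tops (exps I')" using vimage_M assms by blast
  show "I \<subseteq> I'"
  proof
    fix t assume t: "t \<in> I"
    then obtain i where i: "i \<in> Om" "t = Tmap p m i" using assms(1) in_TOm unfolding ideal_def by blast
    then have "mon (lookup i) \<in> tops (exps I)"
      using t mon_in_top_space_iff lookup_in_idx lookup_in_exps by blast
    then have "mon (lookup i) \<in> tops (exps I')" using sub by blast
    then show "t \<in> I'" using i mon_in_top_space_iff lookup_in_idx lookup_in_exps by blast
  qed
next
  assume "I \<subseteq> I'"
  then have "tops (exps I) \<subseteq> tops (exps I')" by (intro top_space_mono) (auto simp: exps_def)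
  then show "M I \<subseteq> M I'" using assms by (auto simp: M_eq)
qed

lemma M_eq_iff: "ideal I \<Longrightarrow> ideal I' \<Longrightarrow> M I = M I' \<longleftrightarrow> I = I'"
  using M_subset_iff[of I I'] M_subset_iff[of I' I] by auto

lemma ideal_empty: "ideal {}" and ideal_TOm: "ideal TOm"
  by (auto simp: ideal_def)

lemma ideal_Int: "ideal I \<Longrightarrow> ideal I' \<Longrightarrow> ideal (I \<inter> I')"
  and ideal_Un: "ideal I \<Longrightarrow> ideal I' \<Longrightarrow> ideal (I \<union> I')"
  unfolding ideal_def by blast+

lemma M_empty: "M {} = {\<zero>\<^bsub>H\<^esub>}"
proof -
  have "M {} = proj ` tops {}" using M_eq[OF ideal_empty] by (simp add: exps_def)
  also have "\<dots> = {\<zero>\<^bsub>H\<^esub>}" 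
    using proj_eq_zero_iff top_subset_UNIV[of "{}"] proj_zero top_space_zero
    by (auto intro!: image_eqI[of _ _ "\<lambda>x. 0"])
  finally show ?thesis .
qed

lemma M_TOm: "M TOm = carrier H"
proof -
  have "e \<in> exps TOm" if "e \<in> idx CARD('a) r" for e
    using ex_lookup[of e] that by (auto simp: lookup_in_exps lookup_in_idx Tmap_in_TOm)
  then have "tops (exps TOm) = tops UNIV"
    unfolding top_space_def idx_def by blast
  then show ?thesis using M_eq[OF ideal_TOm] h.surj by simp
qed

text \<open>In general the image of an intersection can be smaller than the intersection of the
  images. By \<open>vimage_M\<close> the function spaces are full preimages, so one representative
  serves both ideals.\<close>

lemma M_Int:
  assumes "ideal I" "ideal I'" shows "M I \<inter> M I' = M (I \<inter> I')"
proof -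
  note M_eqs = M_eq[OF assms(1)] M_eq[OF assms(2)] M_eq[OF ideal_Int[OF assms]]
  have "x \<in> M (I \<inter> I')" if x: "x \<in> M I" "x \<in> M I'" for x
  proof -
    have "x \<in> proj ` tops (exps I)" using x(1) unfolding M_eqs(1) .
    then obtain f where f: "f \<in> tops (exps I)" "x = proj f" by blast
    have "f \<in> tops UNIV" using f(1) top_subset_UNIV by blast
    then have "f \<in> tops (exps I')" using x(2) f(2) vimage_M[OF assms(2)] by auto
    then have "f \<in> tops (exps (I \<inter> I'))" using f(1) unfolding exps_Int top_space_Int[symmetric] by simp
    then show ?thesis unfolding M_eqs(3) f(2) by (rule imageI)
  qed
  moreover have "M (I \<inter> I') \<subseteq> M I" "M (I \<inter> I') \<subseteq> M I'"
    using M_subset_iff[OF ideal_Int[OF assms]] assms by auto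
  ultimately show ?thesis by blast
qed

lemma M_Un:
  assumes "ideal I" "ideal I'" "x \<in> M (I \<union> I')"
  shows "\<exists>y\<in>M I. \<exists>z\<in>M I'. x = y \<oplus>\<^bsub>H\<^esub> z"
proof -
  obtain f where f: "f \<in> tops (exps I \<union> exps I')" "x = proj f"
    using assms(3) M_eq[OF ideal_Un[OF assms(1,2)]] by (auto simp: exps_Un)
  obtain g h where gh: "g \<in> tops (exps I)" "h \<in> tops (exps I')" "f = (\<lambda>x. g x + h x)"
    using top_space_Un[OF f(1)] by blast
  have "g \<in> tops UNIV" "h \<in> tops UNIV" using gh(1,2) top_subset_UNIV by blast+
  then have "x = proj g \<oplus>\<^bsub>H\<^esub> proj h" unfolding f(2) gh(3) by (rule proj_add)
  moreover have "proj g \<in> M I" "proj h \<in> M I'"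
    using gh(1,2) unfolding M_eq[OF assms(1)] M_eq[OF assms(2)] by (auto intro: imageI)
  ultimately show ?thesis by blast
qed

section \<open>Composition series\<close>

definition below :: "nat list \<Rightarrow> nat list set" where
  "below t = {t' \<in> TOm. list_all2 (\<le>) t' t}"

lemma self_in_below: "t \<in> TOm \<Longrightarrow> t \<in> below t"
  by (simp add: below_def list.rel_refl)

lemma ideal_below: "ideal (below t)"
  unfolding ideal_def below_def using list_all2_le_trans by blast

lemma ideal_below_minus: "ideal (below t - {t})"
proof -
  have "t' \<noteq> t" if "list_all2 (\<le>) t' s" "list_all2 (\<le>) s t" "s \<noteq> t" for s t'
    using list_all2_le_sum_list(1)[OF that(1)] list_all2_le_sum_list(2)[OF that(2,3)] by auto
  then show ?thesis unfolding ideal_def below_def using list_all2_le_trans by blast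
qed

abbreviation "F t \<equiv> (M_factor p m r t :: ('a, ('a^'n \<Rightarrow> 'a) set set, 'a^'n^'n) gmod)"

lemma M_factor_eq: "F t = subquot H (M (below t)) (M (below t - {t}))"
  unfolding M_factor_def Let_def below_def T_image_def ..

text \<open>Adding to \<open>I\<close> an element of \<open>I' - I\<close> with least entry sum
  always gives an ideal, since whatever lies strictly below it has smaller sum and is already in
  \<open>I\<close>. If nothing lies strictly between the ideals, this must be
  \<open>I'\<close>.\<close>

lemma simple_subquot_M_iff:
  assumes "ideal I" "ideal I'" "I \<subseteq> I'"
  shows "simple_rep G K (subquot H (M I') (M I)) \<longleftrightarrow> (\<exists>t. t \<notin> I \<and> I' = insert t I)"
proof -
  have "simple_rep G K (subquot H (M I') (M I)) \<longleftrightarrow>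
      M I' \<noteq> M I \<and> (\<forall>U. subrep G K U H \<and> M I \<subseteq> U \<and> U \<subseteq> M I' \<longrightarrow> U = M I \<or> U = M I')"
    using assms by (intro h.Z.simple_subquot_iff subrep_M) (simp_all add: M_subset_iff)
  also have "\<dots> \<longleftrightarrow> I' \<noteq> I \<and> (\<forall>J. ideal J \<and> I \<subseteq> J \<and> J \<subseteq> I' \<longrightarrow> J = I \<or> J = I')" (is "?L \<longleftrightarrow> ?R")
  proof
    assume L: ?L
    show ?R
    proof (intro conjI allI impI)
      show "I' \<noteq> I" using L by blast
      fix J assume J: "ideal J \<and> I \<subseteq> J \<and> J \<subseteq> I'"
      then have "M J = M I \<or> M J = M I'" using L subrep_M[of J] M_subset_iff assms by simp
      then show "J = I \<or> J = I'" using M_eq_iff J assms by simp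
    qed
  next
    assume R: ?R
    show ?L
    proof (intro conjI allI impI)
      show "M I' \<noteq> M I" using R M_eq_iff assms by simp
      fix U assume U: "subrep G K U H \<and> M I \<subseteq> U \<and> U \<subseteq> M I'"
      then obtain J where J: "ideal J" "U = M J" using subrep_cases[OF conjunct1[OF U]] by blast
      then have "J = I \<or> J = I'" using R U M_subset_iff assms by simp
      then show "U = M I \<or> U = M I'" using J by blast
    qed
  qed
  also have "\<dots> \<longleftrightarrow> (\<exists>t. t \<notin> I \<and> I' = insert t I)"
  proof
    assume R: "I' \<noteq> I \<and> (\<forall>J. ideal J \<and> I \<subseteq> J \<and> J \<subseteq> I' \<longrightarrow> J = I \<or> J = I')"
    then obtain t0 where "t0 \<in> I' - I" using assms(3) by blast
    then obtain t where t: "t \<in> I' - I" "\<And>s. s \<in> I' - I \<Longrightarrow> sum_list t \<le> sum_list s"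
      using ex_has_least_nat[of "\<lambda>t. t \<in> I' - I" t0 sum_list] by blast
    have "ideal (insert t I)"
      unfolding ideal_def
    proof (intro conjI ballI impI)
      show "insert t I \<subseteq> TOm" using t(1) assms by (auto simp: ideal_def)
      fix s s' assume s: "s \<in> insert t I" "s' \<in> TOm" "list_all2 (\<le>) s' s"
      have "s' \<in> I" if "s = t" "s' \<noteq> t"
      proof -
        have "s' \<in> I'" using s t(1) assms(2) that unfolding ideal_def by blast
        moreover have "sum_list s' < sum_list t" using list_all2_le_sum_list(2) s that by blast
        ultimately show ?thesis using t(2)[of s'] by (meson DiffI not_less)
      qed
      then show "s' \<in> insert t I" using s assms(1) unfolding ideal_def by blast
    qed
    then have "insert t I = I'" using R t(1) assms(3) by blast
    then show "\<exists>t. t \<notin> I \<and> I' = insert t I" using t(1) by blast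
  qed blast
  finally show ?thesis .
qed

text \<open>Second isomorphism theorem for \<open>insert t I = I \<union> below t\<close> and
  \<open>I \<inter> below t = below t - {t}\<close>: up to isomorphism the factor depends on
  \<open>t\<close> alone, not on the chain in which \<open>t\<close> is added.\<close>

lemma factor_iso:
  assumes I: "ideal I" "ideal (insert t I)" "t \<notin> I"
  shows "rep_iso G K (subquot H (M (insert t I)) (M I)) (F t)"
  unfolding M_factor_eq
proof (rule h.Z.second_iso)
  have t: "t \<in> TOm" using I(2) by (simp add: ideal_def)
  have bI: "below t \<subseteq> insert t I"
    using I(2) unfolding ideal_def below_def by blast
  have Un: "insert t I = I \<union> below t" using bI self_in_below[OF t] by blast
  have Int: "I \<inter> below t = below t - {t}" using bI I(3) by blast
  show "subrep G K (M (insert t I)) H" "subrep G K (M I) H" "subrep G K (M (below t)) H"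
    "subrep G K (M (below t - {t})) H"
    using I ideal_below ideal_below_minus by (simp_all add: subrep_M)
  show "M I \<subseteq> M (insert t I)" "M (below t) \<subseteq> M (insert t I)"
    using I ideal_below bI by (simp_all add: M_subset_iff subset_insertI)
  show "M I \<inter> M (below t) = M (below t - {t})"
    using M_Int[OF I(1) ideal_below] by (simp add: Int)
  show "\<exists>b\<in>M I. \<exists>c\<in>M (below t). a = b \<oplus>\<^bsub>H\<^esub> c" if "a \<in> M (insert t I)" for a
    using M_Un[OF I(1) ideal_below] that unfolding Un .
qed

lemma finite_Om: "finite Om"
proof -
  have "finite (lookup ` Om)"
    by (rule finite_subset[OF _ finite_idx[of "CARD('a)" r]]) (auto simp: lookup_in_idx)
  then show ?thesis using lookup_bij by (simp add: finite_image_iff bij_def inj_on_def)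
qed

lemma finite_TOm: "finite TOm"
  by (simp add: T_image_def finite_Om)

text \<open>The induction removes an element of largest entry sum; no other element of the ideal
  lies above it, so an ideal remains.\<close>

lemma ideal_chain:
  assumes "finite I" "ideal I"
  shows "\<exists>l J. J 0 = {} \<and> J l = I \<and> (\<forall>i\<le>l. ideal (J i)) \<and> (\<forall>i<l. \<exists>t. t \<notin> J i \<and> J (Suc i) = insert t (J i))"
  using assms
proof (induction "card I" arbitrary: I)
  case 0
  then show ?case by (intro exI[of _ 0] exI[of _ "\<lambda>_. {}"]) (simp add: ideal_empty)
next
  case (Suc k)
  then have "Max (sum_list ` I) \<in> sum_list ` I" by (intro Max_in) auto
  then obtain t where t: "t \<in> I" "sum_list t = Max (sum_list ` I)" by auto
  have mx: "sum_list s \<le> sum_list t" if "s \<in> I" for s using that Suc.prems t(2) by simp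
  have "ideal (I - {t})"
    unfolding ideal_def
  proof (intro conjI ballI impI)
    show "I - {t} \<subseteq> TOm" using Suc.prems by (auto simp: ideal_def)
    fix s s' assume s: "s \<in> I - {t}" "s' \<in> TOm" "list_all2 (\<le>) s' s"
    have "s' \<in> I" using s Suc.prems unfolding ideal_def by blast
    moreover have "s' \<noteq> t"
    proof
      assume "s' = t"
      then have "sum_list t < sum_list s" using list_all2_le_sum_list(2)[OF s(3)] s(1) by blast
      then show False using mx[of s] s(1) by simp
    qed
    ultimately show "s' \<in> I - {t}" by blast
  qed
  moreover have "k = card (I - {t})" using Suc.hyps(2) t(1) Suc.prems by simp
  ultimately obtain l J where J: "J 0 = {}" "J l = I - {t}" "\<forall>i\<le>l. ideal (J i)"
    "\<forall>i<l. \<exists>t. t \<notin> J i \<and> J (Suc i) = insert t (J i)"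
    using Suc.hyps(1)[of "I - {t}"] Suc.prems(1) by auto
  define J' where "J' i = (if i \<le> l then J i else I)" for i
  have "\<exists>t. t \<notin> J' i \<and> J' (Suc i) = insert t (J' i)" if "i < Suc l" for i
  proof (cases "i = l")
    case True
    then show ?thesis using J(2) t(1) by (intro exI[of _ t]) (auto simp: J'_def)
  next
    case False
    then show ?thesis using J(4) that by (simp add: J'_def)
  qed
  moreover have "J' 0 = {}" "J' (Suc l) = I" "\<forall>i\<le>Suc l. ideal (J' i)"
    using J Suc.prems(2) by (auto simp: J'_def)
  ultimately show ?case by blast
qed

lemma linear_rep_H: "linear_rep G K H"
  by (rule h.Z.linear_rep_axioms)

lemma composition_series_exists: "\<exists>l W. composition_series G K H l W"
proof -
  obtain l J where J: "J 0 = {}" "J l = TOm" "\<And>i. i \<le> l \<Longrightarrow> ideal (J i)"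
    "\<And>i. i < l \<Longrightarrow> \<exists>t. t \<notin> J i \<and> J (Suc i) = insert t (J i)"
    using ideal_chain[OF finite_TOm ideal_TOm] by blast
  have "M (J i) \<subseteq> M (J (Suc i)) \<and> simple_rep G K (subquot H (M (J (Suc i))) (M (J i)))" if "i < l" for i
  proof -
    have id: "ideal (J i)" "ideal (J (Suc i))" using J(3)[of i] J(3)[of "Suc i"] that by simp_all
    have sub: "J i \<subseteq> J (Suc i)" using J(4)[OF that] by blast
    show ?thesis using simple_subquot_M_iff[OF id sub] J(4)[OF that] M_subset_iff[OF id] sub by simp
  qed
  then have "composition_series G K H l (\<lambda>i. M (J i))"
    unfolding composition_series_def using J(1,2,3) linear_rep_H by (simp add: M_empty M_TOm subrep_M)
  then show ?thesis by blast
qed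

text \<open>A series is a chain of ideals from \<open>{}\<close> to \<open>TOm\<close> that grows by
  one element per step. The added elements enumerate \<open>TOm\<close>, which gives length and
  bijection for every series directly, without a Jordan-Hoelder argument.\<close>

lemma composition_series_factors:
  assumes "composition_series G K H l W"
  shows "l = card TOm \<and> (\<exists>\<sigma>. bij_betw \<sigma> {..<l} TOm \<and>
    (\<forall>i<l. rep_iso G K (subquot H (W (Suc i)) (W i)) (F (\<sigma> i))))"
proof -
  have W0: "W 0 = {\<zero>\<^bsub>H\<^esub>}" and Wl: "W l = carrier H" and sub: "\<And>i. i \<le> l \<Longrightarrow> subrep G K (W i) H"
    and step: "\<And>i. i < l \<Longrightarrow> W i \<subseteq> W (Suc i) \<and> simple_rep G K (subquot H (W (Suc i)) (W i))"
    using assms unfolding composition_series_def by blast+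
  have "\<forall>i. \<exists>I. i \<le> l \<longrightarrow> ideal I \<and> W i = M I" using sub subrep_cases by blast
  then obtain J where "\<forall>i. i \<le> l \<longrightarrow> ideal (J i) \<and> W i = M (J i)" by (rule choice[THEN exE])
  then have id: "\<And>i. i \<le> l \<Longrightarrow> ideal (J i)" and W: "\<And>i. i \<le> l \<Longrightarrow> W i = M (J i)" by blast+
  have "M (J 0) = M {}" using W[OF le0] unfolding W0 M_empty by (rule sym)
  then have J0: "J 0 = {}" using M_eq_iff[OF id[OF le0] ideal_empty] by blast
  have "M (J l) = M TOm" using W[OF order_refl] unfolding Wl M_TOm by (rule sym)
  then have Jl: "J l = TOm" using M_eq_iff[OF id[OF order_refl] ideal_TOm] by blast
  have "\<exists>t. t \<notin> J i \<and> J (Suc i) = insert t (J i)" if i: "i < l" for i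
  proof -
    have il: "i \<le> l" "Suc i \<le> l" using i by simp_all
    have s: "J i \<subseteq> J (Suc i)"
      using step[OF i] M_subset_iff[OF id[OF il(1)] id[OF il(2)]] unfolding W[OF il(1)] W[OF il(2)] by blast
    show ?thesis
      using step[OF i] simple_subquot_M_iff[OF id[OF il(1)] id[OF il(2)] s]
      unfolding W[OF il(1)] W[OF il(2)] by blast
  qed
  then have "\<forall>i. \<exists>t. i < l \<longrightarrow> t \<notin> J i \<and> J (Suc i) = insert t (J i)" by blast
  then obtain \<sigma> where "\<forall>i. i < l \<longrightarrow> \<sigma> i \<notin> J i \<and> J (Suc i) = insert (\<sigma> i) (J i)"
    by (rule choice[THEN exE])
  then have \<sigma>: "\<And>i. i < l \<Longrightarrow> \<sigma> i \<notin> J i" "\<And>i. i < l \<Longrightarrow> J (Suc i) = insert (\<sigma> i) (J i)" by blast+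
  have "bij_betw \<sigma> {..<i} (J i)" if "i \<le> l" for i
    using that
  proof (induction i)
    case (Suc i)
    then show ?case using \<sigma>[of i] bij_betw_combine[of \<sigma> "{..<i}" "J i" "{i}" "{\<sigma> i}"]
      by (simp add: lessThan_Suc)
  qed (simp add: J0 bij_betw_def)
  from this[of l] have bij: "bij_betw \<sigma> {..<l} TOm" by (simp add: Jl)
  have "rep_iso G K (subquot H (W (Suc i)) (W i)) (F (\<sigma> i))" if i: "i < l" for i
  proof -
    have il: "i \<le> l" "Suc i \<le> l" using i by simp_all
    have "ideal (insert (\<sigma> i) (J i))" using id[OF il(2)] unfolding \<sigma>(2)[OF i] .
    from factor_iso[OF id[OF il(1)] this \<sigma>(1)[OF i]] show ?thesis
      unfolding W[OF il(1)] W[OF il(2)] \<sigma>(2)[OF i] .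
  qed
  then show ?thesis using bij bij_betw_same_card[OF bij] by auto
qed

section \<open>Factors as images of spaces of functions\<close>

abbreviation "Q C D \<equiv> subquot H (M C) (M D)"

text \<open>The composite of both quotient maps. Factors are quotients of quotients; reaching them
  directly from functions makes vanishing in a factor a condition on coefficients.\<close>

definition fproj :: "nat list set \<Rightarrow> ('a^'n \<Rightarrow> 'a) \<Rightarrow> ('a^'n \<Rightarrow> 'a) set set" where
  "fproj D f = M D +>\<^bsub>H\<^esub> proj f"

lemma rep_epi_fproj:
  assumes C: "ideal C" and D: "ideal D" and "D \<subseteq> C"
  shows "rep_epi G K (V.vs (tops (exps C))) (Q C D) (fproj D)"
    and "f \<in> tops (exps C) \<Longrightarrow> fproj D f = \<zero>\<^bsub>Q C D\<^esub> \<longleftrightarrow> f \<in> tops (exps D)"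
proof -
  have DC: "M D \<subseteq> M C" using assms M_subset_iff by simp
  note s = h.Z.rep_epi_subquot(1)[OF subrep_M[OF C] subrep_M[OF D] DC]
  note c = V.linear_rep_restrict[OF subrep_top[OF down_closed_exps[OF C]]]
  have U: "f \<in> tops UNIV" if "f \<in> tops (exps C)" for f using that top_subset_UNIV by blast
  have pr: "proj f \<in> M C" if "f \<in> tops (exps C)" for f
    unfolding M_eq[OF C] using that by (rule imageI)
  show "rep_epi G K (V.vs (tops (exps C))) (Q C D) (fproj D)"
  proof (intro rep_epi.intro rep_epi_axioms.intro c rep_epi.axioms(2)[OF s])
    show "fproj D \<in> module_hom K (V.vs (tops (exps C))) (Q C D)"
      unfolding module_hom_def
    proof (intro CollectI conjI allI impI Pi_I)
      fix f assume "f \<in> carrier (V.vs (tops (exps C)))"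
      then show "fproj D f \<in> carrier (Q C D)"
        using rep_epi.f_im[OF s, of "proj f"] pr[of f] by (simp add: fproj_def)
    next
      fix f g assume "f \<in> carrier (V.vs (tops (exps C))) \<and> g \<in> carrier (V.vs (tops (exps C)))"
      then show "fproj D (f \<oplus>\<^bsub>V.vs (tops (exps C))\<^esub> g) =
          fproj D f \<oplus>\<^bsub>Q C D\<^esub> fproj D g"
        using rep_epi.f_add[OF s, of "proj f" "proj g"] pr[of f] pr[of g] proj_add[of f g] U[of f] U[of g]
        by (simp add: fproj_def)
    next
      fix c f assume "c \<in> carrier K \<and> f \<in> carrier (V.vs (tops (exps C)))"
      then show "fproj D (c \<odot>\<^bsub>V.vs (tops (exps C))\<^esub> f) = c \<odot>\<^bsub>Q C D\<^esub> fproj D f"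
        using rep_epi.f_smult[OF s, of c "proj f"] pr[of f] proj_scale[of f c] U[of f]
        by (simp add: fproj_def)
    qed
    have "fproj D ` tops (exps C) = (\<lambda>v. M D +>\<^bsub>H\<^esub> v) ` M C"
      unfolding M_eq[OF C] image_image fproj_def ..
    then show "fproj D ` carrier (V.vs (tops (exps C))) = carrier (Q C D)"
      using rep_epi.surj[OF s] by simp
    fix g f assume g: "g \<in> carrier G" and f: "f \<in> carrier (V.vs (tops (exps C)))"
    then have "proj (act V g f) = act H g (proj f)" using h.equivariant[of g f] U[of f] by simp
    then show "fproj D (act (V.vs (tops (exps C))) g f) = act (Q C D) g (fproj D f)"
      using rep_epi.equivariant[OF s, of g "proj f"] g f pr[of f] by (simp add: fproj_def)
  qed
  assume f: "f \<in> tops (exps C)"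
  have "fproj D f = \<zero>\<^bsub>Q C D\<^esub> \<longleftrightarrow> proj f \<in> M D"
    using h.Z.rep_epi_subquot(2)[OF subrep_M[OF C] subrep_M[OF D] DC] pr[OF f]
    unfolding rep_epi.kern_def[OF s] fproj_def by auto
  also have "\<dots> \<longleftrightarrow> f \<in> tops (exps D)" unfolding vimage_M[OF D, symmetric] using U[OF f] by simp
  finally show "fproj D f = \<zero>\<^bsub>Q C D\<^esub> \<longleftrightarrow> f \<in> tops (exps D)" .
qed

text \<open>The expression \<open>E\<close> depends only on \<open>e\<close>: quantifying over
  \<open>C\<close> and \<open>D\<close> after it is what lets the same operator be compared on two
  different factors.\<close>

lemma projector_gexp:
  assumes "e \<in> idx CARD('a) r"
  shows "\<exists>E. gexp_on G K E \<and> (\<forall>C D. \<forall>f\<in>tops (exps C). ideal C \<longrightarrow> ideal D \<longrightarrow> D \<subseteq> C \<longrightarrow>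
    ev (Q C D) E (fproj D f) = fproj D (\<lambda>x. coef e f * mon e x) \<and>
    (\<lambda>x. coef e f * mon e x) \<in> tops (exps C))"
proof -
  obtain L where L: "realizable L" "\<And>f. f \<in> tops UNIV \<Longrightarrow> (\<lambda>x. L f x - coef e f * mon e x) \<in> tops {}"
    using projector[OF prime card assms] by blast
  obtain E where E: "gexp_on G K E" "\<And>f. ev V E f = L f"
    using L(1) unfolding realizable_def by blast
  have "ev (Q C D) E (fproj D f) = fproj D (\<lambda>x. coef e f * mon e x) \<and>
      (\<lambda>x. coef e f * mon e x) \<in> tops (exps C)"
    if f: "f \<in> tops (exps C)" and C: "ideal C" and D: "ideal D" "D \<subseteq> C" for C D f
  proof -
    note r = rep_epi_fproj(1)[OF C D]
    have fe: "(\<lambda>x. coef e f * mon e x) \<in> tops (exps C)"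
    proof (cases "coef e f = 0")
      case False
      then have "e \<in> exps C" using f assms by (auto simp: top_space_def idx_def)
      then show ?thesis using mon_in_top_space_iff[OF assms] by (intro top_space_scale) simp
    qed (simp add: top_space_zero)
    define d where "d = (\<lambda>x. L f x - coef e f * mon e x)"
    have "d \<in> tops {}" unfolding d_def using f top_subset_UNIV by (intro L(2)) blast
    then have d: "d \<in> tops (exps C)" "d \<in> tops (exps D)"
      using top_space_mono[of "{}"] by blast+
    have "fproj D (ev (V.vs (tops (exps C))) E f) = ev (Q C D) E (fproj D f)"
    proof (rule ev_equivariant[OF rep_epi.axioms(1,2)[OF r] rep_epi.hom[OF r] _ E(1)])
      show "f \<in> carrier (V.vs (tops (exps C)))" using f by simp
    qed (rule rep_epi.equivariant[OF r])
    then have "ev (Q C D) E (fproj D f) = fproj D (ev (V.vs (tops (exps C))) E f)"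
      by (rule sym)
    also have "\<dots> = fproj D (\<lambda>x. coef e f * mon e x + d x)"
      by (simp add: ev_restrict E(2) d_def)
    also have "\<dots> = fproj D (\<lambda>x. coef e f * mon e x)"
      using rep_epi.f_add_zero[OF r, of "\<lambda>x. coef e f * mon e x" d] fe d
        rep_epi_fproj(2)[OF C D d(1)] by simp
    finally show ?thesis using fe by blast
  qed
  then show ?thesis using E(1) by blast
qed

section \<open>The factors\<close>

abbreviation "\<rho> t \<equiv> fproj (below t - {t})"
abbreviation "tops_below t \<equiv> tops (exps (below t))"

lemma rep_epi_\<rho>: "rep_epi G K (V.vs (tops_below t)) (F t) (\<rho> t)"
  unfolding M_factor_eq by (rule rep_epi_fproj(1)[OF ideal_below ideal_below_minus]) blast

lemma \<rho>_eq_zero_iff: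
  "f \<in> tops_below t \<Longrightarrow> \<rho> t f = \<zero>\<^bsub>F t\<^esub> \<longleftrightarrow> f \<in> tops (exps (below t - {t}))"
  unfolding M_factor_eq by (rule rep_epi_fproj(2)[OF ideal_below ideal_below_minus]) blast

lemma projector_F:
  assumes "e \<in> idx CARD('a) r"
  shows "\<exists>E. gexp_on G K E \<and> (\<forall>t. \<forall>f\<in>tops_below t. ev (F t) E (\<rho> t f) = \<rho> t (\<lambda>x. coef e f * mon e x) \<and>
    (\<lambda>x. coef e f * mon e x) \<in> tops_below t)"
proof -
  have "below t - {t} \<subseteq> below t" for t by blast
  then show ?thesis
    using projector_gexp[OF assms] ideal_below ideal_below_minus unfolding M_factor_eq by meson
qed

lemma mon_in_tops_below:
  assumes "i \<in> Om" shows "mon (lookup i) \<in> tops_below (Tmap p m i)"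
  unfolding mon_in_top_space_iff[OF lookup_in_idx[THEN iffD2, OF assms]] lookup_in_exps
  using assms self_in_below[OF Tmap_in_TOm[OF assms]] by simp

lemma \<rho>_mon_nonzero:
  assumes "i \<in> Om"
  shows "\<rho> (Tmap p m i) (mon (lookup i)) \<noteq> \<zero>\<^bsub>F (Tmap p m i)\<^esub>"
  unfolding \<rho>_eq_zero_iff[OF mon_in_tops_below[OF assms]]
    mon_in_top_space_iff[OF lookup_in_idx[THEN iffD2, OF assms]] lookup_in_exps
  by simp

lemma module_F: "Module.module K (F t)"
  using rep_epi.axioms(2)[OF rep_epi_\<rho>[of t]] by (simp add: linear_rep_def vectorspace_def)

lemma factors_not_iso:
  assumes i: "i \<in> Om" and t: "t = Tmap p m i" "t \<noteq> t'"
  shows "\<not> rep_iso G K (F t) (F t')"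
proof
  assume "rep_iso G K (F t) (F t')"
  then obtain \<phi> where \<phi>: "\<phi> \<in> module_hom K (F t) (F t')" "bij_betw \<phi> (carrier (F t)) (carrier (F t'))"
    "\<And>g v. g \<in> carrier G \<Longrightarrow> v \<in> carrier (F t) \<Longrightarrow> \<phi> (act (F t) g v) = act (F t') g (\<phi> v)"
    unfolding rep_iso_def by blast
  note lin = rep_epi.axioms(2)[OF rep_epi_\<rho>]
  let ?e = "lookup i"
  have e: "?e \<in> idx CARD('a) r" using i lookup_in_idx by blast
  obtain E where E: "gexp_on G K E"
    "\<And>t f. f \<in> tops_below t \<Longrightarrow> ev (F t) E (\<rho> t f) = \<rho> t (\<lambda>x. coef ?e f * mon ?e x)"
    "\<And>t f. f \<in> tops_below t \<Longrightarrow> (\<lambda>x. coef ?e f * mon ?e x) \<in> tops_below t"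
    using projector_F[OF e] by blast
  have m: "mon ?e \<in> tops_below t" unfolding t(1) by (rule mon_in_tops_below[OF i])
  define v where "v = \<rho> t (mon ?e)"
  have v: "v \<in> carrier (F t)" unfolding v_def by (rule rep_epi.f_im[OF rep_epi_\<rho>]) (simp add: m)
  have c1: "coef ?e (mon ?e :: 'a^'n \<Rightarrow> 'a) = 1" using e by (simp add: coef_mon idx_def)
  have Ev: "ev (F t) E v = v" unfolding v_def E(2)[OF m] c1 by simp
  have "\<phi> v \<in> carrier (F t')" using \<phi>(2) v by (rule bij_betw_apply)
  then have "\<phi> v \<in> \<rho> t' ` tops_below t'" using rep_epi.surj[OF rep_epi_\<rho>, of t'] by simp
  then obtain f where f: "f \<in> tops_below t'" "\<phi> v = \<rho> t' f" by blast
  \<comment> \<open>If \<open>?e\<close> occurs in \<open>f\<close> at all, its value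
    \<open>t\<close> under \<open>T\<close> lies in \<open>below t'\<close> and differs from
    \<open>t'\<close>. The monomial thus vanishes in \<open>F t'\<close>, so \<open>E\<close>
    annihilates that factor.\<close>
  have "(\<lambda>x. coef ?e f * mon ?e x) \<in> tops (exps (below t' - {t'}))"
  proof (cases "coef ?e f = 0")
    case False
    then have "?e \<in> exps (below t')" using f(1) e by (auto simp: top_space_def idx_def)
    then have "?e \<in> exps (below t' - {t'})" using t by (simp add: lookup_in_exps)
    then show ?thesis using mon_in_top_space_iff[OF e] by (intro top_space_scale) blast
  qed (simp add: top_space_zero)
  then have z: "ev (F t') E (\<phi> v) = \<zero>\<^bsub>F t'\<^esub>"
    unfolding f(2) E(2)[OF f(1)] using \<rho>_eq_zero_iff[OF E(3)[OF f(1)]] by blast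
  have "\<phi> (ev (F t) E v) = ev (F t') E (\<phi> v)"
    by (rule ev_equivariant[OF lin lin \<phi>(1) _ E(1) v]) (rule \<phi>(3))
  then have "\<phi> v = \<zero>\<^bsub>F t'\<^esub>" unfolding Ev z .
  moreover have "\<phi> \<zero>\<^bsub>F t\<^esub> = \<zero>\<^bsub>F t'\<^esub>"
    by (rule mod_hom.f0_is_0[where R = K]) (intro mod_hom.intro mod_hom_axioms.intro module_F \<phi>(1))
  moreover have "\<zero>\<^bsub>F t\<^esub> \<in> carrier (F t)"
    using linear_rep.subrep_zero[OF lin linear_rep.subrep_carrier[OF lin]] .
  ultimately have "\<phi> v = \<phi> \<zero>\<^bsub>F t\<^esub>" "\<zero>\<^bsub>F t\<^esub> \<in> carrier (F t)" by simp_all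
  then have "v = \<zero>\<^bsub>F t\<^esub>"
    using \<phi>(2) v by (meson bij_betw_imp_inj_on inj_onD)
  then show False using \<rho>_mon_nonzero[OF i] t(1) by (simp add: v_def)
qed

lemma dim_factor:
  assumes t: "t \<in> TOm"
  shows "vectorspace.dim K (F t) = card {i \<in> Om. Tmap p m i = t}"
proof -
  note r = rep_epi_\<rho>[of t]
  let ?S = "{i \<in> Om. Tmap p m i = t}"
  define b where "b i = \<rho> t (mon (lookup i))" for i :: "'n \<Rightarrow>\<^sub>0 nat"
  have m: "mon (lookup i) \<in> tops_below t" if "i \<in> ?S" for i
    using mon_in_tops_below[of i] that by auto
  have b0: "b i \<noteq> \<zero>\<^bsub>F t\<^esub>" if "i \<in> ?S" for i
    using \<rho>_mon_nonzero[of i] that by (auto simp: b_def)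
  have bc: "b i \<in> carrier (F t)" if "i \<in> ?S" for i
    unfolding b_def by (rule rep_epi.f_im[OF r]) (simp add: m[OF that])
  have proj: "\<exists>E. gexp_on G K E \<and> (\<forall>k\<in>?S. ev (F t) E (b k) = (if k = i then b i else \<zero>\<^bsub>F t\<^esub>))"
    if i: "i \<in> ?S" for i
  proof -
    let ?e = "lookup i"
    have e: "?e \<in> idx CARD('a) r" using i lookup_in_idx by blast
    obtain E where E: "gexp_on G K E"
      "\<And>f. f \<in> tops_below t \<Longrightarrow> ev (F t) E (\<rho> t f) = \<rho> t (\<lambda>x. coef ?e f * mon ?e x)"
      using projector_F[OF e] by blast
    have "ev (F t) E (b k) = (if k = i then b i else \<zero>\<^bsub>F t\<^esub>)" if k: "k \<in> ?S" for k
    proof -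
      have "lookup k \<in> idx CARD('a) r" using k lookup_in_idx by blast
      then have "coef ?e (mon (lookup k) :: 'a^'n \<Rightarrow> 'a) =
          (if ?e = lookup k then 1 else 0)"
        using e by (intro coef_mon) (simp_all add: idx_def)
      also have "?e = lookup k \<longleftrightarrow> k = i"
        unfolding poly_mapping_eq_iff[of k i] by (rule eq_commute)
      finally have c: "coef ?e (mon (lookup k) :: 'a^'n \<Rightarrow> 'a) = (if k = i then 1 else 0)" .
      have "ev (F t) E (b k) = \<rho> t (\<lambda>x. (if k = i then 1 else 0) * mon ?e x)"
        unfolding b_def E(2)[OF m[OF k]] c ..
      then show ?thesis using rep_epi.f0_is_0[OF r] by (cases "k = i") (simp_all add: b_def)
    qed
    then show ?thesis using E(1) by blast
  qed
  have fin: "finite ?S" using finite_Om by simp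
  show ?thesis
  proof (rule linear_rep.dim_eq_card[OF rep_epi.axioms(2)[OF r] fin bc b0 proj])
    fix N assume N: "LinearCombinations.submodule K N (F t)" "b ` ?S \<subseteq> N"
    note N_zero = submodule.zero_closed[OF N(1)] and N_add = submodule.m_closed[OF N(1)]
      and N_smult = submodule.smult_closed[OF N(1)]
    show "carrier (F t) \<subseteq> N"
    proof
      fix w assume "w \<in> carrier (F t)"
      then have "w \<in> \<rho> t ` tops_below t" using rep_epi.surj[OF r] by simp
      then obtain f where f: "f \<in> tops_below t" "w = \<rho> t f" by blast
      let ?U = "{f \<in> tops_below t. \<rho> t f \<in> N}"
      have "f \<in> ?U"
      proof (rule top_space_induct[OF f(1)])
        show "(\<lambda>x. 0) \<in> ?U" using rep_epi.f0_is_0[OF r] N_zero by (simp add: top_space_zero)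
        show "(\<lambda>x. f x + g x) \<in> ?U" if "f \<in> ?U" "g \<in> ?U" for f g
          using that N_add[of "\<rho> t f" "\<rho> t g"] rep_epi.f_add[OF r, of f g] by (simp add: top_space_add)
        fix c :: 'a and e :: "'n \<Rightarrow> nat"
        assume e: "e \<in> red_exps CARD('a)" "sum e UNIV < r \<or> sum e UNIV = r \<and> e \<in> exps (below t)"
        have me: "mon e \<in> tops_below t" using e by (intro mon_in_top_space) auto
        have "\<rho> t (mon e) \<in> N"
        proof (cases "mon e \<in> tops (exps (below t - {t}))")
          case True
          then show ?thesis using \<rho>_eq_zero_iff[OF me] N_zero by simp
        next
          case False
          \<comment> \<open>A monomial that survives in the factor has a value of \<open>T\<close>
            in \<open>below t\<close> but not in \<open>below t - {t}\<close>, hence equal to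
            \<open>t\<close>, and so is one of the generators.\<close>
          then have e': "e \<in> exps (below t)" "e \<notin> exps (below t - {t})"
            using e mon_in_top_space[of e r "exps (below t - {t})"] by fastforce+
          obtain i where i: "e = lookup i" using ex_lookup by blast
          then have "i \<in> ?S" using e' by (auto simp: lookup_in_exps)
          then have "\<rho> t (mon e) \<in> b ` ?S" unfolding i b_def[symmetric] by (rule imageI)
          then show ?thesis using N(2) by blast
        qed
        then show "(\<lambda>x. c * mon e x) \<in> ?U"
          using me N_smult[of c "\<rho> t (mon e)"] rep_epi.f_smult[OF r, of c "mon e"] by (simp add: top_space_scale)
      qed
      then show "w \<in> N" using f(2) by simp
    qed
  qed
qed

lemma card_fibre:
  assumes "t \<in> TOm"
  shows "int (card {i \<in> Om. Tmap p m i = t}) =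
    (\<Prod>j<m. \<Sum>k = 0..s_coord p t j div p.
      (- 1) ^ k * int (CARD('n) choose k) * int ((CARD('n) - 1 + s_coord p t j - k * p) choose (CARD('n) - 1)))"
proof -
  obtain i0 where i0: "i0 \<in> Om" "t = Tmap p m i0" using assms in_TOm by blast
  have "card {i \<in> Om. Tmap p m i = t} =
      (\<Prod>j<m. card {c :: 'n \<Rightarrow> nat. (\<forall>k. c k < p) \<and> sum c UNIV = s_coord p t j})"
    unfolding i0(2) by (rule card_Tmap_fibre[OF prime_gt_1_nat[OF prime] i0(1)])
  then show ?thesis
    using card_bounded_compositions[where 'n = 'n, OF prime_gt_0_nat[OF prime]] by simp
qed

end

theorem theorem4p4:
  fixes p m r :: nat
  assumes "prime p" and "m \<ge> 1"
    and "CARD('a::{finite,field}) = p ^ m"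
    and "1 \<le> r" and "r \<le> CARD('n::finite) * (CARD('a) - 1)"
  shows
    "let K = (ring_of_type_algebra :: 'a ring);
         G = (GL :: ('a^'n^'n) monoid);
         H = (Hq (int r) :: ('a, ('a^'n \<Rightarrow> 'a) set, 'a^'n^'n) gmod);
         \<MM> = (M_factor p m r :: nat list \<Rightarrow> ('a, ('a^'n \<Rightarrow> 'a) set set, 'a^'n^'n) gmod);
         \<Omega> = (Omega (CARD('a)) r :: ('n \<Rightarrow>\<^sub>0 nat) set);
         T\<Omega> = Tmap p m ` \<Omega>;
         n = CARD('n)
     in
       (\<exists>l W. composition_series G K H l W) \<and>
       (\<forall>l W. composition_series G K H l W \<longrightarrow>
          l = card T\<Omega> \<and>
          (\<exists>\<sigma>. bij_betw \<sigma> {..<l} T\<Omega> \<and>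
               (\<forall>i<l. rep_iso G K (subquot H (W (Suc i)) (W i)) (\<MM> (\<sigma> i))))) \<and>
       (\<forall>t\<in>T\<Omega>. \<forall>t'\<in>T\<Omega>. t \<noteq> t' \<longrightarrow> \<not> rep_iso G K (\<MM> t) (\<MM> t')) \<and>
       (\<forall>t\<in>T\<Omega>.
          VectorSpace.vectorspace.dim K (\<MM> t) = card {i \<in> \<Omega>. Tmap p m i = t} \<and>
          int (card {i \<in> \<Omega>. Tmap p m i = t}) =
            (\<Prod>j<m. \<Sum>k = 0..s_coord p t j div p.
               (- 1) ^ k * int (n choose k) * int ((n - 1 + s_coord p t j - k * p) choose (n - 1))))"
proof -
  interpret Hq_setting p m r "TYPE('a)" "TYPE('n)"
    by (rule Hq_setting.intro) (use assms in auto)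
  have T: "Tmap p m ` Om = TOm" by (simp add: T_image_def)
  show ?thesis
    unfolding Let_def assms(3) T
  proof (intro conjI allI impI ballI)
    show "\<exists>l W. composition_series G K H l W" by (rule composition_series_exists)
  next
    fix l W assume "composition_series G K H l W"
    from composition_series_factors[OF this]
    show "l = card TOm" "\<exists>\<sigma>. bij_betw \<sigma> {..<l} TOm \<and>
        (\<forall>i<l. rep_iso G K (subquot H (W (Suc i)) (W i)) (F (\<sigma> i)))" by blast+
  next
    fix t t' assume "t \<in> TOm" "t' \<in> TOm" "t \<noteq> t'"
    then show "\<not> rep_iso G K (F t) (F t')" using in_TOm factors_not_iso by blast
  next
    fix t assume "t \<in> TOm"
    then show "vectorspace.dim K (F t) = card {i \<in> Om. Tmap p m i = t}"
      "int (card {i \<in> Om. Tmap p m i = t}) =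
        (\<Prod>j<m. \<Sum>k = 0..s_coord p t j div p. (- 1) ^ k * int (CARD('n) choose k) *
          int ((CARD('n) - 1 + s_coord p t j - k * p) choose (CARD('n) - 1)))"
      by (rule dim_factor, rule card_fibre)
  qed
qed

end
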